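(* For any integers $k\geq 3$ and $1\leq \ell<k/2$, there exists $\xi>0$ such that the following holds for all sufficiently large $n$. Suppose $\mathcal{H}$ is a $k$-uniform hypergraph on $n$ vertices with $n\in(k-\ell)\mathbb{N}$ such that $\mathcal{H}$ is $(\ell,\xi)$-extremal and \[ \delta_{k-2}(\mathcal{H}) > \delta_{k-2}(\mathcal{X}_{k,\ell}(n)). \] Then $\mathcal{H}$ contains a Hamiltonian $\ell$-cycle.
   Context: For a $k$-uniform hypergraph $\mathcal{H}=(V,E)$ and $S\subseteq V$ with $|S|=s$, $d(S)$ is the number of edges containing $S$, and $\delta_s(\mathcal{H})=\min_{|S|=s} d(S)$. For $X\subseteq V$, $e(X)$ is the number of edges contained in $X$. $\mathcal{H}$ is called $(\ell,\xi)$-extremal if there is a partition $V=A\,\dot\cup\, B$ with $|A|=\lceil \frac{n}{2(k-\ell)}-1\rceil$, $|B|=\lfloor \frac{2(k-\ell)-1}{2(k-\ell)}n+1\rfloor$ and $e(B)\leq \xi\binom{n}{k}$. A $k$-uniform hypergraph is an $\ell$-cycle if there is a cyclic ordering of its vertices such that every edge consists of $k$ consecutive vertices, two (vertex-wise) consecutive edges share exactly $\ell$ vertices, and every vertex lies in an edge; a Hamiltonian $\ell$-cycle of $\mathcal{H}$ is an $\ell$-cycle in $\mathcal{H}$ covering all vertices. The hypergraph $\mathcal{X}_{k,\ell}(n)$ on vertex set $V$, $|V|=n\in(k-\ell)\mathbb{N}$: if $n=(2m+1)(k-\ell)$, fix $A\subset V$ with $|A|=\lfloor n/(2(k-\ell))\rfloor$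 and take as edges all $k$-sets meeting $A$; if $n=2m(k-\ell)$, fix $A\subset V$ with $|A|=n/(2(k-\ell))-1$, fix a set $F$ of $\ell+1$ vertices in $B=V\setminus A$, and take as edges all $k$-sets meeting $A$ together with all $k$-subsets of $B$ containing $F$. *)

theory Defs
  imports Complex_Main
begin

text \<open>A hypergraph is given by its vertex set \<open>V\<close> and its edge set \<open>E\<close>.\<close>

definition uniform_hypergraph :: "nat \<Rightarrow> 'a set \<Rightarrow> 'a set set \<Rightarrow> bool" where
  "uniform_hypergraph k V E \<longleftrightarrow> finite V \<and> (\<forall>e\<in>E. e \<subseteq> V \<and> card e = k)"

definition degree :: "'a set set \<Rightarrow> 'a set \<Rightarrow> nat" where
  "degree E S = card {e \<in> E. S \<subseteq> e}"

text \<open>Only meaningful for finite \<open>V\<close> with \<open>s \<le> card V\<close>, since \<open>Min {}\<close> is unspecified.\<close>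

definition min_degree :: "nat \<Rightarrow> 'a set \<Rightarrow> 'a set set \<Rightarrow> nat" where
  "min_degree s V E = Min (degree E ` {S. S \<subseteq> V \<and> card S = s})"

definition edges_within :: "'a set set \<Rightarrow> 'a set \<Rightarrow> nat" where
  "edges_within E X = card {e \<in> E. e \<subseteq> X}"

definition extremal :: "nat \<Rightarrow> nat \<Rightarrow> real \<Rightarrow> 'a set \<Rightarrow> 'a set set \<Rightarrow> bool" where
  "extremal k l \<xi> V E \<longleftrightarrow>
    (\<exists>A B. A \<union> B = V \<and> A \<inter> B = {}
      \<and> int (card A) = \<lceil>real (card V) / (2 * (real k - real l)) - 1\<rceil>
      \<and> int (card B) = \<lfloor>(2 * (real k - real l) - 1) / (2 * (real k - real l)) * real (card V) + 1\<rfloor>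
      \<and> real (edges_within E B) \<le> \<xi> * real (card V choose k))"

text \<open>The \<open>k\<close> consecutive vertices starting at position \<open>i\<close> in the cyclic ordering
  \<open>v 0, \<dots>, v (n - 1)\<close>; positions are read modulo \<open>n\<close>.\<close>

definition segment :: "nat \<Rightarrow> nat \<Rightarrow> (nat \<Rightarrow> 'a) \<Rightarrow> nat \<Rightarrow> 'a set" where
  "segment k n v i = (\<lambda>j. v ((i + j) mod n)) ` {..<k}"

text \<open>Two edges are consecutive when, going round the cyclic ordering from the first vertex of
  one, the next position at which an edge starts is the first vertex of the other.\<close>

definition consecutive_edges ::
  "nat \<Rightarrow> nat \<Rightarrow> (nat \<Rightarrow> 'a) \<Rightarrow> 'a set set \<Rightarrow> 'a set \<Rightarrow> 'a set \<Rightarrow> bool" where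
  "consecutive_edges k n v E e f \<longleftrightarrow>
    (\<exists>i d. i < n \<and> 0 < d \<and> d < n
      \<and> e = segment k n v i \<and> e \<in> E
      \<and> f = segment k n v (i + d) \<and> f \<in> E
      \<and> (\<forall>c. 0 < c \<and> c < d \<longrightarrow> segment k n v (i + c) \<notin> E))"

definition ell_cycle :: "nat \<Rightarrow> nat \<Rightarrow> 'a set \<Rightarrow> 'a set set \<Rightarrow> bool" where
  "ell_cycle k l V E \<longleftrightarrow> uniform_hypergraph k V E \<and>
    (\<exists>v. bij_betw v {..<card V} V
      \<and> (\<forall>e\<in>E. \<exists>i<card V. e = segment k (card V) v i)
      \<and> (\<forall>e f. consecutive_edges k (card V) v E e f \<longrightarrow> card (e \<inter> f) = l)
      \<and> (\<forall>x\<in>V. \<exists>e\<in>E. x \<in> e))"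

definition has_hamiltonian_ell_cycle :: "nat \<Rightarrow> nat \<Rightarrow> 'a set \<Rightarrow> 'a set set \<Rightarrow> bool" where
  "has_hamiltonian_ell_cycle k l V E \<longleftrightarrow> (\<exists>C\<subseteq>E. ell_cycle k l V C)"

text \<open>The edge set of the hypergraph \<open>X_{k,l}(n)\<close> on the vertex set \<open>{..<n}\<close>, for \<open>k - l\<close> dividing
  \<open>n > 0\<close>. The fixed sets are \<open>A = {..<a}\<close> and \<open>F = {a..a + l}\<close>; any other choice of vertex set,
  \<open>A\<close> and \<open>F\<close> of these sizes gives an isomorphic hypergraph.\<close>

definition X_edges :: "nat \<Rightarrow> nat \<Rightarrow> nat \<Rightarrow> nat set set" where
  "X_edges k l n =
    (if odd (n div (k - l))
     then let A = {..<n div (2 * (k - l))}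
          in {e. e \<subseteq> {..<n} \<and> card e = k \<and> e \<inter> A \<noteq> {}}
     else let a = n div (2 * (k - l)) - 1; A = {..<a}; B = {..<n} - A; F = {a..a + l}
          in {e. e \<subseteq> {..<n} \<and> card e = k \<and> e \<inter> A \<noteq> {}} \<union> {e. e \<subseteq> B \<and> card e = k \<and> F \<subseteq> e})"

end

theory Submission
  imports Defs
begin

text \<open>
  Choose the partition \<open>A \<union> B\<close> with as few edges in \<open>B\<close> as possible. The degree condition forces
  almost every \<open>k\<close>-set with exactly one vertex in \<open>A\<close> to be an edge, and only few vertices lie in many
  exceptions. The cycle is put together from vertex-disjoint short paths with well-behaved
  ends (\<open>l\<close>-sets) and, between consecutive paths, slots containing two edges through one
  typical vertex of \<open>A\<close>. Exceptional vertices that see many edges into \<open>B\<close> are covered by paths with two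
  edges. Since all other vertices of \<open>A\<close> can serve two edges each, one or two edges inside \<open>B\<close> are needed
  besides, two more for each vertex of \<open>A\<close> that behaves like a vertex of \<open>B\<close>; the first ones exist because
  the degree exceeds that of \<open>X_{k,l}(n)\<close>, the others because every vertex of the latter kind forces
  many edges in \<open>B\<close>. All remaining paths are single \<open>l\<close>-sets, chosen by a potential function argument such
  that no vertex is in conflict with many of them, and then the slots can be filled by exchanges along
  Latin squares. The constants are powers of a single small number \<open>h\<close>.
\<close>

section \<open>Cyclic sequences of blocks\<close>

text \<open>Why non-edges across are rare: a \<open>(k - 2)\<close>-set \<open>S\<close> misses
  fewer pairs than \<open>B - S\<close> contains, so each missing pair that meets \<open>A\<close>
  is paid for by a pair inside \<open>B\<close> that completes \<open>S\<close> to an edge. The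
  obstacle is exactness. The cycle has \<open>N = n / (k - l)\<close> edges, \<open>N\<close> is
  \<open>2 * card A + 1\<close> or \<open>2 * card A + 2\<close>, and because
  \<open>2 * l < k\<close> a vertex lies in at most two edges. So each path gets an integer value
  \<open>contrib\<close>, and the values must sum to \<open>tau\<close> exactly. Edges in
  \<open>B\<close> yield paths of value 1 or 2, which may overshoot; paths of value -1, in which a
  vertex of \<open>Ag\<close> serves one edge only, repair this. A partition with fewest edges in
  \<open>B\<close> has misplaced vertices on one side only, so a shortage and a surplus of vertices
  for \<open>A\<close> never occur together. Scales: \<open>B\<close> spans at most
  \<open>h ^ 11 * n ^ k\<close> edge tuples; the threshold \<open>h ^ 4 * n ^ (k - 1)\<close> then
  leaves \<open>h ^ 7 * n\<close> exceptional vertices and \<open>h ^ 6 * n\<close> special paths,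
  each of which can be found while avoiding \<open>h ^ 5 * n\<close> vertices.\<close>

lemma add_mod_eq_cancel_left:
  fixes a b c n :: nat
  assumes "(a + b) mod n = (a + c) mod n"
  shows "b mod n = c mod n"
proof -
  have "int n dvd int (a + b) - int (a + c)"
    using assms by (metis mod_eq_dvd_iff of_nat_mod)
  then have "int n dvd int b - int c" by simp
  then show ?thesis by (metis mod_eq_dvd_iff of_nat_eq_iff of_nat_mod)
qed

text \<open>If the starts differ, the position just before \<open>i\<close> still lies in the
  segment at \<open>j\<close>, hence in the one at \<open>i\<close>; that segment would then go all
  the way round, against \<open>k < n\<close>.\<close>

lemma segment_eq_imp_mod_eq:
  assumes inj: "inj_on v {..<n}" and k: "0 < k" "k < n"
    and eq: "segment k n v i = segment k n v j"
  shows "i mod n = j mod n"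
proof -
  have n: "0 < n" using k by simp
  have key: "\<exists>t<k. (i + s) mod n = (j + t) mod n"
    if "s < k" "segment k n v i = segment k n v j" for i j s
  proof -
    have "v ((i + s) mod n) \<in> segment k n v j"
      using that unfolding segment_def by blast
    then obtain t where t: "t < k" "v ((i + s) mod n) = v ((j + t) mod n)"
      unfolding segment_def by auto
    have "(i + s) mod n = (j + t) mod n"
      using inj_onD[OF inj t(2)] n by simp
    with t(1) show ?thesis by blast
  qed
  obtain t where t: "t < k" "i mod n = (j + t) mod n" using key[of 0 i j] k eq by auto
  show ?thesis
  proof (cases t)
    case 0 then show ?thesis using t by simp
  next
    case (Suc u)
    obtain s where s: "s < k" "(j + u) mod n = (i + s) mod n"
      using key[of u j i] eq t(1) Suc by auto
    have "(j + u + 1) mod n = (i + s + 1) mod n" using s(2) by (metis mod_add_left_eq)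
    then have "(i + (s + 1)) mod n = (i + 0) mod n" using t(2) Suc by simp
    then have "(s + 1) mod n = 0 mod n"
      by (rule add_mod_eq_cancel_left)
    then show ?thesis using s(1) k by simp
  qed
qed

text \<open>An \<open>l\<close>-cycle is viewed as a cyclic sequence of blocks \<open>(I, J)\<close> with \<open>card I = l\<close> and
  \<open>card J = k - 2 * l\<close>; the edges are \<open>I \<union> J \<union> I'\<close> for consecutive blocks \<open>(I, J)\<close>, \<open>(I', J')\<close>.\<close>

definition link :: "'a set set \<Rightarrow> 'a set \<times> 'a set \<Rightarrow> 'a set \<times> 'a set \<Rightarrow> bool" where
  "link E p q \<longleftrightarrow> fst p \<union> snd p \<union> fst q \<in> E"

text \<open>The vertices are ordered block by block, the \<open>l\<close>-set of each block first. A
  segment that starts at a multiple of \<open>k - l\<close> is then a block followed by the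
  \<open>l\<close>-set of the next block.\<close>

lemma hamiltonian_ell_cycle_of_blocks:
  assumes H: "uniform_hypergraph k V E" and l: "1 \<le> l" "2 * l < k"
    and N: "length bl = N" and cV: "card V = N * (k - l)" and big: "2 * k \<le> card V"
    and I: "\<And>p. p \<in> set bl \<Longrightarrow> card (fst p) = l" and J: "\<And>p. p \<in> set bl \<Longrightarrow> card (snd p) = k - 2 * l"
    and U: "(\<Union>p\<in>set bl. fst p \<union> snd p) = V"
    and edge: "\<And>i. i < N \<Longrightarrow> link E (bl ! i) (bl ! (Suc i mod N))"
  shows "has_hamiltonian_ell_cycle k l V E"
proof -
  define d where "d = k - l"
  define n where "n = card V"
  have d: "0 < d" "l < d" "d + l = k" "n = N * d" "d + k \<le> n" "k < n"
    using l cV big by (auto simp: d_def n_def)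
  have N0: "0 < N" using d by (cases N) auto
  have finV: "finite V" using H by (simp add: uniform_hypergraph_def)
  have finI: "finite (fst p)" and finJ: "finite (snd p)" if "p \<in> set bl" for p
  proof -
    have "card (fst p) \<noteq> 0" "card (snd p) \<noteq> 0" using I[OF that] J[OF that] l by simp_all
    then show "finite (fst p)" "finite (snd p)" by (meson card.infinite)+
  qed
  define x1 where "x1 p = (SOME xs. set xs = fst p \<and> length xs = l)" for p :: "'a set \<times> 'a set"
  define x2 where "x2 p = (SOME xs. set xs = snd p \<and> length xs = k - 2 * l)" for p :: "'a set \<times> 'a set"
  define xl where "xl p = x1 p @ x2 p" for p
  have ex: "\<exists>xs. set xs = X \<and> length xs = q" if "finite X" "card X = q" for X :: "'a set" and q
  proof -
    obtain xs where "set xs = X" "distinct xs" using finite_distinct_list[OF \<open>finite X\<close>] by auto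
    then show ?thesis using distinct_card[of xs] that(2) by auto
  qed
  have x1: "set (x1 p) = fst p" "length (x1 p) = l" if "p \<in> set bl" for p
    using someI_ex[OF ex[OF finI[OF that] I[OF that]]] by (simp_all add: x1_def)
  have x2: "set (x2 p) = snd p" "length (x2 p) = k - 2 * l" if "p \<in> set bl" for p
    using someI_ex[OF ex[OF finJ[OF that] J[OF that]]] by (simp_all add: x2_def)
  have xl_len: "length (xl p) = d" and xl_set: "set (xl p) = fst p \<union> snd p" if "p \<in> set bl" for p
    using x1[OF that] x2[OF that] l by (auto simp: xl_def d_def)
  have xl_fst: "(\<lambda>j. xl p ! j) ` {..<l} = fst p" if "p \<in> set bl" for p
  proof -
    have "(\<lambda>j. xl p ! j) ` {..<l} = (\<lambda>j. x1 p ! j) ` {..<length (x1 p)}"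
      unfolding x1(2)[OF that] by (rule image_cong[OF refl]) (simp add: xl_def nth_append x1(2)[OF that])
    also have "\<dots> = set (x1 p)" by (auto simp: set_conv_nth)
    finally show ?thesis using x1[OF that] by simp
  qed
  define v where "v x = xl (bl ! (x div d)) ! (x mod d)" for x
  have vij: "v (i * d + j) = xl (bl ! i) ! j" if "j < d" for i j
    using that by (simp add: v_def)
  have blmem: "bl ! i \<in> set bl" if "i < N" for i using that N by simp
  have vblock: "(\<lambda>j. v (i * d + j)) ` {..<d} = fst (bl ! i) \<union> snd (bl ! i)" if "i < N" for i
  proof -
    have "(\<lambda>j. v (i * d + j)) ` {..<d} = (\<lambda>j. xl (bl ! i) ! j) ` {..<length (xl (bl ! i))}"
      unfolding xl_len[OF blmem[OF that]] by (rule image_cong[OF refl]) (simp only: vij lessThan_iff)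
    also have "\<dots> = set (xl (bl ! i))" by (auto simp: set_conv_nth)
    finally show ?thesis using xl_set[OF blmem[OF that]] by simp
  qed
  have idx: "i * d + j < n" if "i < N" "j < d" for i j
  proof -
    have "i * d + j < Suc i * d" using that by simp
    also have "\<dots> \<le> N * d" using that by (intro mult_le_mono1) simp
    finally show ?thesis using d by simp
  qed
  have vim: "v ` {..<n} = V"
  proof
    show "v ` {..<n} \<subseteq> V"
    proof
      fix y assume "y \<in> v ` {..<n}"
      then obtain x where x: "x < n" "y = v x" by auto
      have i: "x div d < N" using x(1) d by (simp add: less_mult_imp_div_less)
      have "v x \<in> (\<lambda>j. v (x div d * d + j)) ` {..<d}" using d
        by (intro image_eqI[of _ _ "x mod d"]) auto
      then show "y \<in> V" using vblock[OF i] x(2) U blmem[OF i] by blast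
    qed
    show "V \<subseteq> v ` {..<n}"
    proof
      fix y assume "y \<in> V"
      then obtain p where p: "p \<in> set bl" "y \<in> fst p \<union> snd p" using U by blast
      then obtain i where i: "i < N" "y \<in> fst (bl ! i) \<union> snd (bl ! i)"
        using N unfolding in_set_conv_nth by blast
      then obtain j where "j < d" "y = v (i * d + j)" using vblock[OF i(1)] by auto
      then show "y \<in> v ` {..<n}" using idx[OF i(1)] by blast
    qed
  qed
  \<comment> \<open>Disjointness of the blocks comes from counting: \<open>n\<close> positions cover
    \<open>n\<close> vertices.\<close>
  have inj: "inj_on v {..<n}"
    by (rule eq_card_imp_inj_on) (simp_all add: vim, simp add: n_def)
  have seg: "segment k n v (i * d) = fst (bl ! i) \<union> snd (bl ! i) \<union> fst (bl ! (Suc i mod N))"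
    if "i < N" for i
  proof -
    have spl: "{..<k} = {..<d} \<union> (\<lambda>j. d + j) ` {..<l}"
    proof
      show "{..<k} \<subseteq> {..<d} \<union> (\<lambda>j. d + j) ` {..<l}"
      proof
        fix x assume "x \<in> {..<k}"
        then have "x < d \<or> (x - d < l \<and> x = d + (x - d))" using d by auto
        then show "x \<in> {..<d} \<union> (\<lambda>j. d + j) ` {..<l}" by blast
      qed
    qed (use d in auto)
    have 1: "(\<lambda>j. v ((i * d + j) mod n)) ` {..<d} = fst (bl ! i) \<union> snd (bl ! i)"
      using vblock[OF that] idx[OF that] by simp
    have "v ((i * d + (d + j)) mod n) = xl (bl ! (Suc i mod N)) ! j" if "j < l" for j
    proof -
      have "(i * d + (d + j)) mod n = (Suc i mod N) * d + j"
      proof (cases "Suc i < N")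
        case True
        then show ?thesis using idx[OF True, of j] that d by (simp add: algebra_simps)
      next
        case False
        then have "Suc i = N" using \<open>i < N\<close> by simp
        then have e: "i * d + (d + j) = n + j" using d by (auto simp: algebra_simps)
        show ?thesis unfolding e using \<open>Suc i = N\<close> that d by (simp add: mod_less)
      qed
      then show ?thesis using vij[of j] that d by simp
    qed
    then have 2: "(\<lambda>j. v ((i * d + j) mod n)) ` (\<lambda>j. d + j) ` {..<l}
        = (\<lambda>j. xl (bl ! (Suc i mod N)) ! j) ` {..<l}"
      by (simp add: image_image)
    show ?thesis
      unfolding segment_def spl image_Un 1 2 using xl_fst[OF blmem[of "Suc i mod N"]] N0 by simp
  qed
  define C where "C = (\<lambda>i. segment k n v (i * d)) ` {..<N}"
  have CE: "C \<subseteq> E" using seg edge by (auto simp: C_def link_def)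
  \<comment> \<open>A segment determines its start modulo \<open>n\<close>, and \<open>d\<close>
    divides \<open>n\<close>. So edges start at multiples of \<open>d\<close> only, and the next
    edge starts exactly \<open>d\<close> positions later.\<close>
  have Cdvd: "d dvd i" if "segment k n v i \<in> C" for i
  proof -
    obtain p where "p < N" "segment k n v i = segment k n v (p * d)" using \<open>segment k n v i \<in> C\<close> by (auto simp: C_def)
    then have "i mod n = p * d mod n"
      using segment_eq_imp_mod_eq[OF inj _ \<open>k < n\<close>, of i "p * d"] l by simp
    then have "i mod n mod d = p * d mod n mod d" by simp
    then have "i mod d = 0" using d by (simp add: mod_mod_cancel)
    then show ?thesis by auto
  qed
  have Cmem: "segment k n v (p * d) \<in> C" if "p \<le> N" for p
  proof (cases "p < N")
    case False
    then have "segment k n v (p * d) = segment k n v (0 * d)" using that d by (simp add: segment_def)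
    then show ?thesis using N0 unfolding C_def by blast
  qed (auto simp: C_def)
  have cons: "card (e \<inter> f) = l" if ce: "consecutive_edges k n v C e f" for e f
  proof -
    obtain i D where i: "i < n" "0 < D" "D < n" "e = segment k n v i" "e \<in> C"
      "f = segment k n v (i + D)" "f \<in> C" "\<And>c. 0 < c \<Longrightarrow> c < D \<Longrightarrow> segment k n v (i + c) \<notin> C"
      using ce unfolding consecutive_edges_def by blast
    have "d dvd i" "d dvd i + D" using Cdvd i by blast+
    then have dD: "d dvd D" by (simp add: dvd_add_right_iff)
    obtain p where p: "i = p * d" using \<open>d dvd i\<close> by (metis dvd_div_mult_self)
    have "p < N" using i(1) p d by simp
    then have "segment k n v (i + d) \<in> C" using Cmem[of "Suc p"] p by (simp add: algebra_simps)
    then have "\<not> d < D" using i(8)[of d] d by auto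
    then have D: "D = d" using dD i(2) using dvd_imp_le[of d D] by linarith
    define g where "g t = v ((i + t) mod n)" for t
    have ginj: "inj_on g {..<n}"
    proof (rule inj_onI)
      fix s t assume st: "s \<in> {..<n}" "t \<in> {..<n}" "g s = g t"
      have "(i + s) mod n = (i + t) mod n"
        using inj_onD[OF inj st(3)[unfolded g_def]] i(1) by simp
      then have "s mod n = t mod n" by (rule add_mod_eq_cancel_left)
      then show "s = t" using st by simp
    qed
    have e: "e = g ` {..<k}" by (simp add: i(4) segment_def g_def)
    have f: "f = g ` {d..<d + k}"
    proof -
      have "{d..<d + k} = (\<lambda>t. d + t) ` {..<k}"
        by (simp add: lessThan_atLeast0 add.commute)
      then show ?thesis by (simp add: i(6) D segment_def g_def image_image add.assoc)
    qed
    \<comment> \<open>\<open>d + k <= n\<close> keeps \<open>f\<close> from running round into the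
      start of \<open>e\<close>.\<close>
    have "e \<inter> f = g ` ({..<k} \<inter> {d..<d + k})"
      unfolding e f by (rule inj_on_image_Int[OF ginj, symmetric]) (use d in auto)
    also have "{..<k} \<inter> {d..<d + k} = {d..<k}" by auto
    finally have "card (e \<inter> f) = card {d..<k}"
      using card_image[OF inj_on_subset[OF ginj, of "{d..<k}"]] \<open>k < n\<close> by (metis atLeastLessThan_iff lessThan_iff less_trans subsetI)
    then show ?thesis using d by simp
  qed
  have "ell_cycle k l V C"
    unfolding ell_cycle_def
  proof (intro conjI exI[of _ v])
    show "uniform_hypergraph k V C" using H CE by (auto simp: uniform_hypergraph_def)
    show "bij_betw v {..<card V} V" using inj vim by (simp add: bij_betw_def n_def)
    show "\<forall>e\<in>C. \<exists>i<card V. e = segment k (card V) v i"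
    proof
      fix e assume "e \<in> C"
      then obtain i where "i < N" "e = segment k n v (i * d)" by (auto simp: C_def)
      then show "\<exists>i<card V. e = segment k (card V) v i"
        using idx[of i 0] d unfolding n_def by (intro exI[of _ "i * d"]) simp
    qed
    show "\<forall>e f. consecutive_edges k (card V) v C e f \<longrightarrow> card (e \<inter> f) = l"
      using cons by (simp add: n_def)
    show "\<forall>x\<in>V. \<exists>e\<in>C. x \<in> e"
    proof
      fix x assume "x \<in> V"
      then obtain p where p: "p \<in> set bl" "x \<in> fst p \<union> snd p" using U by blast
      then obtain i where i: "i < N" "x \<in> fst (bl ! i) \<union> snd (bl ! i)"
        using N unfolding in_set_conv_nth by blast
      then show "\<exists>e\<in>C. x \<in> e" using seg[OF i(1)] Cmem[of i] by (metis UnI1 less_imp_le)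
    qed
  qed
  then show ?thesis using CE by (auto simp: has_hamiltonian_ell_cycle_def)
qed

lemma successively_concat_cyclic:
  assumes m: "0 < m" and ne: "\<And>t. t < m \<Longrightarrow> u t \<noteq> []"
    and s: "\<And>t. t < m \<Longrightarrow> successively P (u t)"
    and c: "\<And>t. t < m \<Longrightarrow> P (last (u t)) (hd (u (Suc t mod m)))"
    and bl: "bl = concat (map u [0..<m])" and i: "i < length bl"
  shows "P (bl ! i) (bl ! (Suc i mod length bl))"
proof -
  have pre: "successively P (concat (map u [0..<Suc j])) \<and> concat (map u [0..<Suc j]) \<noteq> []
     \<and> last (concat (map u [0..<Suc j])) = last (u j) \<and> hd (concat (map u [0..<Suc j])) = hd (u 0)"
    if "j < m" for j
    using that
  proof (induction j)
    case 0 then show ?case using s[of 0] ne[of 0] by simp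
  next
    case (Suc j)
    define xs where "xs = concat (map u [0..<Suc j])"
    have IH: "successively P xs" "xs \<noteq> []" "last xs = last (u j)" "hd xs = hd (u 0)"
      using Suc.IH Suc.prems unfolding xs_def by (simp_all del: upt_Suc)
    have "P (last (u j)) (hd (u (Suc j)))" using c[of j] Suc.prems by simp
    moreover have "concat (map u [0..<Suc (Suc j)]) = xs @ u (Suc j)"
      by (simp add: xs_def)
    ultimately show ?case using IH ne[of "Suc j"] s[of "Suc j"] Suc.prems
      by (simp add: successively_append_iff del: upt_Suc)
  qed
  have "Suc (m - 1) = m" using m by simp
  then have bl': "successively P bl" "bl \<noteq> []" "last bl = last (u (m - 1))" "hd bl = hd (u 0)"
    using pre[of "m - 1"] m by (auto simp: bl)
  show ?thesis
  proof (cases "Suc i < length bl")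
    case True
    then show ?thesis using bl'(1) by (simp add: successively_conv_nth)
  next
    case False
    then have "Suc i = length bl" using i by simp
    then have "bl ! i = last bl" "bl ! (Suc i mod length bl) = hd bl"
      using bl'(2) by (auto simp: last_conv_nth hd_conv_nth simp flip: \<open>Suc i = length bl\<close>)
    then show ?thesis using bl' c[of "m - 1"] m by simp
  qed
qed

section \<open>Tuples and Latin square exchanges\<close>

text \<open>Ordered tuples with repetition stand in for subsets: their number is an exact power,
  they can be cut and joined freely, and repetitions matter only in lower order.\<close>

definition tup :: "'b set \<Rightarrow> nat \<Rightarrow> 'b list set" where
  "tup X p = {xs. set xs \<subseteq> X \<and> length xs = p}"

lemma finite_tup [simp]: "finite X \<Longrightarrow> finite (tup X p)"
  unfolding tup_def by (rule finite_lists_length_eq)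

lemma card_tup: "finite X \<Longrightarrow> card (tup X p) = card X ^ p"
  unfolding tup_def by (rule card_lists_length_eq)

lemma tup_0 [simp]: "tup X 0 = {[]}" by (auto simp: tup_def)

lemma tup_Suc: "tup X (Suc p) = (\<lambda>(x, xs). x # xs) ` (X \<times> tup X p)"
  by (auto simp: tup_def length_Suc_conv image_iff)

text \<open>Entry \<open>j\<close> is a copy of entry \<open>i\<close>, so deleting it is
  injective.\<close>

lemma card_tup_coordinate_eq_le:
  assumes X: "finite X" and ij: "i < j" "j < p"
  shows "card {xs \<in> tup X p. xs ! i = xs ! j} \<le> card X ^ (p - 1)"
proof -
  let ?f = "\<lambda>xs. take j xs @ drop (Suc j) xs"
  have "inj_on ?f {xs \<in> tup X p. xs ! i = xs ! j}"
  proof (rule inj_onI)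
    fix xs ys assume a: "xs \<in> {xs \<in> tup X p. xs ! i = xs ! j}" "ys \<in> {xs \<in> tup X p. xs ! i = xs ! j}"
      "?f xs = ?f ys"
    have len: "length xs = p" "length ys = p" using a by (auto simp: tup_def)
    have t: "take j xs = take j ys" "drop (Suc j) xs = drop (Suc j) ys"
      using a(3) len by simp_all
    have "xs ! i = ys ! i" using arg_cong[OF t(1), of "\<lambda>z. z ! i"] ij by simp
    then have "xs ! j = ys ! j" using a by simp
    then show "xs = ys" using t id_take_nth_drop[of j xs] id_take_nth_drop[of j ys] ij len by metis
  qed
  moreover have "?f ` {xs \<in> tup X p. xs ! i = xs ! j} \<subseteq> tup X (p - 1)"
    using ij set_take_subset[of j] set_drop_subset[of "Suc j"] by (fastforce simp: tup_def)
  ultimately have "card {xs \<in> tup X p. xs ! i = xs ! j} \<le> card (tup X (p - 1))"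
    using X by (intro card_inj_on_le) auto
  then show ?thesis using X by (simp add: card_tup)
qed

lemma card_tup_member_le:
  assumes X: "finite X" and x: "finite Y"
  shows "card {xs \<in> tup X p. set xs \<inter> Y \<noteq> {}} * card X \<le> p * card Y * card X ^ p"
proof (induction p)
  case 0 then show ?case by simp
next
  case (Suc p)
  let ?B = "{xs \<in> tup X p. set xs \<inter> Y \<noteq> {}}"
  have "{xs \<in> tup X (Suc p). set xs \<inter> Y \<noteq> {}} \<subseteq>
     (\<lambda>(x, xs). x # xs) ` (Y \<times> tup X p) \<union> (\<lambda>(x, xs). x # xs) ` (X \<times> ?B)"
    by (force simp: tup_Suc)
  then have "card {xs \<in> tup X (Suc p). set xs \<inter> Y \<noteq> {}} \<le>
     card ((\<lambda>(x, xs). x # xs) ` (Y \<times> tup X p) \<union> (\<lambda>(x, xs). x # xs) ` (X \<times> ?B))"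
    using X x by (intro card_mono) auto
  also have "\<dots> \<le> card ((\<lambda>(x, xs). x # xs) ` (Y \<times> tup X p)) + card ((\<lambda>(x, xs). x # xs) ` (X \<times> ?B))"
    by (rule card_Un_le)
  also have "\<dots> \<le> card (Y \<times> tup X p) + card (X \<times> ?B)"
    using X x by (intro add_mono card_image_le) auto
  also have "\<dots> = card Y * card X ^ p + card X * card ?B"
    using X by (simp add: card_cartesian_product card_tup)
  finally have "card {xs \<in> tup X (Suc p). set xs \<inter> Y \<noteq> {}} * card X
      \<le> (card Y * card X ^ p + card ?B * card X) * card X"
    by (simp add: mult.commute)
  also have "\<dots> \<le> (card Y * card X ^ p + p * card Y * card X ^ p) * card X"
    using Suc.IH by (intro mult_le_mono1 add_left_mono)
  finally show ?case by (simp add: algebra_simps)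
qed

text \<open>Starting from an assignment with as few bad slots as possible, a bad slot and \<open>r\<close> randomly
  chosen other slots exchange their entries along the diagonals of a cyclic Latin square. Every new
  row then contains at most one element that is not random, so all new rows are good with positive
  probability.\<close>

lemma latin_exchange:
  fixes Y :: "nat \<Rightarrow> 'b set" and bad :: "nat \<Rightarrow> 'b list \<Rightarrow> bool" and \<delta> :: real
  assumes Y: "\<And>j. j < r \<Longrightarrow> finite (Y j) \<and> card (Y j) = m"
    and slot: "\<And>t. t < m \<Longrightarrow> real (card {xs. length xs = r \<and> (\<forall>j<r. xs ! j \<in> Y j) \<and> bad t xs}) \<le> \<delta> * real m ^ r"
    and elem: "\<And>j z. j < r \<Longrightarrow> z \<in> Y j \<Longrightarrow>
        real (card {(t, xs). t < m \<and> length xs = r \<and> (\<forall>j<r. xs ! j \<in> Y j) \<and> xs ! j = z \<and> bad t xs}) \<le> \<delta> * real m ^ r"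
    and small: "real (Suc r) * \<delta> + real ((Suc r)\<^sup>2) / real m < 1" and m: "0 < m" and r: "0 < r"
  shows "\<exists>F. (\<forall>j<r. bij_betw (F j) {..<m} (Y j)) \<and> (\<forall>t<m. \<not> bad t (map (\<lambda>j. F j t) [0..<r]))"
proof -
  define row where "row F t = map (\<lambda>j. F j t) [0..<r]" for F :: "nat \<Rightarrow> nat \<Rightarrow> 'b" and t
  define OK where "OK F \<longleftrightarrow> (\<forall>j<r. bij_betw (F j) {..<m} (Y j))" for F :: "nat \<Rightarrow> nat \<Rightarrow> 'b"
  define nb where "nb F = card {t. t < m \<and> bad t (row F t)}" for F
  have "\<exists>f. bij_betw f {..<m} (Y j)" if "j < r" for j
    using ex_bij_betw_nat_finite[of "Y j"] Y[OF that] by (auto simp: atLeast0LessThan)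
  then obtain F0 where "OK F0" unfolding OK_def by metis
  then obtain F where F: "OK F" and min: "\<And>G. OK G \<Longrightarrow> nb F \<le> nb G"
    using ex_has_least_nat[of OK F0 nb] by blast
  have bij: "bij_betw (F j) {..<m} (Y j)" if "j < r" for j using F that by (simp add: OK_def)
  have FY: "F j t \<in> Y j" if "j < r" "t < m" for j t using bij_betwE[OF bij[OF that(1)]] that by simp
  have Finj: "s = t" if "F j s = F j t" "j < r" "s < m" "t < m" for j s t
    using bij[OF that(2)] that by (auto simp: bij_betw_def dest: inj_onD)
  have "\<not> bad t (row F t)" if "t < m" for t
  proof
    assume bt: "bad t (row F t)"
    define q where "q = Suc r"
    have q: "0 < q" "1 < q" using r by (simp_all add: q_def)
    define H where "H = tup {..<m} r"
    have finH: "finite H" and cH: "card H = m ^ r" by (simp_all add: H_def card_tup)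
    \<comment> \<open>\<open>q = r + 1\<close> slots take part: the bad slot \<open>t\<close> has
      index 0 and the random ones follow. Coordinate \<open>j\<close> of new row \<open>i\<close>
      comes from row \<open>i + j + 1\<close> modulo \<open>q\<close>; as \<open>j < r\<close>,
      every row other than \<open>i\<close> is used exactly once.\<close>
    define new where "new hs i = map (\<lambda>j. F j ((t # hs) ! ((i + j + 1) mod q))) [0..<r]" for hs i
    have hsm: "(t # hs) ! i < m" if "hs \<in> H" "i < q" for hs i
    proof -
      have "(t # hs) ! i \<in> set (t # hs)" using that by (intro nth_mem) (simp add: H_def tup_def q_def)
      then show ?thesis using that \<open>t < m\<close> by (auto simp: H_def tup_def)
    qed
    have newY: "\<forall>j<r. new hs i ! j \<in> Y j" if "hs \<in> H" for hs i
      using FY hsm[OF that] q by (simp add: new_def)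
    \<comment> \<open>Row \<open>i\<close> reveals one entry of every other row and each
      \<open>F j\<close> is injective, so \<open>hs\<close> can be read off from the new row and the
      slot that receives it.\<close>
    have inj_new: "hs = hs'" if h: "hs \<in> H" "hs' \<in> H" and i: "i < q" and e: "(t # hs) ! i = (t # hs') ! i"
        and n: "new hs i = new hs' i" for hs hs' i
    proof (rule nth_equalityI)
      show len: "length hs = length hs'" using h by (simp add: H_def tup_def)
      fix s assume s: "s < length hs"
      then have sr: "s < r" using h by (simp add: H_def tup_def)
      show "hs ! s = hs' ! s"
      proof (cases "Suc s = i")
        case True then show ?thesis using e by auto
      next
        case False
        define j where "j = (if i \<le> s then s - i else s + q - i)"
        have "j < r" using False sr i by (auto simp: j_def q_def)
        moreover have "i + j + 1 = Suc s \<or> i + j + 1 = q + Suc s" using i by (auto simp: j_def)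
        then have "(i + j + 1) mod q = Suc s"
          using sr mod_add_self1[of q "Suc s"] by (auto simp: q_def simp del: mod_add_self1)
        ultimately have j: "j < r" "(i + j + 1) mod q = Suc s" .
        have "new hs i ! j = new hs' i ! j" using n by simp
        then have "F j (hs ! s) = F j (hs' ! s)" using j by (simp add: new_def)
        then show ?thesis using Finj[OF _ j(1)] hsm[OF h(1), of "Suc s"] hsm[OF h(2), of "Suc s"] sr
          by (simp add: q_def)
      qed
    qed
    define B where "B i = {hs \<in> H. bad ((t # hs) ! i) (new hs i)}" for i
    \<comment> \<open>Row 0 goes into the fixed slot \<open>t\<close> but holds random entries only,
      so \<open>slot\<close> applies. Row \<open>i > 0\<close> goes into a random slot and holds one
      fixed entry, \<open>F j t\<close> with \<open>j = r - i\<close>, so \<open>elem\<close>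
      applies.\<close>
    have cB: "real (card (B i)) \<le> \<delta> * real m ^ r" if i: "i < q" for i
    proof (cases i)
      case 0
      let ?S = "{xs. length xs = r \<and> (\<forall>j<r. xs ! j \<in> Y j) \<and> bad t xs}"
      have "inj_on (\<lambda>hs. new hs 0) (B 0)"
        by (rule inj_onI) (use inj_new[of _ _ 0] q in \<open>simp add: B_def\<close>)
      moreover have "(\<lambda>hs. new hs 0) ` B 0 \<subseteq> ?S"
      proof
        fix z assume "z \<in> (\<lambda>hs. new hs 0) ` B 0"
        then obtain hs where hs: "hs \<in> H" "bad t (new hs 0)" "z = new hs 0"
          by (auto simp: B_def)
        moreover have "length (new hs 0) = r" by (simp add: new_def)
        ultimately show "z \<in> ?S" using newY[OF hs(1), of 0] by simp
      qed
      moreover have "finite ?S"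
      proof (rule finite_subset)
        show "?S \<subseteq> tup (\<Union>j<r. Y j) r" by (fastforce simp: tup_def in_set_conv_nth)
        show "finite (tup (\<Union>j<r. Y j) r)" using Y by simp
      qed
      ultimately have "card (B 0) \<le> card ?S" by (intro card_inj_on_le)
      then show ?thesis using slot[OF \<open>t < m\<close>] 0 by simp
    next
      case (Suc i')
      define j where "j = r - i"
      have j: "j < r" "(i + j + 1) mod q = 0" using i Suc by (auto simp: j_def q_def)
      let ?S = "{(s, xs). s < m \<and> length xs = r \<and> (\<forall>j<r. xs ! j \<in> Y j) \<and> xs ! j = F j t \<and> bad s xs}"
      have "inj_on (\<lambda>hs. ((t # hs) ! i, new hs i)) (B i)"
        by (rule inj_onI) (use inj_new[OF _ _ i] in \<open>simp add: B_def\<close>)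
      moreover have "(\<lambda>hs. ((t # hs) ! i, new hs i)) ` B i \<subseteq> ?S"
      proof
        fix z assume "z \<in> (\<lambda>hs. ((t # hs) ! i, new hs i)) ` B i"
        then obtain hs where hs: "hs \<in> H" "bad ((t # hs) ! i) (new hs i)" "z = ((t # hs) ! i, new hs i)"
          by (auto simp: B_def)
        have "new hs i ! j = F j t" using j by (simp add: new_def)
        moreover have "length (new hs i) = r" by (simp add: new_def)
        ultimately show "z \<in> ?S" using hs newY[OF hs(1), of i] hsm[OF hs(1) i] by simp
      qed
      moreover have "finite ?S"
      proof (rule finite_subset)
        show "?S \<subseteq> {..<m} \<times> tup (\<Union>j<r. Y j) r" by (fastforce simp: tup_def in_set_conv_nth)
        show "finite ({..<m} \<times> tup (\<Union>j<r. Y j) r)" using Y by simp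
      qed
      ultimately have "card (B i) \<le> card ?S" by (intro card_inj_on_le)
      then show ?thesis using elem[OF j(1) FY[OF j(1) \<open>t < m\<close>]] by simp
    qed
    \<comment> \<open>The exchange needs distinct slots different from \<open>t\<close>; the other
      choices are a proportion of order \<open>1 / m\<close>.\<close>
    define D1 where "D1 i j = {hs \<in> H. hs ! i = hs ! j}" for i j
    define D2 where "D2 = {hs \<in> H. set hs \<inter> {t} \<noteq> {}}"
    have cD1: "card (D1 i j) \<le> m ^ (r - 1)" if "i < j" "j < r" for i j
      using card_tup_coordinate_eq_le[of "{..<m}" i j r] that by (simp add: D1_def H_def)
    have cD2: "card D2 \<le> r * m ^ (r - 1)"
    proof -
      have "card D2 * m \<le> r * m ^ r"
        using card_tup_member_le[of "{..<m}" "{t}" r] by (simp add: D2_def H_def)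
      also have "\<dots> = (r * m ^ (r - 1)) * m" using r by (cases r) (simp_all add: algebra_simps)
      finally show ?thesis using m by simp
    qed
    let ?P = "{(i, j). i < j \<and> j < r}"
    have finP: "finite ?P" by (rule finite_subset[of _ "{..<r} \<times> {..<r}"]) auto
    have cP: "card ?P \<le> r * r"
    proof -
      have "?P \<subseteq> {..<r} \<times> {..<r}" by auto
      then show ?thesis using card_mono[of "{..<r} \<times> {..<r}" ?P] by simp
    qed
    define bads where "bads = (\<Union>i<q. B i) \<union> (\<Union>(i, j)\<in>?P. D1 i j) \<union> D2"
    have "card bads \<le> card (\<Union>i<q. B i) + card (\<Union>(i, j)\<in>?P. D1 i j) + card D2"
      unfolding bads_def using card_Un_le[of "(\<Union>i<q. B i) \<union> (\<Union>(i, j)\<in>?P. D1 i j)" D2]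
        card_Un_le[of "\<Union>i<q. B i" "\<Union>(i, j)\<in>?P. D1 i j"] by linarith
    also have "card (\<Union>i<q. B i) \<le> (\<Sum>i<q. card (B i))" by (rule card_UN_le) simp
    also have "card (\<Union>(i, j)\<in>?P. D1 i j) \<le> (\<Sum>x\<in>?P. card (case x of (i, j) \<Rightarrow> D1 i j))"
      by (rule card_UN_le[OF finP])
    also have "\<dots> \<le> (\<Sum>x\<in>?P. m ^ (r - 1))" using cD1 by (intro sum_mono) auto
    also have "\<dots> \<le> r * r * m ^ (r - 1)" using cP by simp
    finally have "card bads \<le> (\<Sum>i<q. card (B i)) + r * r * m ^ (r - 1) + r * m ^ (r - 1)"
      using cD2 by linarith
    then have "real (card bads) \<le> real ((\<Sum>i<q. card (B i)) + (r * r * m ^ (r - 1) + r * m ^ (r - 1)))"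
      by (intro of_nat_mono) simp
    then have "real (card bads) \<le> (\<Sum>i<q. real (card (B i))) + real (r * r * m ^ (r - 1) + r * m ^ (r - 1))"
      by (simp only: of_nat_add of_nat_sum)
    also have "\<dots> \<le> (\<Sum>i<q. \<delta> * real m ^ r) + real (q * q) * real m ^ (r - 1)"
    proof (rule add_mono)
      show "(\<Sum>i<q. real (card (B i))) \<le> (\<Sum>i<q. \<delta> * real m ^ r)" using cB by (intro sum_mono) simp
      have "r * r * m ^ (r - 1) + r * m ^ (r - 1) \<le> q * q * m ^ (r - 1)"
        by (simp add: q_def algebra_simps)
      then show "real (r * r * m ^ (r - 1) + r * m ^ (r - 1)) \<le> real (q * q) * real m ^ (r - 1)"
        unfolding of_nat_power[symmetric] of_nat_mult[symmetric] by (rule of_nat_mono)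
    qed
    also have "\<dots> = (real q * \<delta> + real (q\<^sup>2) / real m) * real m ^ r"
      using m r by (cases r) (simp_all add: field_simps power2_eq_square)
    also have "\<dots> < 1 * real m ^ r"
      using small m by (intro mult_strict_right_mono) (simp_all add: q_def)
    finally have "card bads < card H" unfolding cH by (simp flip: of_nat_power)
    moreover have "finite bads"
      by (rule finite_subset[OF _ finH]) (auto simp: bads_def B_def D1_def D2_def)
    ultimately obtain hs where hs: "hs \<in> H" "hs \<notin> bads"
      by (metis card_mono leD subsetI)
    have len: "length hs = r" using hs by (simp add: H_def tup_def)
    have good: "\<not> bad ((t # hs) ! i) (new hs i)" if "i < q" for i
      using hs that by (auto simp: bads_def B_def)
    have "hs ! i \<noteq> hs ! j" if "i < j" "j < r" for i j
      using hs that by (auto simp: bads_def D1_def)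
    then have "distinct hs" unfolding distinct_conv_nth len by (metis linorder_neqE_nat)
    moreover have "t \<notin> set hs" using hs by (auto simp: bads_def D2_def)
    ultimately have dist: "distinct (t # hs)" by simp
    define h where "h i = (t # hs) ! i" for i
    have hinj: "inj_on h {..<q}" using dist len by (auto simp: h_def inj_on_def nth_eq_iff_index_eq q_def)
    have hm: "h i < m" if "i < q" for i using hsm[OF hs(1) that] by (simp add: h_def)
    define \<pi> where "\<pi> j s = (if s \<in> h ` {..<q} then h ((the_inv_into {..<q} h s + j + 1) mod q) else s)" for j s
    have pih: "\<pi> j (h i) = h ((i + j + 1) mod q)" if "i < q" for i j
      using that hinj by (simp add: \<pi>_def the_inv_into_f_f)
    have pio: "\<pi> j s = s" if "s \<notin> h ` {..<q}" for j s using that by (simp add: \<pi>_def)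
    have pim: "\<pi> j s < m" if "s < m" for j s
      using that hm q by (simp add: \<pi>_def)
    have pisurj: "{..<m} \<subseteq> \<pi> j ` {..<m}" for j
    proof
      fix s assume s: "s \<in> {..<m}"
      show "s \<in> \<pi> j ` {..<m}"
      proof (cases "s \<in> h ` {..<q}")
        case True
        then obtain i where i: "i < q" "s = h i" by auto
        \<comment> \<open>This subtracts \<open>j + 1\<close> modulo \<open>q\<close> without
          leaving the naturals.\<close>
        define i' where "i' = (i + (q * (j + 1) - (j + 1))) mod q"
        have "(i' + j + 1) mod q = (i + (q * (j + 1) - (j + 1)) + (j + 1)) mod q"
          unfolding i'_def by (metis add.assoc mod_add_left_eq)
        also have "i + (q * (j + 1) - (j + 1)) + (j + 1) = i + q * (j + 1)"
        proof -
          have "j + 1 \<le> q * (j + 1)" using q by (metis mult_le_mono1 nat_mult_1 less_imp_le)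
          then show ?thesis by (simp only: add.assoc le_add_diff_inverse2)
        qed
        finally have "(i' + j + 1) mod q = i" using i by (simp only: mod_mult_self2 mod_less)
        then have "\<pi> j (h i') = s" using pih[of i' j] i q by (simp add: i'_def)
        then show ?thesis using hm[of i'] q by (auto simp: i'_def image_iff)
      next
        case False then show ?thesis using pio[OF False] s by (metis image_eqI)
      qed
    qed
    have pibij: "bij_betw (\<pi> j) {..<m} {..<m}" for j
    proof -
      have "\<pi> j ` {..<m} = {..<m}" using pisurj[of j] pim by auto
      then show ?thesis by (simp add: bij_betw_def eq_card_imp_inj_on)
    qed
    define G where "G j s = F j (\<pi> j s)" for j s
    have "OK G" unfolding OK_def G_def
      using bij_betw_trans[OF pibij bij] by (simp add: o_def)
    have rowh: "row G (h i) = new hs i" if "i < q" for i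
      using pih[OF that] by (simp add: row_def G_def new_def flip: h_def)
    have rowo: "row G s = row F s" if "s \<notin> h ` {..<q}" for s
      using that by (simp add: row_def G_def pio)
    \<comment> \<open>Rows that moved are now all good and the others are unchanged:
      \<open>t\<close> is no longer bad and no slot has become bad, against the minimality of
      \<open>F\<close>.\<close>
    have "{s. s < m \<and> bad s (row G s)} \<subseteq> {s. s < m \<and> bad s (row F s)} - {t}"
    proof
      fix s assume s: "s \<in> {s. s < m \<and> bad s (row G s)}"
      have "s \<notin> h ` {..<q}" using good rowh s by (auto simp: h_def)
      moreover have "t = h 0" by (simp add: h_def)
      then have "t \<in> h ` {..<q}" using q by blast
      ultimately show "s \<in> {s. s < m \<and> bad s (row F s)} - {t}" using s rowo[of s] by auto
    qed
    then have "nb G \<le> card ({s. s < m \<and> bad s (row F s)} - {t})"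
      unfolding nb_def by (intro card_mono) auto
    also have "\<dots> < nb F" unfolding nb_def using that bt
      by (intro card_Diff1_less) auto
    finally show False using min[OF \<open>OK G\<close>] by simp
  qed
  then show ?thesis using F unfolding OK_def row_def by blast
qed

text \<open>The sequence is chosen greedily so that the potential \<open>\<Sum>x\<in>X. 2 ^ bad(x)\<close>, where \<open>bad(x)\<close>
  counts the conflicts of \<open>x\<close> so far, grows by a factor at most \<open>1 + \<delta>\<close> in each step.\<close>

lemma balanced_disjoint_sequence:
  fixes vs :: "'c \<Rightarrow> 'a set" and \<delta> :: real
  assumes C: "finite C" "\<And>c. c \<in> C \<Longrightarrow> finite (vs c) \<and> card (vs c) \<le> l"
    and X: "finite X" and W: "finite W"
    and avail: "\<And>U. finite U \<Longrightarrow> card U \<le> card W + m * l \<Longrightarrow> K \<le> real (card {c \<in> C. vs c \<inter> U = {}})"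
    and K: "0 < K"
    and bad: "\<And>x. x \<in> X \<Longrightarrow> real (card {c \<in> C. bad x c}) \<le> \<delta> * K" and \<delta>: "0 \<le> \<delta>"
  shows "j \<le> m \<Longrightarrow> \<exists>f. (\<forall>i<j. f i \<in> C \<and> vs (f i) \<inter> W = {}) \<and> (\<forall>i<j. \<forall>i'<i. vs (f i) \<inter> vs (f i') = {})
     \<and> (\<Sum>x\<in>X. 2 ^ card {i. i < j \<and> bad x (f i)}) \<le> (1 + \<delta>) ^ j * real (card X)"
proof (induction j)
  case 0
  then show ?case by simp
next
  case (Suc j)
  then obtain f where f: "\<forall>i<j. f i \<in> C \<and> vs (f i) \<inter> W = {}" "\<forall>i<j. \<forall>i'<i. vs (f i) \<inter> vs (f i') = {}"
    and pot: "(\<Sum>x\<in>X. 2 ^ card {i. i < j \<and> bad x (f i)}) \<le> (1 + \<delta>) ^ j * real (card X)" by auto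
  define U where "U = W \<union> (\<Union>i<j. vs (f i))"
  define D where "D = {c \<in> C. vs c \<inter> U = {}}"
  define p where "p x = (2::real) ^ card {i. i < j \<and> bad x (f i)}" for x
  have p0: "0 \<le> p x" for x by (simp add: p_def)
  have finU: "finite U" using W f C by (auto simp: U_def)
  have "card (\<Union>i<j. vs (f i)) \<le> (\<Sum>i<j. card (vs (f i)))" by (rule card_UN_le) simp
  also have "\<dots> \<le> (\<Sum>i<j. l)" using f C by (intro sum_mono) auto
  also have "\<dots> \<le> m * l" using Suc.prems by simp
  finally have "card U \<le> card W + m * l"
    unfolding U_def using card_Un_le[of W "\<Union>i<j. vs (f i)"] by linarith
  then have DK: "K \<le> real (card D)" using avail[OF finU] by (simp add: D_def)
  have finD: "finite D" using C by (simp add: D_def)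
  \<comment> \<open>\<open>g c\<close> is the potential after choosing \<open>c\<close>: a new
    conflict doubles the weight of \<open>x\<close>.\<close>
  define g where "g c = (\<Sum>x\<in>X. p x * (1 + of_bool (bad x c)))" for c
  have D0: "0 < card D" using DK K by linarith
  have "(\<Sum>c\<in>D. g c) = (\<Sum>x\<in>X. p x * (\<Sum>c\<in>D. 1 + of_bool (bad x c)))"
    unfolding g_def by (subst sum.swap) (simp add: sum_distrib_left)
  also have "\<dots> \<le> (\<Sum>x\<in>X. p x * ((1 + \<delta>) * real (card D)))"
  proof (intro sum_mono mult_left_mono p0)
    fix x assume x: "x \<in> X"
    have "(\<Sum>c\<in>D. 1 + of_bool (bad x c)) = real (card D) + real (card {c \<in> D. bad x c})"
      using finD by (simp add: sum.distrib sum_of_bool_eq Int_def)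
    also have "card {c \<in> D. bad x c} \<le> card {c \<in> C. bad x c}"
      using C by (intro card_mono) (auto simp: D_def)
    also have "real (card {c \<in> C. bad x c}) \<le> \<delta> * real (card D)"
      using bad[OF x] mult_left_mono[OF DK \<delta>] by linarith
    finally show "(\<Sum>c\<in>D. 1 + of_bool (bad x c)) \<le> (1 + \<delta>) * real (card D)"
      by (simp add: algebra_simps)
  qed
  also have "\<dots> = (\<Sum>c\<in>D. (1 + \<delta>) * (\<Sum>x\<in>X. p x))"
    by (simp add: sum_distrib_left sum_distrib_right mult_ac)
  finally have "(\<Sum>c\<in>D. g c) \<le> (\<Sum>c\<in>D. (1 + \<delta>) * (\<Sum>x\<in>X. p x))" .
  \<comment> \<open>Averaging: some available \<open>c\<close> does no worse than the mean.\<close>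
  then obtain c where c: "c \<in> D" "g c \<le> (1 + \<delta>) * (\<Sum>x\<in>X. p x)"
    using sum_strict_mono[OF finD, of "\<lambda>_. (1 + \<delta>) * (\<Sum>x\<in>X. p x)" g] D0
    by (metis card.empty less_irrefl linorder_not_less)
  define f' where "f' = f(j := c)"
  have "(\<Sum>x\<in>X. 2 ^ card {i. i < Suc j \<and> bad x (f' i)}) = g c"
    unfolding g_def
  proof (rule sum.cong[OF refl])
    fix x
    have "{i. i < Suc j \<and> bad x (f' i)} = {i. i < j \<and> bad x (f i)} \<union> (if bad x c then {j} else {})"
      by (auto simp: f'_def less_Suc_eq)
    then have "card {i. i < Suc j \<and> bad x (f' i)} = card {i. i < j \<and> bad x (f i)} + of_bool (bad x c)"
      by (simp add: card_insert_if)
    then show "2 ^ card {i. i < Suc j \<and> bad x (f' i)} = p x * (1 + of_bool (bad x c))"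
      by (simp add: p_def power_add)
  qed
  also have "\<dots> \<le> (1 + \<delta>) * ((1 + \<delta>) ^ j * real (card X))"
    using c(2) mult_left_mono[OF pot, of "1 + \<delta>"] \<delta> unfolding p_def by linarith
  finally have "(\<Sum>x\<in>X. 2 ^ card {i. i < Suc j \<and> bad x (f' i)}) \<le> (1 + \<delta>) ^ Suc j * real (card X)"
    by (simp add: mult.assoc)
  moreover have "\<forall>i<Suc j. f' i \<in> C \<and> vs (f' i) \<inter> W = {}"
    using f c(1) by (auto simp: f'_def less_Suc_eq D_def U_def)
  moreover have "\<forall>i<Suc j. \<forall>i'<i. vs (f' i) \<inter> vs (f' i') = {}"
    using f(2) c(1) by (auto simp: f'_def less_Suc_eq D_def U_def)
  ultimately show ?case by blast
qed

section \<open>Pairs of edges with prescribed intersection\<close>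

text \<open>A set \<open>C\<close> is robust for \<open>F\<close> if it is, up to any \<open>w\<close> elements, the intersection of a member of
  \<open>F\<close> with the surroundings of \<open>C\<close>; it plays the role of the core of a large sunflower.\<close>

definition robust :: "nat \<Rightarrow> 'a set set \<Rightarrow> 'a set \<Rightarrow> bool" where
  "robust w F C \<longleftrightarrow> (\<forall>W. finite W \<longrightarrow> card W \<le> w \<longrightarrow> (\<exists>f\<in>F. C \<subseteq> f \<and> f \<inter> W \<subseteq> C))"

lemma robustE:
  assumes "robust w F C" "finite W" "card W \<le> w"
  obtains f where "f \<in> F" "C \<subseteq> f" "f \<inter> W \<subseteq> C"
  using assms unfolding robust_def by blast

lemma robust_mono: "robust w F C \<Longrightarrow> w' \<le> w \<Longrightarrow> F \<subseteq> G \<Longrightarrow> robust w' G C"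
  unfolding robust_def by (meson order_trans subsetD)

text \<open>This bounds the size of a blocking set of at most \<open>w\<close> elements together
  with one set of the previous level for each of them.\<close>

fun growth_bound :: "nat \<Rightarrow> nat \<Rightarrow> nat" where
  "growth_bound w 0 = w"
| "growth_bound w (Suc j) = w + w * growth_bound w j"

lemma growth_bound_mono: "j \<le> j' \<Longrightarrow> growth_bound w j \<le> growth_bound w j'"
proof (induction j arbitrary: j')
  case 0 then show ?case by (cases j') auto
next
  case (Suc j) then show ?case by (cases j') (auto intro: mult_le_mono2)
qed

text \<open>If the empty set is not robust, a small \<open>W0\<close> meets all of \<open>F\<close>.
  Either the members through some \<open>c\<close> in \<open>W0\<close>, with \<open>c\<close>
  removed, satisfy the hypothesis one level lower, and \<open>c\<close> is added to their robust
  set; or \<open>W0\<close> and the sets that witness failure for every \<open>c\<close> together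
  violate the hypothesis.\<close>

lemma exists_robust:
  assumes "\<And>W. finite W \<Longrightarrow> card W \<le> growth_bound w j \<Longrightarrow> \<exists>f\<in>F. finite f \<and> card (f \<inter> W) \<le> j"
  shows "\<exists>C. finite C \<and> card C \<le> j \<and> robust w F C"
  using assms
proof (induction j arbitrary: F)
  case 0
  have "robust w F {}" unfolding robust_def
  proof (intro allI impI)
    fix W :: "'a set" assume "finite W" "card W \<le> w"
    then obtain f where "f \<in> F" "finite f" "card (f \<inter> W) \<le> 0" using 0 by auto
    then show "\<exists>f\<in>F. {} \<subseteq> f \<and> f \<inter> W \<subseteq> {}" by auto
  qed
  then show ?case by (intro exI[of _ "{}"]) simp
next
  case (Suc j)
  show ?case
  proof (cases "robust w F {}")
    case True then show ?thesis by (intro exI[of _ "{}"]) simp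
  next
    case False
    then obtain W0 where W0: "finite W0" "card W0 \<le> w" "\<And>f. f \<in> F \<Longrightarrow> f \<inter> W0 \<noteq> {}"
      unfolding robust_def by auto
    define Fc where "Fc c = {f - {c} |f. f \<in> F \<and> c \<in> f}" for c
    show ?thesis
    proof (cases "\<exists>c\<in>W0. \<forall>W. finite W \<longrightarrow> card W \<le> growth_bound w j \<longrightarrow> (\<exists>f\<in>Fc c. finite f \<and> card (f \<inter> W) \<le> j)")
      case True
      then obtain c where c: "c \<in> W0"
        "\<And>W. finite W \<Longrightarrow> card W \<le> growth_bound w j \<Longrightarrow> (\<exists>f\<in>Fc c. finite f \<and> card (f \<inter> W) \<le> j)" by auto
      then obtain C where C: "finite C" "card C \<le> j" "robust w (Fc c) C" using Suc.IH[of "Fc c"] by auto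
      have "robust w F (insert c C)" unfolding robust_def
      proof (intro allI impI)
        fix W :: "'a set" assume "finite W" "card W \<le> w"
        then obtain g where g: "g \<in> Fc c" "C \<subseteq> g" "g \<inter> W \<subseteq> C" using C(3) unfolding robust_def by auto
        then obtain f where "f \<in> F" "c \<in> f" "g = f - {c}" by (auto simp: Fc_def)
        then show "\<exists>f\<in>F. insert c C \<subseteq> f \<and> f \<inter> W \<subseteq> insert c C"
          using g by (intro bexI[of _ f]) auto
      qed
      then show ?thesis using C(1,2) by (intro exI[of _ "insert c C"]) (simp add: card_insert_if)
    next
      case False
      then have "\<forall>c\<in>W0. \<exists>W. finite W \<and> card W \<le> growth_bound w j \<and> (\<forall>f\<in>Fc c. finite f \<longrightarrow> \<not> card (f \<inter> W) \<le> j)"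
        by meson
      then obtain Wc where Wc: "\<And>c. c \<in> W0 \<Longrightarrow> finite (Wc c)" "\<And>c. c \<in> W0 \<Longrightarrow> card (Wc c) \<le> growth_bound w j"
        "\<And>c f. c \<in> W0 \<Longrightarrow> f \<in> Fc c \<Longrightarrow> finite f \<Longrightarrow> \<not> card (f \<inter> Wc c) \<le> j"
        by metis
      define W where "W = W0 \<union> (\<Union>c\<in>W0. Wc c)"
      have "card (\<Union>c\<in>W0. Wc c) \<le> (\<Sum>c\<in>W0. card (Wc c))" by (rule card_UN_le[OF W0(1)])
      also have "\<dots> \<le> card W0 * growth_bound w j" using sum_bounded_above[of W0 "\<lambda>c. card (Wc c)" "growth_bound w j"] Wc(2) by simp
      also have "\<dots> \<le> w * growth_bound w j" using W0(2) by (rule mult_le_mono1)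
      finally have "card W \<le> growth_bound w (Suc j)"
        unfolding W_def using card_Un_le[of W0 "\<Union>c\<in>W0. Wc c"] W0(2) by simp
      moreover have finW: "finite W" using W0(1) Wc(1) by (simp add: W_def)
      ultimately obtain f where f: "f \<in> F" "finite f" "card (f \<inter> W) \<le> Suc j" using Suc.prems by blast
      then obtain c where c: "c \<in> f" "c \<in> W0" using W0(3) by blast
      have "(f - {c}) \<inter> Wc c \<subseteq> (f \<inter> W) - {c}" using c by (auto simp: W_def)
      then have "card ((f - {c}) \<inter> Wc c) \<le> card ((f \<inter> W) - {c})"
        using f(2) by (intro card_mono) auto
      also have "\<dots> = card (f \<inter> W) - 1" using c by (intro card_Diff_singleton) (auto simp: W_def)
      finally have "card ((f - {c}) \<inter> Wc c) \<le> j" using f(3) by linarith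
      moreover have "f - {c} \<in> Fc c" using f c by (auto simp: Fc_def)
      ultimately show ?thesis using Wc(3)[OF c(2), of "f - {c}"] f(2) by simp
    qed
  qed
qed

lemma exists_subset_avoiding:
  assumes "finite B" "finite W" "card W + p \<le> card B"
  shows "\<exists>P. P \<subseteq> B \<and> P \<inter> W = {} \<and> card P = p \<and> finite P"
proof -
  have "p \<le> card (B - W)" using diff_card_le_card_Diff[OF assms(2), of B] assms(3) by linarith
  then obtain P where "P \<subseteq> B - W" "card P = p" by (meson obtain_subset_with_card_n)
  moreover have "finite P" using \<open>P \<subseteq> B - W\<close> assms(1) finite_subset[of P "B - W"] by simp
  ultimately show ?thesis by (intro exI[of _ P]) auto
qed

text \<open>Suppose no two edges meet in 0 or \<open>l\<close> vertices. Robust sets inherit this,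
  since each can be enlarged to an edge that meets a given small set only inside it; the covering
  condition provides small robust sets with contradictory intersections. For \<open>l = 1\<close>
  the \<open>k\<close>-sets through a fixed pair satisfy \<open>cov\<close> without two such edges,
  whence \<open>cov2\<close>.\<close>

lemma two_edges:
  fixes B :: "'a set" and F :: "'a set set"
  assumes kl: "1 \<le> l" "2 * l < k" and B: "finite B"
    and F: "\<And>f. f \<in> F \<Longrightarrow> f \<subseteq> B \<and> card f = k"
    and cov: "\<And>S. S \<subseteq> B \<Longrightarrow> card S = k - 2 \<Longrightarrow> \<exists>f\<in>F. S \<subseteq> f"
    and cov2: "\<And>S. l = 1 \<Longrightarrow> S \<subseteq> B \<Longrightarrow> card S = k - 2 \<Longrightarrow> \<exists>f\<in>F. \<exists>g\<in>F. S \<subseteq> f \<and> S \<subseteq> g \<and> f \<noteq> g"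
    and big: "growth_bound (growth_bound (4 * k) 2 + 4 * k) k + 10 * k \<le> card B"
  shows "\<exists>e\<in>F. \<exists>f\<in>F. card (e \<inter> f) = 0 \<or> card (e \<inter> f) = l"
proof (rule ccontr)
  assume neg: "\<not> ?thesis"
  have no: "card (e \<inter> f) \<noteq> 0" "card (e \<inter> f) \<noteq> l" if "e \<in> F" "f \<in> F" for e f using neg that by auto
  have finF: "finite f" if "f \<in> F" for f using F[OF that] B finite_subset by auto
  have rob_edge: "card (C \<inter> g) \<noteq> 0" "card (C \<inter> g) \<noteq> l" if a: "robust w F C" "k \<le> w" "g \<in> F" for C g w
  proof -
    obtain f where f: "f \<in> F" "C \<subseteq> f" "f \<inter> g \<subseteq> C"
      using robustE[OF a(1) finF[OF a(3)]] F[OF a(3)] a(2) by auto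
    then have "C \<inter> g = f \<inter> g" by auto
    then show "card (C \<inter> g) \<noteq> 0" "card (C \<inter> g) \<noteq> l" using no[OF f(1) that(3)] by simp_all
  qed
  \<comment> \<open>With \<open>C = D\<close> this also says that a robust set of size at most
    \<open>k\<close> has neither 0 nor \<open>l\<close> elements.\<close>
  have rob_rob: "card (C \<inter> D) \<noteq> 0" "card (C \<inter> D) \<noteq> l"
    if a: "robust w F C" "robust w F D" "k \<le> w" "finite D" "card D \<le> k" for C D w
  proof -
    obtain f where f: "f \<in> F" "C \<subseteq> f" "f \<inter> D \<subseteq> C"
      using robustE[OF a(1) a(4) order_trans[OF a(5,3)]] by auto
    then have "C \<inter> D = D \<inter> f" by auto
    then show "card (C \<inter> D) \<noteq> 0" "card (C \<inter> D) \<noteq> l" using rob_edge[OF that(2,3) f(1)] by simp_all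
  qed
  define w2 where "w2 = growth_bound (4 * k) 2 + 4 * k"
  have w2: "4 * k \<le> w2" "k \<le> w2" "growth_bound (4 * k) 2 \<le> w2" by (simp_all add: w2_def)
  have bigw: "growth_bound w2 j + 10 * k \<le> card B" if "j \<le> k" for j
    using big growth_bound_mono[OF that, of w2] by (simp add: w2_def)
  have w2B: "w2 + 10 * k \<le> card B" using bigw[of 0] by simp
  have ext: "\<exists>S\<subseteq>B. T \<subseteq> S \<and> card S = k - 2 \<and> (S - T) \<inter> W = {}"
    if a: "T \<subseteq> B" "card T \<le> k - 2" "finite W" "card W + 3 * k \<le> card B" for T W
  proof -
    have finT: "finite T" using that(1) B finite_subset by auto
    obtain P where P: "P \<subseteq> B" "P \<inter> (W \<union> T) = {}" "card P = k - 2 - card T" "finite P"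
    proof -
      have h: "finite (W \<union> T)" "card (W \<union> T) + (k - 2 - card T) \<le> card B"
        using a(2,3,4) finT card_Un_le[of W T] by (simp, linarith)
      show ?thesis using exists_subset_avoiding[OF B h] by (elim exE conjE) (rule that)
    qed
    then have "card (T \<union> P) = k - 2" using that(2) finT by (subst card_Un_disjoint) auto
    then show ?thesis using P that(1) by (intro exI[of _ "T \<union> P"]) auto
  qed
  \<comment> \<open>Extending \<open>Z\<close> to a \<open>(k - 2)\<close>-set whose new vertices
    avoid \<open>W\<close>, and then to an edge, leaves only two uncontrolled vertices, so the edge
    meets \<open>W\<close> in at most \<open>l + 1\<close> vertices.\<close>
  have robZ: "\<exists>C. finite C \<and> Z \<subseteq> C \<and> card C \<le> l + 1 \<and> robust w2 F C" if Z: "Z \<subseteq> B" "card Z = l - 1" for Z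
  proof -
    have finZ: "finite Z" using Z(1) B finite_subset by auto
    have "\<exists>f\<in>{f \<in> F. Z \<subseteq> f}. finite f \<and> card (f \<inter> W) \<le> l + 1"
      if W: "finite W" "card W \<le> growth_bound w2 (l + 1)" for W
    proof -
      obtain S where S: "S \<subseteq> B" "Z \<subseteq> S" "card S = k - 2" "(S - Z) \<inter> W = {}"
        using ext[of Z W] Z W kl bigw[of "l + 1"] by fastforce
      then obtain f where f: "f \<in> F" "S \<subseteq> f" using cov by blast
      have finS: "finite S" using S(1) B finite_subset by auto
      have "f \<inter> W \<subseteq> Z \<union> (f - S)" using S(4) by auto
      then have "card (f \<inter> W) \<le> card (Z \<union> (f - S))" using finF[OF f(1)] finZ by (intro card_mono) auto
      also have "\<dots> \<le> card Z + card (f - S)" by (rule card_Un_le)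
      also have "card (f - S) = 2" using F[OF f(1)] f(2) S(3) finS kl by (subst card_Diff_subset) auto
      finally show ?thesis using f S(2) finF Z(2) kl by (intro bexI[of _ f]) auto
    qed
    then obtain C where C: "finite C" "card C \<le> l + 1" "robust w2 {f \<in> F. Z \<subseteq> f} C"
      using exists_robust[of w2 "l + 1" "{f \<in> F. Z \<subseteq> f}"] by blast
    have "card Z \<le> w2" using Z kl w2 by linarith
    then obtain f where "f \<in> {f \<in> F. Z \<subseteq> f}" "f \<inter> Z \<subseteq> C" by (rule robustE[OF C(3) finZ])
    then have "Z \<subseteq> C" by auto
    moreover have "robust w2 F C" by (rule robust_mono[OF C(3)]) auto
    ultimately show ?thesis using C by blast
  qed
  show False
  proof (cases "l = 1")
    case True
    obtain C where C: "finite C" "card C \<le> 2" "robust w2 F C" using robZ[of "{}"] True by auto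
    have "card C \<noteq> 0" "card C \<noteq> 1" using rob_rob[OF C(3,3) w2(2) C(1)] C(2) kl True by auto
    then have C2: "card C = 2" using C(2) by linarith
    obtain S where S: "S \<subseteq> B" "card S = k - 2" "S \<inter> C = {}"
      using ext[of "{}" C] C w2B kl C2 by auto
    obtain f g where fg: "f \<in> F" "g \<in> F" "S \<subseteq> f" "S \<subseteq> g" "f \<noteq> g" using cov2[OF True S(1,2)] by blast
    \<comment> \<open>An edge meets \<open>C\<close> in neither 0 nor 1 vertices, so the two
      vertices it adds to \<open>S\<close> are those of \<open>C\<close>. This makes the edge
      through \<open>S\<close> unique, against \<open>cov2\<close>.\<close>
    have "h = S \<union> C" if h: "h \<in> F" "S \<subseteq> h" for h
    proof -
      have finS: "finite S" using S(1) B finite_subset by auto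
      have c2: "card (h - S) = 2" using F[OF h(1)] h(2) S(2) finS kl by (subst card_Diff_subset) auto
      have "C \<inter> h \<subseteq> h - S" using S(3) by auto
      moreover have "card (C \<inter> h) \<noteq> 0" "card (C \<inter> h) \<noteq> 1" using rob_edge[OF C(3) w2(2) h(1)] True by auto
      moreover have "card (C \<inter> h) \<le> 2" using card_mono[OF C(1), of "C \<inter> h"] C2 by auto
      ultimately have "card (C \<inter> h) = 2" by linarith
      then have "C \<inter> h = h - S" "C \<inter> h = C"
        using card_subset_eq[OF _ \<open>C \<inter> h \<subseteq> h - S\<close>] card_subset_eq[OF C(1), of "C \<inter> h"] finF[OF h(1)] c2 C2 by auto
      then show ?thesis using h(2) by auto
    qed
    then show False using fg by blast
  next
    case False
    then have l2: "2 \<le> l" using kl by linarith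
    obtain S0 where "S0 \<subseteq> B" "card S0 = k - 2" using ext[of "{}" "{}"] w2B by auto
    then obtain e0 where e0: "e0 \<in> F" using cov by blast
    \<comment> \<open>Size \<open>l\<close> is excluded by intersecting \<open>C\<close> with
      itself, size \<open>l - 1\<close> because \<open>Z\<close> misses the edge
      \<open>e0\<close>.\<close>
    have robZ': "\<exists>C. finite C \<and> Z \<subseteq> C \<and> card C = l + 1 \<and> robust w2 F C"
      if Z: "Z \<subseteq> B" "card Z = l - 1" "Z \<inter> e0 = {}" for Z
    proof -
      obtain C where C: "finite C" "Z \<subseteq> C" "card C \<le> l + 1" "robust w2 F C" using robZ[OF Z(1,2)] by auto
      have "card C \<noteq> l" using rob_rob(2)[OF C(4,4) w2(2) C(1)] C(3) kl by auto
      moreover have "card C \<noteq> l - 1"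
      proof
        assume "card C = l - 1"
        then have "C = Z" using card_subset_eq[OF C(1,2)] Z(2) by simp
        then show False using rob_edge(1)[OF C(4) w2(2) e0] Z(3) by simp
      qed
      moreover have "l - 1 \<le> card C" using card_mono[OF C(1,2)] Z(2) by simp
      ultimately show ?thesis using C by (intro exI[of _ C]) linarith
    qed
    define R where "R = {C. finite C \<and> card C = l + 1 \<and> robust w2 F C}"
    have RR: "card (C \<inter> D) \<noteq> l" if "C \<in> R" "D \<in> R" for C D
      using rob_rob(2)[of w2 C D] that w2(2) kl by (auto simp: R_def)
    define RZ where "RZ = {C \<in> R. \<exists>Z\<subseteq>C. card Z = l - 1 \<and> Z \<inter> e0 = {} \<and> Z \<subseteq> B}"
    have fin_e0: "finite e0" "card e0 = k" using finF[OF e0] F[OF e0] by auto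
    have getZ: "\<exists>Z C. Z \<subseteq> B \<and> card Z = l - 1 \<and> finite Z \<and> Z \<inter> e0 = {} \<and> Z \<inter> W = {} \<and> Z \<subseteq> C \<and> C \<in> RZ"
      if a: "finite W" "card W \<le> w2" for W
    proof -
      obtain Z where Z: "Z \<subseteq> B" "Z \<inter> (W \<union> e0) = {}" "card Z = l - 1" "finite Z"
      proof -
        have h: "finite (W \<union> e0)" "card (W \<union> e0) + (l - 1) \<le> card B"
          using a fin_e0 card_Un_le[of W e0] w2B kl by (simp, linarith)
        show ?thesis using exists_subset_avoiding[OF B h] by (elim exE conjE) (rule that)
      qed
      then obtain C where "C \<in> R" "Z \<subseteq> C" using robZ'[of Z] by (auto simp: R_def)
      then show ?thesis using Z by (intro exI[of _ Z] exI[of _ C]) (auto simp: RZ_def)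
    qed
    \<comment> \<open>A second round, now with \<open>RZ\<close> as the family: with
      \<open>Z\<close> chosen off \<open>W\<close>, a member has only two elements outside
      \<open>Z\<close>, so there is a robust core \<open>K\<close> of at most two elements.\<close>
    have "\<exists>C\<in>RZ. finite C \<and> card (C \<inter> W) \<le> 2" if W: "finite W" "card W \<le> growth_bound (4 * k) 2" for W
    proof -
      obtain Z C where ZC: "card Z = l - 1" "finite Z" "Z \<inter> W = {}" "Z \<subseteq> C" "C \<in> RZ"
        using getZ[OF W(1)] W(2) w2(3) by (meson order_trans)
      have finC: "finite C" "card C = l + 1" using ZC(5) by (auto simp: RZ_def R_def)
      have "card (C \<inter> W) \<le> card (C - Z)" using ZC finC by (intro card_mono) auto
      also have "\<dots> = 2" using ZC finC l2 by (subst card_Diff_subset) auto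
      finally show ?thesis using ZC finC by blast
    qed
    then obtain K where K: "finite K" "card K \<le> 2" "robust (4 * k) RZ K" using exists_robust[of "4 * k" 2 RZ] by blast
    have K_rob: "robust (4 * k) F K" unfolding robust_def
    proof (intro allI impI)
      fix W :: "'a set" assume W: "finite W" "card W \<le> 4 * k"
      then obtain C where C: "C \<in> RZ" "K \<subseteq> C" "C \<inter> W \<subseteq> K" using robustE[OF K(3) W] by auto
      then have "robust w2 F C" by (simp add: RZ_def R_def)
      then obtain f where "f \<in> F" "C \<subseteq> f" "f \<inter> W \<subseteq> C" using robustE[of w2 F C W] W w2(1) by auto
      then show "\<exists>f\<in>F. K \<subseteq> f \<and> f \<inter> W \<subseteq> K" using C by (intro bexI[of _ f]) auto
    qed
    have K_edge: "K \<inter> g \<noteq> {}" if "g \<in> F" for g using rob_edge(1)[OF K_rob _ that] by auto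
    have K_R: "K \<inter> C \<noteq> {}" if "C \<in> R" for C
      using rob_rob(1)[OF K_rob robust_mono[of w2 F C "4 * k" F]] that w2(1) kl by (auto simp: R_def)
    have "K \<noteq> {}" using K_edge[OF e0] by auto
    then have "card K \<noteq> 0" using K(1) by simp
    then consider "card K = 1" | "card K = 2" using K(2) by linarith
    then show False
    proof cases
      case 1
      then obtain x where x: "K = {x}" by (auto simp: card_1_singleton_iff)
      have xF: "x \<in> g" if "g \<in> F" for g using K_edge[OF that] x by auto
      have xR: "x \<in> C" if "C \<in> R" for C using K_R[OF that] x by auto
      have xe0: "x \<in> e0" using xF e0 by simp
      obtain Y where Y: "Y \<subseteq> B" "Y \<inter> e0 = {}" "card Y = l - 2" "finite Y"
      proof -
        have h: "finite (e0)" "card (e0) + (l - 2) \<le> card B"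
          using fin_e0 w2B kl by (simp, linarith)
        show ?thesis using exists_subset_avoiding[OF B h] by (elim exE conjE) (rule that)
      qed
      obtain T where T: "T \<subseteq> B" "T \<inter> (e0 \<union> Y) = {}" "card T = 4" "finite T"
      proof -
        have h: "finite (e0 \<union> Y)" "card (e0 \<union> Y) + 4 \<le> card B"
          using fin_e0 Y(3,4) card_Un_le[of e0 Y] w2B kl by (simp, linarith)
        show ?thesis using exists_subset_avoiding[OF B h] by (elim exE conjE) (rule that)
      qed
      \<comment> \<open>Here \<open>x\<close> lies in every edge and in every set of
        \<open>R\<close>, so a set of \<open>R\<close> through \<open>insert z Y\<close> is
        determined up to one vertex \<open>q z\<close>.\<close>
      have "\<exists>q. q \<noteq> x \<and> q \<notin> Y \<and> q \<noteq> z \<and> insert x (insert q (insert z Y)) \<in> R" if z: "z \<in> T" for z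
      proof -
        have cz: "card (insert z Y) = l - 1" using z T(2) Y l2 by (subst card_insert_disjoint) auto
        obtain C where C: "finite C" "insert z Y \<subseteq> C" "card C = l + 1" "robust w2 F C"
          using robZ'[of "insert z Y"] cz z T Y by auto
        have CR: "C \<in> R" using C by (simp add: R_def)
        have "card (C - insert z Y) = 2" using C cz Y(4) l2 by (subst card_Diff_subset) auto
        moreover have "x \<in> C - insert z Y" using xR[OF CR] xe0 z T(2) Y(2) by auto
        ultimately obtain q where "C - insert z Y = {x, q}" "q \<noteq> x"
          by (metis card_2_iff doubleton_eq_iff insertE singletonD)
        moreover from this have "C = insert x (insert q (insert z Y))" using C(2) by auto
        ultimately show ?thesis using CR by (intro exI[of _ q]) auto
      qed
      then obtain q where q: "\<And>z. z \<in> T \<Longrightarrow> q z \<noteq> x \<and> q z \<notin> Y \<and> q z \<noteq> z \<and> insert x (insert (q z) (insert z Y)) \<in> R"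
        by metis
      have xY: "x \<notin> Y" "x \<notin> T" using xe0 Y(2) T(2) by auto
      have qinj: "z = z'" if "z \<in> T" "z' \<in> T" "q z = q z'" for z z'
      proof (rule ccontr)
        assume ne: "z \<noteq> z'"
        have "insert x (insert (q z) (insert z Y)) \<inter> insert x (insert (q z') (insert z' Y)) = insert x (insert (q z) Y)"
          using that q[OF that(1)] q[OF that(2)] ne T(2) by auto
        moreover have "card (insert x (insert (q z) Y)) = l" using q[OF that(1)] xY Y l2 by (auto simp: card_insert_if)
        ultimately show False using RR q[OF that(1)] q[OF that(2)] by metis
      qed
      \<comment> \<open>Four candidates suffice: only \<open>z1\<close>, \<open>q z1\<close> and at
        most one \<open>z\<close> with \<open>q z = z1\<close> are excluded for
        \<open>z2\<close>.\<close>
      obtain z1 where z1: "z1 \<in> T" using T(3) by fastforce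
      have "card ({q z1} \<union> {z \<in> T. q z = z1}) \<le> 2"
      proof -
        have "card {z \<in> T. q z = z1} \<le> 1"
          using qinj T(4) by (auto simp: card_le_Suc0_iff_eq)
        then show ?thesis using card_Un_le[of "{q z1}" "{z \<in> T. q z = z1}"] by auto
      qed
      then have "card (insert z1 ({q z1} \<union> {z \<in> T. q z = z1})) \<le> 3"
        using card_insert_le_m1[of 3 "{q z1} \<union> {z \<in> T. q z = z1}" z1] by auto
      then have "\<not> T \<subseteq> insert z1 ({q z1} \<union> {z \<in> T. q z = z1})"
        using card_mono[of "insert z1 ({q z1} \<union> {z \<in> T. q z = z1})" T] T(3,4) by auto
      then obtain z2 where z2: "z2 \<in> T" "z2 \<noteq> z1" "z2 \<noteq> q z1" "q z2 \<noteq> z1" by auto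
      have q12: "q z1 \<noteq> q z2" using qinj[of z1 z2] z1 z2 by auto
      let ?T = "insert z1 (insert z2 Y)"
      have cT: "card ?T = l" using z1 z2 T(2) Y l2 by (subst card_insert_disjoint; auto)
      \<comment> \<open>An edge through \<open>S\<close> has just two further vertices but must
        contain \<open>x\<close>, \<open>q z1\<close> and \<open>q z2\<close>: without
        \<open>q z\<close> it would meet the robust set of \<open>z\<close> in exactly
        \<open>l\<close> vertices.\<close>
      obtain S where S: "S \<subseteq> B" "?T \<subseteq> S" "card S = k - 2" "(S - ?T) \<inter> {x, q z1, q z2} = {}"
      proof -
        have c3: "card {x, q z1, q z2} \<le> 3" by (simp add: card_insert_if)
        have h1: "?T \<subseteq> B" "finite {x, q z1, q z2}" using z1 z2(1) T(1) Y(1) by auto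
        have h2: "card ?T \<le> k - 2" "card {x, q z1, q z2} + 3 * k \<le> card B"
          using cT c3 kl l2 w2B by linarith+
        show ?thesis using ext[OF h1(1) h2(1) h1(2) h2(2)] by (elim exE conjE) (rule that)
      qed
      have Snot: "x \<notin> S" "q z1 \<notin> S" "q z2 \<notin> S"
        using S(4) xY z1 z2 q[OF z1] q[OF z2(1)] by auto
      obtain f where f: "f \<in> F" "S \<subseteq> f" using cov[OF S(1,3)] by blast
      have finS: "finite S" using S(1) B finite_subset by auto
      have c2: "card (f - S) = 2" using F[OF f(1)] f(2) S(3) finS kl by (subst card_Diff_subset) auto
      have qf: "q z \<in> f" if z: "z = z1 \<or> z = z2" for z
      proof (rule ccontr)
        assume "q z \<notin> f"
        then have "insert x (insert (q z) (insert z Y)) \<inter> f = insert x (insert z Y)"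
          using f(2) S(2) xF[OF f(1)] z by auto
        moreover have "card (insert x (insert z Y)) = l"
          using z z1 z2(1) T(2) xY Y l2 by (auto simp: card_insert_if)
        moreover have "robust w2 F (insert x (insert (q z) (insert z Y)))" using q z z1 z2(1) by (auto simp: R_def)
        ultimately show False using rob_edge(2)[OF _ w2(2) f(1)] by metis
      qed
      have "{x, q z1, q z2} \<subseteq> f - S" using Snot xF[OF f(1)] qf by auto
      then have "card {x, q z1, q z2} \<le> 2" using c2 finF[OF f(1)] by (metis card_mono finite_Diff)
      then show False using q[OF z1] q[OF z2(1)] q12 by (auto simp: card_insert_if split: if_splits)
    next
      case 2
      have getC: "\<exists>C Z. C \<in> R \<and> C = Z \<union> K \<and> Z \<inter> K = {} \<and> card Z = l - 1 \<and> finite Z \<and> Z \<subseteq> B \<and> Z \<inter> W = {}"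
        if W: "finite W" "card W \<le> 3 * k" for W
      proof -
        obtain C where C: "C \<in> RZ" "K \<subseteq> C" "C \<inter> W \<subseteq> K"
          using robustE[OF K(3) W(1)] W(2) by auto
        have CR: "C \<in> R" "finite C" "card C = l + 1" using C by (auto simp: RZ_def R_def)
        obtain f where f: "f \<in> F" "C \<subseteq> f" using robustE[of w2 F C "{}"] CR by (auto simp: R_def)
        have "C \<subseteq> B" using f F by auto
        moreover have "card (C - K) = l - 1" using C(2) CR K(1) 2 by (subst card_Diff_subset) auto
        ultimately show ?thesis using C CR by (intro exI[of _ C] exI[of _ "C - K"]) auto
      qed
      obtain C1 Z1 where Z1: "C1 \<in> R" "C1 = Z1 \<union> K" "Z1 \<inter> K = {}" "card Z1 = l - 1" "finite Z1" "Z1 \<subseteq> B"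
        using getC[of "{}"] by auto
      obtain C2 Z2 where Z2: "C2 \<in> R" "C2 = Z2 \<union> K" "Z2 \<inter> K = {}" "card Z2 = l - 1" "finite Z2" "Z2 \<subseteq> B" "Z2 \<inter> Z1 = {}"
      proof -
        have c: "card Z1 \<le> 3 * k" using Z1(4) kl by linarith
        show ?thesis using getC[OF Z1(5) c] by (elim exE conjE) (rule that)
      qed
      \<comment> \<open>Every edge meets \<open>K\<close>, but if it did so in one vertex it would
        meet \<open>Z \<union> K\<close> in \<open>l\<close> vertices. So it contains all of
        \<open>K\<close>.\<close>
      have fS: "f = S \<union> K" if f: "f \<in> F" "S \<subseteq> f" and S: "S \<subseteq> B" "card S = k - 2" "Z \<subseteq> S" "S \<inter> K = {}"
        and Z: "Z \<union> K \<in> R" "card Z = l - 1" "finite Z" for f S Z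
      proof -
        have finS: "finite S" using S(1) B finite_subset by auto
        have c2: "card (f - S) = 2" using F[OF f(1)] f(2) S(2) finS kl by (subst card_Diff_subset) auto
        have ZK: "Z \<inter> K = {}" using S by auto
        have "(Z \<union> K) \<inter> f = Z \<union> (K \<inter> f)" using f S by auto
        then have "card ((Z \<union> K) \<inter> f) = l - 1 + card (K \<inter> f)" using card_Un_disjoint[of Z "K \<inter> f"] ZK Z K(1) by auto
        moreover have "card ((Z \<union> K) \<inter> f) \<noteq> l" using rob_edge(2)[OF _ w2(2) f(1)] Z by (auto simp: R_def)
        moreover have "card (K \<inter> f) \<noteq> 0" using K_edge[OF f(1)] K(1) by simp
        moreover have "card (K \<inter> f) \<le> 2" using card_mono[OF K(1), of "K \<inter> f"] 2 by auto
        ultimately have "card (K \<inter> f) = 2" using l2 by linarith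
        then have "K \<inter> f = K" using card_subset_eq[OF K(1), of "K \<inter> f"] 2 by auto
        then have "K \<subseteq> f - S" using S(4) by auto
        then have "K = f - S" using card_subset_eq[of "f - S" K] finF[OF f(1)] c2 2 by auto
        then show ?thesis using f(2) by auto
      qed
      \<comment> \<open>Two sets \<open>S\<close> are made to share exactly the \<open>l - 2\<close>
        vertices of \<open>Y\<close>; together with \<open>K\<close>, the edges through them share
        \<open>l\<close>.\<close>
      obtain Y where Y: "Y \<subseteq> B" "Y \<inter> (Z1 \<union> Z2 \<union> K) = {}" "card Y = l - 2" "finite Y"
      proof -
        have h1: "card (Z1 \<union> Z2 \<union> K) + (l - 2) \<le> card B"
          using card_Un_le[of "Z1 \<union> Z2" K] card_Un_le[of Z1 Z2] Z1(4) Z2(4) 2 w2B kl l2 by linarith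
        have h2: "finite (Z1 \<union> Z2 \<union> K)" using Z1(5) Z2(5) K(1) by simp
        show ?thesis using exists_subset_avoiding[OF B h2 h1] by (elim exE conjE) (rule that)
      qed
      have c1: "card (Z1 \<union> Y) = 2 * l - 3" using Z1 Y l2 by (subst card_Un_disjoint) auto
      have c2: "card (Z2 \<union> Y) = 2 * l - 3" using Z2 Y l2 by (subst card_Un_disjoint) auto
      have cKZ: "card (K \<union> Z2 \<union> Y) \<le> 2 + 2 * l" using card_Un_le[of K "Z2 \<union> Y"] c2 2 by (simp add: Un_assoc)
      obtain S1 where S1: "S1 \<subseteq> B" "Z1 \<union> Y \<subseteq> S1" "card S1 = k - 2" "(S1 - (Z1 \<union> Y)) \<inter> (K \<union> Z2 \<union> Y) = {}"
      proof -
        have h1: "Z1 \<union> Y \<subseteq> B" "finite (K \<union> Z2 \<union> Y)" using Z1(6) Z2(5) Y K(1) by auto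
        have h2: "card (Z1 \<union> Y) \<le> k - 2" "card (K \<union> Z2 \<union> Y) + 3 * k \<le> card B" using c1 cKZ kl l2 w2B by linarith+
        show ?thesis using ext[OF h1(1) h2(1) h1(2) h2(2)] by (elim exE conjE) (rule that)
      qed
      have finS1: "finite S1" using S1(1) B finite_subset by auto
      have cS1: "card (K \<union> S1) \<le> k" using card_Un_le[of K S1] S1(3) 2 kl by linarith
      obtain S2 where S2: "S2 \<subseteq> B" "Z2 \<union> Y \<subseteq> S2" "card S2 = k - 2" "(S2 - (Z2 \<union> Y)) \<inter> (K \<union> S1) = {}"
      proof -
        have h1: "Z2 \<union> Y \<subseteq> B" "finite (K \<union> S1)" using Z2(6) finS1 Y K(1) by auto
        have h2: "card (Z2 \<union> Y) \<le> k - 2" "card (K \<union> S1) + 3 * k \<le> card B" using c2 cS1 kl l2 w2B by linarith+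
        show ?thesis using ext[OF h1(1) h2(1) h1(2) h2(2)] by (elim exE conjE) (rule that)
      qed
      have K1: "S1 \<inter> K = {}" using S1(4) Z1(3) Y(2) by auto
      have K2: "S2 \<inter> K = {}" using S2(4) Z2(3) Y(2) by auto
      have S12: "S1 \<inter> S2 = Y" using S1(2,4) S2(2,4) Z2(7) Y(2) by auto
      obtain f1 where f1: "f1 \<in> F" "S1 \<subseteq> f1" using cov[OF S1(1,3)] by blast
      obtain f2 where f2: "f2 \<in> F" "S2 \<subseteq> f2" using cov[OF S2(1,3)] by blast
      have "f1 = S1 \<union> K" using fS[OF f1 S1(1,3) _ K1, of Z1] S1(2) Z1 by auto
      moreover have "f2 = S2 \<union> K" using fS[OF f2 S2(1,3) _ K2, of Z2] S2(2) Z2 by auto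
      ultimately have "f1 \<inter> f2 = Y \<union> K" using S12 K1 K2 by auto
      moreover have "card (Y \<union> K) = l" using Y K 2 l2 by (subst card_Un_disjoint) auto
      ultimately show False using no(2)[OF f1(1) f2(1)] by simp
    qed
  qed
qed

section \<open>Counting in near-extremal hypergraphs\<close>

definition cnt :: "'a set \<Rightarrow> nat \<Rightarrow> ('a set \<Rightarrow> bool) \<Rightarrow> nat" where
  "cnt X p P = card {xs \<in> tup X p. P (set xs)}"

lemma cnt_le: "finite X \<Longrightarrow> cnt X p P \<le> card X ^ p"
  unfolding cnt_def card_tup[symmetric] by (intro card_mono) auto

lemma card_tup_append:
  assumes X: "finite X"
  shows "card {xs \<in> tup X (p + q). P (take p xs) (drop p xs)} = (\<Sum>us\<in>tup X p. card {vs \<in> tup X q. P us vs})"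
proof -
  let ?S = "SIGMA us:tup X p. {vs \<in> tup X q. P us vs}"
  have "{xs \<in> tup X (p + q). P (take p xs) (drop p xs)} = (\<lambda>(us, vs). us @ vs) ` ?S"
  proof
    show "{xs \<in> tup X (p + q). P (take p xs) (drop p xs)} \<subseteq> (\<lambda>(us, vs). us @ vs) ` ?S"
    proof
      fix xs assume xs: "xs \<in> {xs \<in> tup X (p + q). P (take p xs) (drop p xs)}"
      then have "(take p xs, drop p xs) \<in> ?S"
        using set_take_subset[of p xs] set_drop_subset[of p xs] by (auto simp: tup_def)
      then show "xs \<in> (\<lambda>(us, vs). us @ vs) ` ?S" by (rule image_eqI[rotated]) simp
    qed
  qed (auto simp: tup_def)
  moreover have "inj_on (\<lambda>(us, vs). us @ vs) ?S" by (auto simp: inj_on_def tup_def)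
  ultimately show ?thesis using X by (simp add: card_image)
qed

lemma cnt_split:
  assumes X: "finite X"
  shows "cnt X (p + q) P = (\<Sum>us\<in>tup X p. cnt X q (\<lambda>S. P (set us \<union> S)))"
proof -
  have "{xs \<in> tup X (p + q). P (set xs)} = {xs \<in> tup X (p + q). P (set (take p xs) \<union> set (drop p xs))}"
    by (simp add: set_append[symmetric] del: set_append)
  then show ?thesis using card_tup_append[OF X, of p q "\<lambda>us vs. P (set us \<union> set vs)"]
    by (simp add: cnt_def)
qed

lemma card_tup_hit_le:
  assumes X: "finite X" "real (card X) \<le> n" and Y: "finite Y" "real (card Y) \<le> y * n"
  shows "real (card {xs \<in> tup X p. set xs \<inter> Y \<noteq> {}}) \<le> real p * y * n ^ p"
proof (cases "p = 0 \<or> card X = 0")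
  case True
  show ?thesis
  proof (cases "p = 0")
    case False
    then have "X = {}" using True X by simp
    then have "{xs \<in> tup X p. set xs \<inter> Y \<noteq> {}} = {}" by (auto simp: tup_def)
    moreover have "0 \<le> y * n" using Y(2) by linarith
    then have "0 \<le> real p * (y * n) * n ^ (p - 1)" using X(2) \<open>X = {}\<close> by simp
    then have "0 \<le> real p * y * n ^ p" using False by (cases p) (auto simp: mult_ac)
    ultimately show ?thesis by (simp only: card.empty)
  qed simp
next
  case False
  have "real (card {xs \<in> tup X p. set xs \<inter> Y \<noteq> {}}) * real (card X) \<le> real p * real (card Y) * real (card X) ^ p"
    using card_tup_member_le[OF X(1) Y(1), of p]
    unfolding of_nat_mult[symmetric] of_nat_power[symmetric] by (rule of_nat_mono)
  also have "\<dots> = real p * real (card Y) * real (card X) ^ (p - 1) * real (card X)"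
    using False by (cases p) auto
  finally have "real (card {xs \<in> tup X p. set xs \<inter> Y \<noteq> {}}) \<le> real p * real (card Y) * real (card X) ^ (p - 1)"
    using False by simp
  also have "\<dots> \<le> real p * (y * n) * n ^ (p - 1)"
  proof -
    have "0 \<le> y * n" using Y(2) by linarith
    then show ?thesis using X Y by (intro mult_mono power_mono) simp_all
  qed
  also have "\<dots> = real p * y * n ^ p" using False by (cases p) auto
  finally show ?thesis .
qed

lemma card_tup_fresh_ge:
  assumes X: "finite X" and Z: "finite Z"
  shows "(card X - card Z - p) ^ p \<le> card {xs \<in> tup X p. distinct xs \<and> set xs \<inter> Z = {}}"
  using Z
proof (induction p arbitrary: Z)
  case 0
  have "{xs \<in> tup X 0. distinct xs \<and> set xs \<inter> Z = {}} = {[]}" by auto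
  then show ?case by simp
next
  case (Suc p)
  let ?A = "\<lambda>Z. {xs \<in> tup X p. distinct xs \<and> set xs \<inter> Z = {}}"
  let ?S = "SIGMA x:X - Z. ?A (insert x Z)"
  have inj: "inj_on (\<lambda>(x, xs). x # xs) ?S" by (auto simp: inj_on_def)
  have "(\<lambda>(x, xs). x # xs) ` ?S \<subseteq> {xs \<in> tup X (Suc p). distinct xs \<and> set xs \<inter> Z = {}}"
    by (auto simp: tup_def)
  then have "card ((\<lambda>(x, xs). x # xs) ` ?S) \<le> card {xs \<in> tup X (Suc p). distinct xs \<and> set xs \<inter> Z = {}}"
    using X by (intro card_mono) auto
  moreover have "card ((\<lambda>(x, xs). x # xs) ` ?S) = (\<Sum>x\<in>X - Z. card (?A (insert x Z)))"
    using inj X by (simp add: card_image)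
  moreover have "(\<Sum>x\<in>X - Z. (card X - card Z - Suc p) ^ p) \<le> (\<Sum>x\<in>X - Z. card (?A (insert x Z)))"
  proof (rule sum_mono)
    fix x assume "x \<in> X - Z"
    then have "card X - card (insert x Z) - p = card X - card Z - Suc p" using Suc.prems by simp
    then show "(card X - card Z - Suc p) ^ p \<le> card (?A (insert x Z))"
      using Suc.IH[of "insert x Z"] Suc.prems by simp
  qed
  moreover have "(card X - card Z - Suc p) ^ Suc p \<le> (\<Sum>x\<in>X - Z. (card X - card Z - Suc p) ^ p)"
  proof -
    have "card X - card Z - Suc p \<le> card (X - Z)"
      using diff_card_le_card_Diff[OF Suc.prems, of X] by linarith
    then show ?thesis by (simp add: mult_le_mono1)
  qed
  ultimately show ?case by linarith
qed

lemma markov_card: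
  fixes f :: "'c \<Rightarrow> real"
  assumes S: "finite S" and f: "\<And>x. x \<in> S \<Longrightarrow> 0 \<le> f x"
  shows "real (card {x \<in> S. t < f x}) * t \<le> sum f S"
proof -
  have "real (card {x \<in> S. t < f x}) * t = (\<Sum>x\<in>{x \<in> S. t < f x}. t)" by simp
  also have "\<dots> \<le> (\<Sum>x\<in>{x \<in> S. t < f x}. f x)" by (intro sum_mono) auto
  also have "\<dots> \<le> sum f S" using S f by (intro sum_mono2) auto
  finally show ?thesis .
qed

section \<open>Degrees of \<open>(k - 2)\<close>-sets and the charging argument\<close>

lemma degree_plus_missing_pairs:
  assumes H: "uniform_hypergraph k V E" and k: "2 \<le> k" and S: "S \<subseteq> V" "card S = k - 2"
  shows "degree E S + card {P. P \<subseteq> V - S \<and> card P = 2 \<and> S \<union> P \<notin> E} = (card V - (k - 2)) choose 2"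
proof -
  have finV: "finite V" and edge: "\<And>e. e \<in> E \<Longrightarrow> e \<subseteq> V \<and> card e = k" using H by (auto simp: uniform_hypergraph_def)
  have finS: "finite S" using S(1) finV finite_subset by auto
  let ?P = "{P. P \<subseteq> V - S \<and> card P = 2}"
  let ?Y = "{P. P \<subseteq> V - S \<and> card P = 2 \<and> S \<union> P \<in> E}"
  let ?N = "{P. P \<subseteq> V - S \<and> card P = 2 \<and> S \<union> P \<notin> E}"
  have "{e \<in> E. S \<subseteq> e} = (\<lambda>P. S \<union> P) ` ?Y"
  proof
    show "{e \<in> E. S \<subseteq> e} \<subseteq> (\<lambda>P. S \<union> P) ` ?Y"
    proof
      fix e assume e: "e \<in> {e \<in> E. S \<subseteq> e}"
      then have "card (e - S) = 2" using edge[of e] S(2) finS k by (subst card_Diff_subset) auto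
      then have "e - S \<in> ?Y" using e edge[of e] by (auto simp: Un_absorb1)
      then show "e \<in> (\<lambda>P. S \<union> P) ` ?Y" using e by (intro image_eqI[of _ _ "e - S"]) auto
    qed
  qed auto
  moreover have "inj_on (\<lambda>P. S \<union> P) ?Y"
  proof (rule inj_onI)
    fix P P' assume "P \<in> ?Y" "P' \<in> ?Y" and eq: "S \<union> P = S \<union> P'"
    then have "P \<inter> S = {}" "P' \<inter> S = {}" by auto
    then show "P = P'" using eq by blast
  qed
  ultimately have "degree E S = card ?Y" by (simp add: degree_def card_image)
  moreover have "?P = ?Y \<union> ?N" by auto
  moreover have "card (?Y \<union> ?N) = card ?Y + card ?N" using finV by (intro card_Un_disjoint) auto
  moreover have "card ?P = (card V - (k - 2)) choose 2"
    using n_subsets[of "V - S" 2] finV finS S by (simp add: card_Diff_subset)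
  ultimately show ?thesis by simp
qed

text \<open>\<open>deg\<close> avoids subtraction. For \<open>S\<close> inside \<open>B\<close> it
  says that at least \<open>\<kappa>\<close> more pairs complete \<open>S\<close> to an edge than
  there are pairs outside \<open>S\<close> that meet \<open>A\<close>.\<close>

locale degree_condition =
  fixes k n \<kappa> :: nat and V A B :: "'a set" and E :: "'a set set"
  assumes H: "uniform_hypergraph k V E" and cV: "card V = n"
    and AB: "A \<union> B = V" "A \<inter> B = {}" and k3: "3 \<le> k"
    and deg: "\<And>S. S \<subseteq> V \<Longrightarrow> card S = k - 2 \<Longrightarrow>
      ((n - (k - 2)) choose 2) + \<kappa> \<le> degree E S + ((card B - (k - 2)) choose 2)"
begin

lemma finV: "finite V" and finA: "finite A" and finB: "finite B"
  using H AB by (auto simp: uniform_hypergraph_def)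

lemma AV: "A \<subseteq> V" and BV: "B \<subseteq> V" using AB by auto

lemma edge: "e \<in> E \<Longrightarrow> e \<subseteq> V" "e \<in> E \<Longrightarrow> card e = k"
  using H by (auto simp: uniform_hypergraph_def)

definition ne :: "'a set \<Rightarrow> bool" where "ne S \<longleftrightarrow> S \<subseteq> V \<and> card S = k \<and> S \<notin> E"

definition wB :: "nat \<Rightarrow> 'a set \<Rightarrow> nat" where "wB p Z = cnt B p (\<lambda>T. Z \<union> T \<in> E)"

text \<open>The number of missing pairs is at least \<open>\<kappa>\<close> below the number of
  pairs inside \<open>B - S\<close>, so a missing pair that meets \<open>A\<close> forces a present
  one inside \<open>B - S\<close>.\<close>

lemma pairs:
  assumes S: "S \<subseteq> V" "card S = k - 2"
  shows "card {P. P \<subseteq> V - S \<and> card P = 2 \<and> \<not> P \<subseteq> B \<and> S \<union> P \<notin> E} + \<kappa>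
    \<le> card {P. P \<subseteq> B - S \<and> card P = 2 \<and> S \<union> P \<in> E}"
proof -
  have finS: "finite S" using S(1) finV finite_subset by auto
  let ?M = "{P. P \<subseteq> V - S \<and> card P = 2 \<and> S \<union> P \<notin> E}"
  let ?NA = "{P. P \<subseteq> V - S \<and> card P = 2 \<and> \<not> P \<subseteq> B \<and> S \<union> P \<notin> E}"
  let ?NB = "{P. P \<subseteq> B - S \<and> card P = 2 \<and> S \<union> P \<notin> E}"
  let ?EB = "{P. P \<subseteq> B - S \<and> card P = 2 \<and> S \<union> P \<in> E}"
  have d: "degree E S + card ?M = (n - (k - 2)) choose 2"
    using degree_plus_missing_pairs[OF H _ S] k3 cV by simp
  have "?M = ?NA \<union> ?NB" using BV by auto
  moreover have "card (?NA \<union> ?NB) = card ?NA + card ?NB"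
    using finV finB by (intro card_Un_disjoint) auto
  ultimately have m: "card ?M = card ?NA + card ?NB" by (simp only:)
  have "{P. P \<subseteq> B - S \<and> card P = 2} = ?EB \<union> ?NB" by auto
  moreover have "card (?EB \<union> ?NB) = card ?EB + card ?NB"
    using finB by (intro card_Un_disjoint) auto
  ultimately have e: "card (B - S) choose 2 = card ?EB + card ?NB"
    using n_subsets[of "B - S" 2] finB by simp
  have "(card B - (k - 2)) choose 2 \<le> card (B - S) choose 2"
    using diff_card_le_card_Diff[OF finS, of B] S(2) unfolding choose_two
    by (intro div_le_mono mult_le_mono) auto
  then show ?thesis using deg[OF S] d m e by linarith
qed

lemma tup_1: "tup X (Suc 0) = (\<lambda>x. [x]) ` X"
  by (auto simp: tup_def length_Suc_conv image_iff)

lemma nonedges_pairs: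
  assumes S: "S \<subseteq> V" "card S \<le> k - 2"
  shows "(\<Sum>x\<in>A. cnt B 1 (\<lambda>T. ne (insert x (S \<union> T)))) \<le> cnt B 2 (\<lambda>T. S \<union> T \<in> E)"
proof -
  have finS: "finite S" using S(1) finV finite_subset by auto
  let ?P = "SIGMA x:A. {b \<in> B. ne (insert x (S \<union> {b}))}"
  have c1: "cnt B (Suc 0) P = card {b \<in> B. P {b}}" for P
  proof -
    have "{xs \<in> tup B (Suc 0). P (set xs)} = (\<lambda>x. [x]) ` {b \<in> B. P {b}}" unfolding tup_1 by auto
    then show ?thesis by (simp add: cnt_def card_image inj_on_def)
  qed
  have "(\<Sum>x\<in>A. cnt B 1 (\<lambda>T. ne (insert x (S \<union> T)))) = card ?P"
    using finA finB by (simp add: c1)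
  also have "\<dots> \<le> cnt B 2 (\<lambda>T. S \<union> T \<in> E)"
  proof (cases "card S = k - 2")
    \<comment> \<open>This arises from tuples with repetitions; two more vertices then cannot make a
      \<open>k\<close>-set.\<close>
    case False
    have "\<not> ne (insert x (S \<union> {b}))" for x b
      using card_insert_le_m1[of "k - 1" "S \<union> {b}" x] card_insert_le_m1[of "k - 2" S b] False S(2) k3 finS
      by (auto simp: ne_def card_insert_if split: if_splits)
    then have "?P = {}" by auto
    then show ?thesis by (metis card.empty le0)
  next
    case True
    let ?N = "{P. P \<subseteq> V - S \<and> card P = 2 \<and> \<not> P \<subseteq> B \<and> S \<union> P \<notin> E}"
    let ?M = "{P. P \<subseteq> B - S \<and> card P = 2 \<and> S \<union> P \<in> E}"
    let ?f = "\<lambda>(x, b). {x, b}"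
    have "inj_on ?f ?P"
      using AB by (auto simp: inj_on_def doubleton_eq_iff)
    moreover have "?f ` ?P \<subseteq> ?N"
    proof
      fix Q assume "Q \<in> ?f ` ?P"
      then obtain x b where xb: "x \<in> A" "b \<in> B" "ne (insert x (S \<union> {b}))" "Q = {x, b}" by auto
      have "card (insert x (S \<union> {b})) = k" using xb by (simp add: ne_def)
      then have "x \<notin> S" "b \<notin> S" "x \<noteq> b" using True finS k3
        by (auto simp: card_insert_if split: if_splits)
      moreover have "S \<union> {x, b} = insert x (S \<union> {b})" by auto
      ultimately show "Q \<in> ?N" using xb AB by (auto simp: ne_def)
    qed
    moreover have "finite ?N" using finV by simp
    ultimately have "card ?P \<le> card ?N" by (rule card_inj_on_le)
    also have "\<dots> \<le> card ?M" using pairs[OF S(1) True] by linarith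
    also have "\<dots> \<le> card {xs \<in> tup B 2. S \<union> set xs \<in> E}"
    proof -
      have "?M \<subseteq> set ` {xs \<in> tup B 2. S \<union> set xs \<in> E}"
      proof
        fix P assume P: "P \<in> ?M"
        then obtain a b where "P = {a, b}" by (auto simp: card_2_iff)
        then show "P \<in> set ` {xs \<in> tup B 2. S \<union> set xs \<in> E}"
          using P by (intro image_eqI[of _ _ "[a, b]"]) (auto simp: tup_def)
      qed
      then show ?thesis using finB by (intro surj_card_le) auto
    qed
    finally show ?thesis by (simp add: cnt_def)
  qed
  finally show ?thesis .
qed

text \<open>A non-edge that contains a single new vertex of \<open>A\<close> is charged, by the degree condition for
  one of its \<open>(k - 2)\<close>-subsets, to an edge whose new vertices all lie in \<open>B\<close>.\<close>

lemma nonedges_le_edges: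
  assumes Z: "Z \<subseteq> V" "card Z + p + 2 = k"
  shows "(\<Sum>x\<in>A. cnt B (p + 1) (\<lambda>T. ne (insert x (Z \<union> T)))) \<le> wB (p + 2) Z"
proof -
  have finZ: "finite Z" using Z(1) finV finite_subset by auto
  have "(\<Sum>x\<in>A. cnt B (p + 1) (\<lambda>T. ne (insert x (Z \<union> T))))
     = (\<Sum>us\<in>tup B p. \<Sum>x\<in>A. cnt B 1 (\<lambda>T. ne (insert x ((Z \<union> set us) \<union> T))))"
    unfolding cnt_split[OF finB, of p 1] by (subst sum.swap) (simp only: Un_assoc)
  also have "\<dots> \<le> (\<Sum>us\<in>tup B p. cnt B 2 (\<lambda>T. (Z \<union> set us) \<union> T \<in> E))"
  proof (rule sum_mono)
    fix us assume us: "us \<in> tup B p"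
    have "card (Z \<union> set us) \<le> card Z + p"
      using us card_Un_le[of Z "set us"] card_length[of us] by (simp add: tup_def)
    then show "(\<Sum>x\<in>A. cnt B 1 (\<lambda>T. ne (insert x ((Z \<union> set us) \<union> T)))) \<le> cnt B 2 (\<lambda>T. (Z \<union> set us) \<union> T \<in> E)"
      using us Z BV by (intro nonedges_pairs) (auto simp: tup_def)
  qed
  also have "\<dots> = wB (p + 2) Z"
    unfolding wB_def by (simp only: cnt_split[OF finB, of p 2] Un_assoc)
  finally show ?thesis .
qed

lemma finE: "finite E" using finV edge(1) by (intro finite_subset[of E "Pow V"]) auto

text \<open>A tuple that completes \<open>Z\<close> to a \<open>k\<close>-set has distinct entries
  outside \<open>Z\<close>, so an edge is counted once for every order of its \<open>p\<close> other
  vertices.\<close>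

lemma wB_eq:
  assumes Z: "Z \<subseteq> V" "card Z + p = k"
  shows "wB p Z = fact p * card {e \<in> E. Z \<subseteq> e \<and> e - Z \<subseteq> B}"
proof -
  let ?D = "{e \<in> E. Z \<subseteq> e \<and> e - Z \<subseteq> B}"
  let ?L = "\<lambda>e. {xs. set xs = e - Z \<and> distinct xs}"
  have finZ: "finite Z" using Z(1) finV finite_subset by auto
  have cL: "card (?L e) = fact p \<and> finite (?L e)" if e: "e \<in> ?D" for e
  proof -
    have fin: "finite (e - Z)" and c: "card (e - Z) = p"
      using e edge[of e] finV finite_subset[of e V] Z finZ by (auto simp: card_Diff_subset)
    have "?L e = {xs. length xs = p \<and> distinct xs \<and> set xs \<subseteq> e - Z}"
    proof
      show "{xs. length xs = p \<and> distinct xs \<and> set xs \<subseteq> e - Z} \<subseteq> ?L e"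
      proof
        fix xs assume xs: "xs \<in> {xs. length xs = p \<and> distinct xs \<and> set xs \<subseteq> e - Z}"
        then have "card (set xs) = card (e - Z)" using c distinct_card[of xs] by simp
        then have "set xs = e - Z" using card_subset_eq[OF fin, of "set xs"] xs by simp
        then show "xs \<in> ?L e" using xs by simp
      qed
    qed (use c in \<open>auto simp: distinct_card[symmetric]\<close>)
    moreover have "card {xs. length xs = p \<and> distinct xs \<and> set xs \<subseteq> e - Z} = \<Prod>{card (e - Z) - p + 1..card (e - Z)}"
      using fin c by (intro card_lists_distinct_length_eq) auto
    moreover have "\<Prod>{card (e - Z) - p + 1..card (e - Z)} = fact p" using c by (simp add: fact_prod)
    moreover have "finite {xs. length xs = p \<and> distinct xs \<and> set xs \<subseteq> e - Z}"
      by (rule finite_subset[OF _ finite_tup[OF fin, of p]]) (auto simp: tup_def)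
    ultimately show ?thesis by simp
  qed
  have "{xs \<in> tup B p. Z \<union> set xs \<in> E} = (\<Union>e\<in>?D. ?L e)"
  proof
    show "{xs \<in> tup B p. Z \<union> set xs \<in> E} \<subseteq> (\<Union>e\<in>?D. ?L e)"
    proof
      fix xs assume xs: "xs \<in> {xs \<in> tup B p. Z \<union> set xs \<in> E}"
      then have c: "card (Z \<union> set xs) = k" "length xs = p" "set xs \<subseteq> B" using edge by (auto simp: tup_def)
      have "card (Z \<union> set xs) + card (Z \<inter> set xs) = card Z + card (set xs)"
        using card_Un_Int[OF finZ, of "set xs"] by simp
      then have "card (set xs) = p" "card (Z \<inter> set xs) = 0" using c Z card_length[of xs] by linarith+
      then have "distinct xs" "Z \<inter> set xs = {}" using c finZ by (auto intro: card_distinct)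
      then show "xs \<in> (\<Union>e\<in>?D. ?L e)" using xs c by (intro UN_I[of "Z \<union> set xs"]) auto
    qed
    show "(\<Union>e\<in>?D. ?L e) \<subseteq> {xs \<in> tup B p. Z \<union> set xs \<in> E}"
    proof
      fix xs assume "xs \<in> (\<Union>e\<in>?D. ?L e)"
      then obtain e where e: "e \<in> ?D" "set xs = e - Z" "distinct xs" by auto
      have "card (e - Z) = p" using e(1) edge[of e] Z finZ by (auto simp: card_Diff_subset)
      then have "length xs = p" using e distinct_card[of xs] by simp
      moreover have "Z \<union> (e - Z) = e" using e(1) by auto
      ultimately show "xs \<in> {xs \<in> tup B p. Z \<union> set xs \<in> E}" using e by (auto simp: tup_def)
    qed
  qed
  moreover have "card (\<Union>e\<in>?D. ?L e) = (\<Sum>e\<in>?D. card (?L e))"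
  proof (rule card_UN_disjoint)
    show "finite ?D" using finE by simp
    show "\<forall>e\<in>?D. finite (?L e)" using cL by simp
    show "\<forall>e\<in>?D. \<forall>f\<in>?D. e \<noteq> f \<longrightarrow> ?L e \<inter> ?L f = {}"
    proof (intro ballI impI)
      fix e f assume "e \<in> ?D" "f \<in> ?D" "e \<noteq> f"
      then have "e - Z \<noteq> f - Z" by (metis (mono_tags, lifting) Diff_partition mem_Collect_eq)
      then show "?L e \<inter> ?L f = {}" by auto
    qed
  qed
  moreover have "(\<Sum>e\<in>?D. card (?L e)) = fact p * card ?D" using cL by simp
  ultimately show ?thesis by (simp add: wB_def cnt_def)
qed

end

text \<open>\<open>N\<close> is the number of edges of a Hamiltonian \<open>l\<close>-cycle. By the
  bound on \<open>h\<close>, one power of \<open>h\<close> absorbs any constant up to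
  \<open>(16 * real k) ^ (4 * k)\<close>, and \<open>big\<close> makes \<open>n\<close> dominate
  such constants. For \<open>l = 1\<close> and even \<open>N\<close>, two edges through each
  \<open>(k - 2)\<close>-set of \<open>B\<close> are required by \<open>two_edges\<close>, hence
  \<open>2 <= \<kappa>\<close>.\<close>

locale near_extremal = degree_condition +
  fixes l N :: nat and h :: real
  assumes l: "1 \<le> l" "2 * l < k"
    and N: "n = N * (k - l)" "N = 2 * card A + 1 \<or> N = 2 * card A + 2"
    and h: "0 < h" "h * (16 * real k) ^ (4 * k) \<le> 1" and big: "1 \<le> h ^ 20 * real n"
    and sparse: "real (wB k {}) \<le> h ^ 11 * real n ^ k"
    and minimal: "\<And>A' B'. A' \<union> B' = V \<Longrightarrow> A' \<inter> B' = {} \<Longrightarrow> card A' = card A \<Longrightarrow>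
      edges_within E B \<le> edges_within E B'"
    and kappa: "1 \<le> \<kappa>" "l = 1 \<Longrightarrow> even N \<Longrightarrow> 2 \<le> \<kappa>"
begin

section \<open>Arithmetic of the powers of \<open>h\<close>\<close>

lemma h_times_le: "C \<le> (16 * real k) ^ (4 * k) \<Longrightarrow> h * C \<le> 1"
  using mult_left_mono[of C "(16 * real k) ^ (4 * k)" h] h by linarith

lemma k_power_le: "(16 * real k) ^ i \<le> (16 * real k) ^ (4 * k)" if "i \<le> 4 * k"
  using that k3 by (intro power_increasing) auto

lemma h_k: "h * (16 * real k) ^ i \<le> 1" if "i \<le> 4 * k"
  using h_times_le[OF k_power_le[OF that]] .

lemma h_small: "h * real k \<le> 1 / 256" "h \<le> 1 / 256" "h * (real k)\<^sup>2 \<le> 1 / 256" "h \<le> 1"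
proof -
  have a: "h * (256 * (real k)\<^sup>2) \<le> 1"
    using h_k[of 2] k3 by (simp add: power_mult_distrib)
  then show "h * (real k)\<^sup>2 \<le> 1 / 256" by simp
  have "h * real k \<le> h * (real k)\<^sup>2" "h * 1 \<le> h * real k"
    using k3 h by (auto intro!: mult_left_mono simp: power2_eq_square)
  then show "h * real k \<le> 1 / 256" "h \<le> 1 / 256" "h \<le> 1" using a by auto
qed

lemma h_power_mono: "i \<le> j \<Longrightarrow> h ^ j \<le> h ^ i"
  using h h_small by (intro power_decreasing) auto

lemma h_power_gap: "C \<le> (16 * real k) ^ (4 * k) \<Longrightarrow> C * h ^ Suc i \<le> h ^ i"
  using h_times_le[of C] mult_right_mono[of "h * C" 1 "h ^ i"] h by (simp add: mult_ac)

lemma n0: "0 < n" using big by (cases n) auto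

lemma const_le: "C \<le> (16 * real k) ^ (4 * k) \<Longrightarrow> C \<le> h ^ 19 * real n"
proof -
  assume C: "C \<le> (16 * real k) ^ (4 * k)"
  have "h * C \<le> 1" by (rule h_times_le[OF C])
  also have "\<dots> \<le> h * (h ^ 19 * real n)" using big by (simp add: power_Suc[symmetric] mult.assoc[symmetric] del: power_Suc)
  finally show ?thesis using h by simp
qed

lemma n_big: "100 * k \<le> n" "100 * real k \<le> real n"
proof -
  have "100 * real k \<le> (16 * real k) ^ 2" using k3 by (simp add: power2_eq_square)
  also have "\<dots> \<le> (16 * real k) ^ (4 * k)" using k3 by (intro k_power_le) simp
  finally have "100 * real k \<le> h ^ 19 * real n" by (rule const_le)
  also have "\<dots> \<le> 1 * real n" using h h_small by (intro mult_right_mono power_le_one) auto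
  finally show "100 * real k \<le> real n" by simp
  then show "100 * k \<le> n" by linarith
qed

lemma cardB_ge: "3 * n \<le> 4 * card B"
proof -
  have "2 \<le> k - l" using l k3 by linarith
  then have "N * 2 \<le> n" unfolding N(1) by (rule mult_le_mono2)
  then have "4 * card A \<le> n" using N(2) by linarith
  moreover have "card A + card B = n" using cV AB finA finB card_Un_disjoint[of A B] by simp
  ultimately show ?thesis by linarith
qed

text \<open>\<open>XA\<close> consists of the vertices that lie in many edges with \<open>k - 1\<close> vertices of \<open>B\<close>, so that it can
  play the role of \<open>A\<close> in the cycle; \<open>Ag\<close> consists of those that do so in almost every way.\<close>

definition XA where "XA = {v \<in> V. h ^ 4 * real n ^ (k - 1) \<le> real (wB (k - 1) {v})}"
definition XB where "XB = V - XA"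
definition Ag where "Ag = {y \<in> A. real (cnt B (k - 1) (\<lambda>T. ne (insert y T))) \<le> h ^ 4 * real n ^ (k - 1)}"

lemma sets: "XA \<subseteq> V" "XB \<subseteq> V" "Ag \<subseteq> A" "Ag \<subseteq> V" "finite XA" "finite XB" "finite Ag" "XA \<inter> XB = {}" "XA \<union> XB = V"
  using finV AV finA by (auto simp: XA_def XB_def Ag_def)

text \<open>Since \<open>5/8 - 1/16 - 1/100 > 1/2\<close>, more than half of all vertices stay
  available for each entry. Both \<open>B\<close> and \<open>XB\<close> have at least
  \<open>5/8 * n\<close> vertices.\<close>

lemma fresh_count:
  assumes X: "X \<subseteq> V" "5 * n \<le> 8 * card X" and Z: "finite Z" "16 * card Z \<le> n" and p: "p \<le> k"
  shows "(real n / 2) ^ p \<le> real (card {xs \<in> tup X p. distinct xs \<and> set xs \<inter> Z = {}})"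
proof -
  have finX: "finite X" using X(1) finV finite_subset by auto
  have "n \<le> 2 * (card X - card Z - p)" using X Z p n_big by linarith
  then have "real n / 2 \<le> real (card X - card Z - p)" by linarith
  then have "(real n / 2) ^ p \<le> real (card X - card Z - p) ^ p" by (intro power_mono) auto
  also have "\<dots> \<le> real (card {xs \<in> tup X p. distinct xs \<and> set xs \<inter> Z = {}})"
    using card_tup_fresh_ge[OF finX Z(1), of p] unfolding of_nat_power[symmetric] by (rule of_nat_mono)
  finally show ?thesis .
qed

lemma edges_plus_nonedges:
  assumes y: "y \<in> A"
  shows "(real n / 2) ^ (k - 1) \<le> real (wB (k - 1) {y}) + real (cnt B (k - 1) (\<lambda>T. ne (insert y T)))"
proof -
  have "{xs \<in> tup B (k - 1). distinct xs \<and> set xs \<inter> {y} = {}} \<subseteq>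
    {xs \<in> tup B (k - 1). {y} \<union> set xs \<in> E} \<union> {xs \<in> tup B (k - 1). ne (insert y (set xs))}"
  proof
    fix xs assume xs: "xs \<in> {xs \<in> tup B (k - 1). distinct xs \<and> set xs \<inter> {y} = {}}"
    then have "card (insert y (set xs)) = k" "insert y (set xs) \<subseteq> V"
      using k3 y AV BV by (auto simp: tup_def distinct_card)
    then show "xs \<in> {xs \<in> tup B (k - 1). {y} \<union> set xs \<in> E} \<union> {xs \<in> tup B (k - 1). ne (insert y (set xs))}"
      using xs by (simp add: ne_def)
  qed
  then have "card {xs \<in> tup B (k - 1). distinct xs \<and> set xs \<inter> {y} = {}} \<le>
    card ({xs \<in> tup B (k - 1). {y} \<union> set xs \<in> E} \<union> {xs \<in> tup B (k - 1). ne (insert y (set xs))})"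
    using finB by (intro card_mono) auto
  also have "\<dots> \<le> wB (k - 1) {y} + cnt B (k - 1) (\<lambda>T. ne (insert y T))"
    unfolding wB_def cnt_def by (rule card_Un_le)
  finally have "real (card {xs \<in> tup B (k - 1). distinct xs \<and> set xs \<inter> {y} = {}}) \<le>
     real (wB (k - 1) {y}) + real (cnt B (k - 1) (\<lambda>T. ne (insert y T)))" by linarith
  moreover have "(real n / 2) ^ (k - 1) \<le> real (card {xs \<in> tup B (k - 1). distinct xs \<and> set xs \<inter> {y} = {}})"
    using BV cardB_ge n_big k3 by (intro fresh_count) auto
  ultimately show ?thesis by linarith
qed

text \<open>The factor 4 leaves room to subtract terms of order \<open>h ^ 4\<close>;
  \<open>8 * real k ^ 2\<close> is twice the loss \<open>4 * real k ^ 2\<close> that occurs when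
  disjoint edges are chosen in \<open>B\<close>.\<close>

lemma half_power: "4 * h ^ 4 * real n ^ (k - 1) < (real n / 2) ^ (k - 1)"
  and half_power': "8 * real k ^ 2 * h ^ 4 * real n ^ (k - 1) \<le> (real n / 2) ^ (k - 1)"
proof -
  have "8 * real k ^ 2 * 2 ^ (k - 1) \<le> (16 * real k) ^ 2 * (16 * real k) ^ (k - 1)"
    using k3 by (intro mult_mono power_mono) (auto simp: power2_eq_square)
  also have "\<dots> = (16 * real k) ^ (2 + (k - 1))" by (simp only: power_add)
  also have "\<dots> \<le> (16 * real k) ^ (4 * k)" using k3 by (intro k_power_le) simp
  finally have "8 * real k ^ 2 * 2 ^ (k - 1) * h ^ Suc 3 \<le> h ^ 3" by (rule h_power_gap)
  also have "\<dots> \<le> 1" using h h_small by (intro power_le_one) auto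
  finally have a: "8 * real k ^ 2 * h ^ 4 * 2 ^ (k - 1) \<le> 1" by (simp add: mult_ac)
  then have "8 * real k ^ 2 * h ^ 4 * 2 ^ (k - 1) * (real n / 2) ^ (k - 1) \<le> 1 * (real n / 2) ^ (k - 1)"
    by (intro mult_right_mono) auto
  moreover have "2 ^ (k - 1) * (real n / 2) ^ (k - 1) = real n ^ (k - 1)"
    by (simp add: power_divide)
  ultimately show b: "8 * real k ^ 2 * h ^ 4 * real n ^ (k - 1) \<le> (real n / 2) ^ (k - 1)"
    by (simp only: mult.assoc mult_1)
  have "3 ^ 2 \<le> real k ^ 2" using k3 by (intro power_mono) auto
  then have "4 < 8 * real k ^ 2" by simp
  then have "4 * (h ^ 4 * real n ^ (k - 1)) < 8 * real k ^ 2 * (h ^ 4 * real n ^ (k - 1))"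
    using h n0 by (intro mult_strict_right_mono) auto
  then show "4 * h ^ 4 * real n ^ (k - 1) < (real n / 2) ^ (k - 1)"
    using b by (simp only: mult.assoc)
qed

section \<open>Exceptional vertices are few and lie on one side\<close>

lemma Ag_XA: "Ag \<subseteq> XA"
proof
  fix y assume y: "y \<in> Ag"
  then have "(real n / 2) ^ (k - 1) \<le> real (wB (k - 1) {y}) + h ^ 4 * real n ^ (k - 1)"
    using edges_plus_nonedges[of y] by (auto simp: Ag_def)
  moreover have "0 \<le> h ^ 4 * real n ^ (k - 1)" using h by simp
  moreover have "4 * (h ^ 4 * real n ^ (k - 1)) < (real n / 2) ^ (k - 1)" using half_power by simp
  ultimately have "h ^ 4 * real n ^ (k - 1) \<le> real (wB (k - 1) {y})" by linarith
  then show "y \<in> XA" using y sets by (auto simp: XA_def)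
qed

lemma XB_Ag: "Ag \<inter> XB = {}" using Ag_XA by (auto simp: XB_def)

text \<open>Markov's inequality: charging bounds the non-edges by \<open>h ^ 11 * n ^ k\<close>, and
  each vertex of \<open>A - Ag\<close> is in more than \<open>h ^ 4 * n ^ (k - 1)\<close> of
  them.\<close>

lemma card_A_minus_Ag: "real (card (A - Ag)) \<le> h ^ 7 * real n"
proof -
  let ?f = "\<lambda>y. real (cnt B (k - 1) (\<lambda>T. ne (insert y T)))"
  have "real (card {y \<in> A. h ^ 4 * real n ^ (k - 1) < ?f y}) * (h ^ 4 * real n ^ (k - 1)) \<le> sum ?f A"
    by (rule markov_card[OF finA]) simp
  moreover have "{y \<in> A. h ^ 4 * real n ^ (k - 1) < ?f y} = A - Ag" by (auto simp: Ag_def)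
  moreover have "sum ?f A \<le> real (wB k {})"
  proof -
    have "(\<Sum>y\<in>A. cnt B (k - 2 + 1) (\<lambda>T. ne (insert y ({} \<union> T)))) \<le> wB (k - 2 + 2) {}"
      using k3 by (intro nonedges_le_edges) auto
    moreover have "k - 2 + 1 = k - 1" "k - 2 + 2 = k" using k3 by auto
    ultimately have "(\<Sum>y\<in>A. cnt B (k - 1) (\<lambda>T. ne (insert y T))) \<le> wB k {}" by simp
    then show ?thesis unfolding of_nat_sum[symmetric] by (rule of_nat_mono)
  qed
  ultimately have "real (card (A - Ag)) * (h ^ 4 * real n ^ (k - 1)) \<le> h ^ 11 * real n ^ k"
    using sparse by simp
  also have "\<dots> = (h ^ 7 * real n) * (h ^ 4 * real n ^ (k - 1))"
    using k3 by (cases k) (simp_all add: power_add[symmetric] mult_ac)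
  finally show ?thesis using h n0 by simp
qed

lemma card_R: "real (card (B \<inter> XA)) \<le> h ^ 7 * real n"
proof -
  have "B \<inter> XA = {v \<in> B. h ^ 4 * real n ^ (k - 1) \<le> real (wB (k - 1) {v})}" using BV by (auto simp: XA_def)
  then have "real (card (B \<inter> XA)) * (h ^ 4 * real n ^ (k - 1)) = (\<Sum>v\<in>B \<inter> XA. h ^ 4 * real n ^ (k - 1))" by simp
  also have "\<dots> \<le> (\<Sum>v\<in>B \<inter> XA. real (wB (k - 1) {v}))"
    by (intro sum_mono) (auto simp: XA_def)
  also have "\<dots> \<le> (\<Sum>v\<in>B. real (wB (k - 1) {v}))" using finB by (intro sum_mono2) auto
  also have "\<dots> = real (wB (1 + (k - 1)) {})"
    unfolding wB_def cnt_split[OF finB, of 1]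
    by (simp add: tup_1 sum.reindex inj_on_def)
  also have "1 + (k - 1) = k" using k3 by simp
  finally have "real (card (B \<inter> XA)) * (h ^ 4 * real n ^ (k - 1)) \<le> h ^ 11 * real n ^ k"
    using sparse by simp
  also have "\<dots> = (h ^ 7 * real n) * (h ^ 4 * real n ^ (k - 1))"
    using k3 by (cases k) (simp_all add: power_add[symmetric] mult_ac)
  finally show ?thesis using h n0 by simp
qed

lemma card_Q: "real (card (A - XA)) \<le> h ^ 7 * real n"
proof -
  have "card (A - XA) \<le> card (A - Ag)" using Ag_XA finA by (intro card_mono) auto
  then show ?thesis using card_A_minus_Ag by linarith
qed

text \<open>Otherwise, exchanging a vertex of \<open>A - XA\<close> with one of
  \<open>B \<inter> XA\<close> would leave fewer edges in \<open>B\<close>, against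
  \<open>minimal\<close>.\<close>

lemma Q_or_R_empty: "A - XA = {} \<or> B \<inter> XA = {}"
proof (rule ccontr)
  assume "\<not> ?thesis"
  then obtain v w where v: "v \<in> A" "v \<notin> XA" and w: "w \<in> B" "w \<in> XA" by blast
  define A' where "A' = insert w (A - {v})"
  define B' where "B' = insert v (B - {w})"
  define D where "D u = {e \<in> E. {u} \<subseteq> e \<and> e - {u} \<subseteq> B}" for u
  have finE: "finite E" using finV edge(1) by (intro finite_subset[of E "Pow V"]) auto
  have vV: "v \<in> V" "w \<in> V" using v w AV BV by auto
  have 1: "A' \<union> B' = V" "A' \<inter> B' = {}" using v w AB by (auto simp: A'_def B'_def)
  have "w \<notin> A" using w AB by auto
  then have 2: "card A' = card A" using v finA card_Suc_Diff1[OF finA v(1)] by (simp add: A'_def)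
  have "{e \<in> E. e \<subseteq> B'} \<subseteq> ({e \<in> E. e \<subseteq> B} - D w) \<union> D v" by (auto simp: B'_def D_def)
  then have "edges_within E B' \<le> card (({e \<in> E. e \<subseteq> B} - D w) \<union> D v)"
    unfolding edges_within_def using finE by (intro card_mono) (auto simp: D_def)
  also have "\<dots> \<le> card ({e \<in> E. e \<subseteq> B} - D w) + card (D v)" by (rule card_Un_le)
  also have "card ({e \<in> E. e \<subseteq> B} - D w) = edges_within E B - card (D w)"
    unfolding edges_within_def using finE w by (intro card_Diff_subset) (auto simp: D_def)
  finally have "edges_within E B' \<le> edges_within E B - card (D w) + card (D v)" .
  moreover have "card (D w) \<le> edges_within E B"
    unfolding edges_within_def using finE w by (intro card_mono) (auto simp: D_def)
  ultimately have "card (D w) \<le> card (D v)" using minimal[OF 1 2] by linarith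
  then have "wB (k - 1) {w} \<le> wB (k - 1) {v}"
    using wB_eq[of "{v}" "k - 1"] wB_eq[of "{w}" "k - 1"] vV k3 by (simp add: D_def)
  then show False using v w vV by (simp add: XA_def)
qed

section \<open>Non-edges between \<open>Ag\<close> and \<open>XB\<close>, good sets and
  conflicts\<close>

definition NK :: "nat \<Rightarrow> 'a set \<Rightarrow> nat" where
  "NK p Z = (\<Sum>y\<in>Ag. cnt XB p (\<lambda>T. ne (insert y (Z \<union> T))))"

lemma XB_subset: "XB \<subseteq> B \<union> (A - XA)" using AB by (auto simp: XB_def)

lemma card_le_n: "X \<subseteq> V \<Longrightarrow> real (card X) \<le> real n" using card_mono[OF finV, of X] cV by simp

text \<open>\<open>XB\<close> exceeds \<open>B\<close> only by \<open>A - XA\<close>, which has at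
  most \<open>h ^ 7 * n\<close> vertices.\<close>

lemma cnt_XB_le: "real (cnt XB p P) \<le> real (cnt B p P) + real p * h ^ 7 * real n ^ p"
proof -
  have "{xs \<in> tup XB p. P (set xs)} \<subseteq> {xs \<in> tup B p. P (set xs)} \<union> {xs \<in> tup XB p. set xs \<inter> (A - XA) \<noteq> {}}"
    using XB_subset by (fastforce simp: tup_def)
  then have "cnt XB p P \<le> card ({xs \<in> tup B p. P (set xs)} \<union> {xs \<in> tup XB p. set xs \<inter> (A - XA) \<noteq> {}})"
    unfolding cnt_def using finB sets by (intro card_mono) auto
  also have "\<dots> \<le> cnt B p P + card {xs \<in> tup XB p. set xs \<inter> (A - XA) \<noteq> {}}"
    unfolding cnt_def by (rule card_Un_le)
  finally have "real (cnt XB p P) \<le> real (cnt B p P) + real (card {xs \<in> tup XB p. set xs \<inter> (A - XA) \<noteq> {}})"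
    by linarith
  also have "real (card {xs \<in> tup XB p. set xs \<inter> (A - XA) \<noteq> {}}) \<le> real p * h ^ 7 * real n ^ p"
    using card_tup_hit_le[of XB "real n" "A - XA" "h ^ 7" p] sets card_le_n finA card_Q by simp
  finally show ?thesis by simp
qed

text \<open>This transfers \<open>nonedges_le_edges\<close> to \<open>Ag\<close> and
  \<open>XB\<close>; the second term pays for tuples that hit \<open>A - XA\<close>.\<close>

lemma NK_le:
  assumes Z: "Z \<subseteq> V" "card Z + p + 2 = k"
  shows "real (NK (p + 1) Z) \<le> real (wB (p + 2) Z) + real k * h ^ 7 * real n ^ (p + 2)"
proof -
  have h0: "0 \<le> h ^ 7" using h by simp
  have "real (NK (p + 1) Z) \<le> (\<Sum>y\<in>Ag. real (cnt B (p + 1) (\<lambda>T. ne (insert y (Z \<union> T)))) + real (p + 1) * h ^ 7 * real n ^ (p + 1))"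
    unfolding NK_def of_nat_sum by (intro sum_mono cnt_XB_le)
  also have "\<dots> = (\<Sum>y\<in>Ag. real (cnt B (p + 1) (\<lambda>T. ne (insert y (Z \<union> T))))) + real (card Ag) * (real (p + 1) * h ^ 7 * real n ^ (p + 1))"
    by (simp only: sum.distrib sum_constant)
  also have "(\<Sum>y\<in>Ag. real (cnt B (p + 1) (\<lambda>T. ne (insert y (Z \<union> T))))) \<le> (\<Sum>y\<in>A. real (cnt B (p + 1) (\<lambda>T. ne (insert y (Z \<union> T)))))"
    using finA sets by (intro sum_mono2) auto
  also have "\<dots> \<le> real (wB (p + 2) Z)"
    unfolding of_nat_sum[symmetric] using nonedges_le_edges[OF Z] by (rule of_nat_mono)
  also have "real (card Ag) * (real (p + 1) * h ^ 7 * real n ^ (p + 1)) \<le> real n * (real k * h ^ 7 * real n ^ (p + 1))"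
    using card_le_n[OF sets(4)] Z h0 by (intro mult_mono mult_nonneg_nonneg) auto
  also have "\<dots> = real k * h ^ 7 * real n ^ (p + 2)" by simp
  finally show ?thesis by simp
qed

lemma NK_split: "NK (p + q) Z = (\<Sum>us\<in>tup XB p. NK q (Z \<union> set us))"
  unfolding NK_def cnt_split[OF sets(6), of p q] by (subst sum.swap) (simp only: Un_assoc)

lemma h_arith: "h ^ 4 + real k * h ^ 7 \<le> h ^ 3" "h ^ 11 + real k * h ^ 7 \<le> h ^ 6"
proof -
  have 1: "real k * h ^ 7 \<le> h ^ 6 * (1 / 256)"
    using mult_left_mono[OF h_small(1), of "h ^ 6"] h by (simp add: power_Suc[symmetric] eval_nat_numeral mult_ac)
  have 2: "h ^ 4 \<le> h ^ 3 * (1 / 256)"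
    using mult_left_mono[OF h_small(2), of "h ^ 3"] h by (simp add: eval_nat_numeral mult_ac)
  have 3: "h ^ 11 \<le> h ^ 7" "h ^ 6 \<le> h ^ 3" by (simp_all add: h_power_mono)
  have 4: "h ^ 7 \<le> h ^ 6 * (1 / 256)"
    using mult_left_mono[OF h_small(2), of "h ^ 6"] h by (simp add: eval_nat_numeral mult_ac)
  have 5: "0 \<le> h ^ 3" "0 \<le> h ^ 6" using h by simp_all
  show "h ^ 4 + real k * h ^ 7 \<le> h ^ 3" "h ^ 11 + real k * h ^ 7 \<le> h ^ 6" using 1 2 3 4 5 by linarith+
qed

lemma NK_vertex: "z \<in> XB \<Longrightarrow> real (NK (k - 2) {z}) \<le> h ^ 3 * real n ^ (k - 1)"
proof -
  assume z: "z \<in> XB"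
  have e: "k - 3 + 1 = k - 2" "k - 3 + 2 = k - 1" using k3 by auto
  have "real (NK (k - 3 + 1) {z}) \<le> real (wB (k - 3 + 2) {z}) + real k * h ^ 7 * real n ^ (k - 3 + 2)"
    using z sets k3 by (intro NK_le) auto
  moreover have "real (wB (k - 1) {z}) \<le> h ^ 4 * real n ^ (k - 1)" using z by (auto simp: XB_def XA_def)
  ultimately have "real (NK (k - 2) {z}) \<le> (h ^ 4 + real k * h ^ 7) * real n ^ (k - 1)"
    unfolding e by (simp add: distrib_right)
  also have "\<dots> \<le> h ^ 3 * real n ^ (k - 1)" using h_arith by (intro mult_right_mono) auto
  finally show ?thesis .
qed

lemma nonedges_Ag: "y \<in> Ag \<Longrightarrow> real (cnt XB (k - 1) (\<lambda>T. ne (insert y T))) \<le> h ^ 3 * real n ^ (k - 1)"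
proof -
  assume y: "y \<in> Ag"
  have h0: "0 \<le> h ^ 7" using h by simp
  have "real (cnt XB (k - 1) (\<lambda>T. ne (insert y T))) \<le> h ^ 4 * real n ^ (k - 1) + real (k - 1) * h ^ 7 * real n ^ (k - 1)"
    using cnt_XB_le[of "k - 1" "\<lambda>T. ne (insert y T)"] y by (simp add: Ag_def)
  also have "\<dots> \<le> h ^ 4 * real n ^ (k - 1) + real k * h ^ 7 * real n ^ (k - 1)"
    using h0 by (intro add_left_mono mult_right_mono) auto
  also have "\<dots> = (h ^ 4 + real k * h ^ 7) * real n ^ (k - 1)" by (simp add: distrib_right)
  also have "\<dots> \<le> h ^ 3 * real n ^ (k - 1)" using h_arith by (intro mult_right_mono) auto
  finally show ?thesis .
qed

lemma NK_total: "real (NK (k - 1) {}) \<le> h ^ 6 * real n ^ k"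
proof -
  have e: "k - 2 + 1 = k - 1" "k - 2 + 2 = k" using k3 by auto
  have "real (NK (k - 2 + 1) {}) \<le> real (wB (k - 2 + 2) {}) + real k * h ^ 7 * real n ^ (k - 2 + 2)"
    using k3 by (intro NK_le) auto
  then have "real (NK (k - 1) {}) \<le> (h ^ 11 + real k * h ^ 7) * real n ^ k"
    using sparse unfolding e by (simp add: distrib_right)
  also have "\<dots> \<le> h ^ 6 * real n ^ k" using h_arith by (intro mult_right_mono) auto
  finally show ?thesis .
qed

text \<open>\<open>NK p Z\<close> counts the non-edges that extend \<open>Z\<close> by one vertex of \<open>Ag\<close> and \<open>p\<close> vertices of \<open>XB\<close>. The
  \<open>l\<close>-sets at which the parts of the cycle are joined have to be good and to be in conflict with few
  of the vertices.\<close>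

definition good :: "'a set \<Rightarrow> bool" where
  "good L \<longleftrightarrow> L \<subseteq> XB \<and> card L = l \<and> real (NK (k - l - 1) L) \<le> h * real n ^ (k - l)"

text \<open>A vertex of \<open>Ag\<close> acts as the one vertex from \<open>Ag\<close> of a
  \<open>k\<close>-set, any other vertex as one of those from \<open>XB\<close>. In both cases
  \<open>k - l - 1\<close> vertices stay free, hence the common threshold.\<close>

definition conflict :: "'a \<Rightarrow> 'a set \<Rightarrow> bool" where
  "conflict x L \<longleftrightarrow> h * real n ^ (k - l - 1) <
    real (if x \<in> Ag then cnt XB (k - l - 1) (\<lambda>T. ne (insert x (L \<union> T))) else NK (k - l - 2) (insert x L))"

text \<open>Markov's inequality for the at most \<open>h ^ 6 * n ^ k\<close> non-edges, grouped by
  the first \<open>l\<close> of their vertices in \<open>XB\<close>; the threshold of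
  \<open>good\<close> takes one power of \<open>h\<close>.\<close>

lemma card_not_good: "real (card {us \<in> tup XB l. card (set us) = l \<and> \<not> good (set us)}) \<le> h ^ 5 * real n ^ l"
proof -
  let ?t = "h * real n ^ (k - l)"
  let ?f = "\<lambda>us. real (NK (k - l - 1) (set us))"
  have "{us \<in> tup XB l. card (set us) = l \<and> \<not> good (set us)} \<subseteq> {us \<in> tup XB l. ?t < ?f us}"
    by (auto simp: good_def tup_def)
  then have "card {us \<in> tup XB l. card (set us) = l \<and> \<not> good (set us)} \<le> card {us \<in> tup XB l. ?t < ?f us}"
    using sets by (intro card_mono) auto
  then have "real (card {us \<in> tup XB l. card (set us) = l \<and> \<not> good (set us)}) * ?t \<le> real (card {us \<in> tup XB l. ?t < ?f us}) * ?t"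
    using h by (intro mult_right_mono) auto
  also have "\<dots> \<le> sum ?f (tup XB l)" using sets by (intro markov_card) auto
  also have "\<dots> = real (NK (l + (k - l - 1)) {})" unfolding NK_split by simp
  also have "l + (k - l - 1) = k - 1" using l by simp
  also have "real (NK (k - 1) {}) \<le> h ^ 6 * real n ^ k" by (rule NK_total)
  also have "\<dots> = (h ^ 5 * real n ^ l) * ?t"
    using l by (simp add: power_add[symmetric] eval_nat_numeral mult_ac)
  finally show ?thesis using h n0 by simp
qed

lemma card_conflict:
  assumes x: "x \<in> V" shows "real (card {us \<in> tup XB l. (x \<in> Ag \<or> x \<in> XB) \<and> conflict x (set us)}) \<le> h ^ 2 * real n ^ l"
proof (cases "x \<in> Ag \<or> x \<in> XB")
  case True
  let ?t = "h * real n ^ (k - l - 1)"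
  let ?f = "\<lambda>us. real (if x \<in> Ag then cnt XB (k - l - 1) (\<lambda>T. ne (insert x (set us \<union> T))) else NK (k - l - 2) (insert x (set us)))"
  have "{us \<in> tup XB l. (x \<in> Ag \<or> x \<in> XB) \<and> conflict x (set us)} = {us \<in> tup XB l. ?t < ?f us}"
    using True by (simp add: conflict_def)
  then have "real (card {us \<in> tup XB l. (x \<in> Ag \<or> x \<in> XB) \<and> conflict x (set us)}) * ?t \<le> sum ?f (tup XB l)"
    using markov_card[of "tup XB l" ?f ?t] sets by simp
  also have "\<dots> \<le> h ^ 3 * real n ^ (k - 1)"
  proof (cases "x \<in> Ag")
    case True
    have "sum ?f (tup XB l) = real (cnt XB (l + (k - l - 1)) (\<lambda>T. ne (insert x T)))"
      unfolding cnt_split[OF sets(6)] using True by simp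
    also have "l + (k - l - 1) = k - 1" using l by simp
    finally show ?thesis using nonedges_Ag[OF True] by simp
  next
    case False
    have "sum ?f (tup XB l) = real (NK (l + (k - l - 2)) {x})"
      unfolding NK_split using False by simp
    also have "l + (k - l - 2) = k - 2" using l by simp
    finally show ?thesis using NK_vertex[of x] True False by simp
  qed
  also have "\<dots> = (h ^ 2 * real n ^ l) * ?t"
    using l by (simp add: power_add[symmetric] eval_nat_numeral mult_ac)
  finally show ?thesis using h n0 by simp
next
  case False
  then have "{us \<in> tup XB l. (x \<in> Ag \<or> x \<in> XB) \<and> conflict x (set us)} = {}" by auto
  then show ?thesis using h by (simp only: card.empty) simp
qed

text \<open>The charging argument with \<open>Z = L\<close>. So an \<open>l\<close>-set of
  \<open>B - XA\<close> can be an end of a path, unless it has so many edges into \<open>B\<close>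
  that it can be the middle of one.\<close>

lemma good_if_sparse:
  assumes L: "L \<subseteq> B - XA" "card L = l" "real (wB (k - l) L) \<le> h / 2 * real n ^ (k - l)"
  shows "good L"
proof -
  have e: "k - l - 2 + 1 = k - l - 1" "k - l - 2 + 2 = k - l" using l by auto
  have "real (NK (k - l - 2 + 1) L) \<le> real (wB (k - l - 2 + 2) L) + real k * h ^ 7 * real n ^ (k - l - 2 + 2)"
    using L BV l by (intro NK_le) auto
  then have "real (NK (k - l - 1) L) \<le> (h / 2 + real k * h ^ 7) * real n ^ (k - l)"
    unfolding e using L(3) by (simp add: distrib_right)
  also have "\<dots> \<le> h * real n ^ (k - l)"
  proof (intro mult_right_mono)
    have "real k * h ^ 7 = (h * real k) * h ^ 6" by (simp add: eval_nat_numeral)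
    also have "\<dots> \<le> 1 / 256 * h ^ 1" using h_small h_power_mono[of 1 6] h by (intro mult_mono) auto
    finally show "h / 2 + real k * h ^ 7 \<le> h" using h by simp
  qed auto
  finally show ?thesis using L BV by (auto simp: good_def XB_def)
qed

end

section \<open>Items\<close>

type_synonym 'a item = "('a set \<times> 'a set) list \<times> 'a set"

text \<open>The item \<open>(bs, z)\<close> stands for the path with blocks \<open>bs\<close> that ends in the \<open>l\<close>-set \<open>z\<close>, so it has
  \<open>length bs\<close> edges.\<close>

definition ivs :: "'a item \<Rightarrow> 'a set" where
  "ivs it = (\<Union>p\<in>set (fst it). fst p \<union> snd p) \<union> snd it"

definition lend :: "'a item \<Rightarrow> 'a set" where
  "lend it = (if fst it = [] then snd it else fst (hd (fst it)))"

context near_extremal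
begin

text \<open>The final \<open>l\<close>-set is appended with an empty second part, since
  \<open>link\<close> reads only the first part of its right argument. The equation for
  \<open>card (ivs it)\<close> forces all parts to be disjoint.\<close>

definition valid :: "'a item \<Rightarrow> bool" where
  "valid it \<longleftrightarrow> successively (link E) (fst it @ [(snd it, {})])
     \<and> (\<forall>p\<in>set (fst it). card (fst p) = l \<and> card (snd p) = k - 2 * l)
     \<and> card (ivs it) = length (fst it) * (k - l) + l \<and> ivs it \<subseteq> V
     \<and> good (lend it) \<and> good (snd it)"

definition contrib :: "'a item \<Rightarrow> int" where
  "contrib it = int (length (fst it)) - 2 * int (card (ivs it \<inter> XA))"

text \<open>Between consecutive items the cycle has a slot with two edges and one vertex of \<open>Ag\<close>. Hence the
  contributions of all items must add up to the number of edges of the cycle minus twice the size of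
  \<open>XA\<close>.\<close>

definition solvable :: "'a set \<Rightarrow> int \<Rightarrow> bool" where
  "solvable K c \<longleftrightarrow> (\<forall>W. finite W \<longrightarrow> real (card W) \<le> h ^ 5 * real n \<longrightarrow>
     (\<exists>it. valid it \<and> contrib it = c \<and> length (fst it) \<le> 2 \<and> ivs it \<inter> W \<subseteq> K \<and> K \<inter> XA \<subseteq> ivs it))"

section \<open>Tasks solved by a single item\<close>

definition badL :: "'a list set" where
  "badL = {us \<in> tup XB l. card (set us) = l \<and> \<not> good (set us)}"

lemma card_badL_window:
  assumes X: "X \<subseteq> V"
  shows "real (card {xs \<in> tup X (p + l + q). take l (drop p xs) \<in> badL}) \<le> h ^ 5 * real n ^ (p + l + q)"
proof -
  have finX: "finite X" using X finV finite_subset by auto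
  have finb: "finite badL" using sets by (simp add: badL_def)
  let ?S = "{xs \<in> tup X (p + l + q). take l (drop p xs) \<in> badL}"
  let ?f = "\<lambda>xs. (take p xs, take l (drop p xs), drop (p + l) xs)"
  have "inj_on ?f ?S"
  proof (rule inj_onI)
    fix xs ys :: "'a list" assume "?f xs = ?f ys"
    then have "take p xs @ take l (drop p xs) @ drop l (drop p xs) = take p ys @ take l (drop p ys) @ drop l (drop p ys)"
      by (simp add: add.commute)
    then show "xs = ys" by (simp only: append_take_drop_id)
  qed
  moreover have "?f ` ?S \<subseteq> tup X p \<times> badL \<times> tup X q"
    by (auto simp: tup_def dest: in_set_takeD in_set_dropD)
  ultimately have "card ?S \<le> card (tup X p \<times> badL \<times> tup X q)"
    using finX finb by (intro card_inj_on_le) auto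
  also have "\<dots> = card X ^ p * (card badL * card X ^ q)"
    using finX by (simp add: card_cartesian_product card_tup)
  finally have "real (card ?S) \<le> real (card X) ^ p * (real (card badL) * real (card X) ^ q)"
    unfolding of_nat_mult[symmetric] of_nat_power[symmetric] by (rule of_nat_mono)
  also have "\<dots> \<le> real n ^ p * ((h ^ 5 * real n ^ l) * real n ^ q)"
    using card_le_n[OF X] card_not_good h
    by (intro mult_mono power_mono) (auto simp: badL_def)
  also have "\<dots> = h ^ 5 * real n ^ (p + l + q)" by (simp add: power_add)
  finally show ?thesis .
qed

text \<open>Of the tuples that complete \<open>L\<close> to an edge, those that hit a forbidden
  vertex or begin with an \<open>l\<close>-set that is not good are fewer by a factor of order
  \<open>h * k\<close>.\<close>

lemma ext_core:
  assumes L: "L \<subseteq> V" "card L = l" and W: "finite W" "real (card W) \<le> 2 * h ^ 5 * real n"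
    and d: "h ^ 4 / 2 * real n ^ (k - l) \<le> real (wB (k - l) L)"
  shows "\<exists>es J. good es \<and> card J = k - 2 * l \<and> finite J \<and> es \<inter> J = {} \<and> (es \<union> J) \<inter> (W \<union> L) = {}
    \<and> es \<union> J \<subseteq> B - XA \<and> L \<union> es \<union> J \<in> E"
proof -
  define S where "S = {xs \<in> tup B (k - l). L \<union> set xs \<in> E}"
  define S1 where "S1 = {xs \<in> tup B (k - l). set xs \<inter> (W \<union> (B \<inter> XA)) \<noteq> {}}"
  define S2 where "S2 = {xs \<in> tup B (0 + l + (k - 2 * l)). take l (drop 0 xs) \<in> badL}"
  have kl: "0 + l + (k - 2 * l) = k - l" using l by simp
  have h0: "0 \<le> h ^ 5" "0 < h ^ 4" using h by simp_all
  have "h ^ 7 \<le> h ^ 5" by (rule h_power_mono) simp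
  then have "real (card (B \<inter> XA)) \<le> h ^ 5 * real n" using card_R mult_right_mono[of "h ^ 7" "h ^ 5" "real n"] by linarith
  then have "real (card (W \<union> (B \<inter> XA))) \<le> 3 * h ^ 5 * real n"
    using W(2) card_Un_le[of W "B \<inter> XA"] by linarith
  then have "real (card S1) \<le> real (k - l) * (3 * h ^ 5) * real n ^ (k - l)"
    unfolding S1_def using card_le_n[OF BV] finB W(1) by (intro card_tup_hit_le) auto
  also have "\<dots> \<le> real k * (3 * h ^ 5) * real n ^ (k - l)"
    using h0 by (intro mult_right_mono) auto
  finally have s1: "real (card S1) \<le> 3 * real k * h ^ 5 * real n ^ (k - l)" by simp
  have s2: "real (card S2) \<le> h ^ 5 * real n ^ (k - l)"
    using card_badL_window[OF BV, of 0 "k - 2 * l"] unfolding S2_def kl .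
  have "real (card (S1 \<union> S2)) \<le> real (card S1) + real (card S2)"
    using card_Un_le[of S1 S2] by linarith
  also have "\<dots> \<le> (3 * real k + 1) * h ^ 5 * real n ^ (k - l)" using s1 s2 by (simp add: algebra_simps)
  also have "\<dots> < h ^ 4 / 2 * real n ^ (k - l)"
  proof (rule mult_strict_right_mono)
    have "(3 * real k + 1) * h ^ 5 = (3 * (h * real k) + h) * h ^ 4" by (simp add: algebra_simps eval_nat_numeral)
    also have "\<dots> \<le> (4 / 256) * h ^ 4" using h_small h0 by (intro mult_right_mono) auto
    also have "\<dots> < h ^ 4 / 2" using h0 by simp
    finally show "(3 * real k + 1) * h ^ 5 < h ^ 4 / 2" .
    show "0 < real n ^ (k - l)" using n0 by simp
  qed
  also have "\<dots> \<le> real (card S)" using d by (simp add: wB_def cnt_def S_def)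
  finally have "card (S1 \<union> S2) < card S" by simp
  moreover have "finite (S1 \<union> S2)" using finB by (simp add: S1_def S2_def)
  ultimately obtain xs where xs: "xs \<in> S" "xs \<notin> S1 \<union> S2" by (metis card_mono leD subsetI)
  have e: "L \<union> set xs \<in> E" and len: "length xs = k - l" and B: "set xs \<subseteq> B" using xs by (auto simp: S_def tup_def)
  have finL: "finite L" using L finV finite_subset by auto
  have "card (L \<union> set xs) + card (L \<inter> set xs) = card L + card (set xs)"
    using card_Un_Int[OF finL, of "set xs"] by simp
  then have "card (set xs) = k - l" "card (L \<inter> set xs) = 0" using edge(2)[OF e] L l len card_length[of xs] by linarith+
  then have dist: "distinct xs" and dis: "L \<inter> set xs = {}" using len finL by (auto intro: card_distinct)
  have av: "set xs \<inter> (W \<union> (B \<inter> XA)) = {}" using xs by (auto simp: S1_def S_def)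
  define es where "es = set (take l xs)"
  define J where "J = set (drop l xs)"
  have ln: "length (take l xs) = l" "length (drop l xs) = k - 2 * l" using len l by auto
  have un: "es \<union> J = set xs" unfolding es_def J_def set_append[symmetric] append_take_drop_id ..
  have cards: "card es = l" "card J = k - 2 * l"
    unfolding es_def J_def using ln dist by (simp_all add: distinct_card)
  have XBs: "set xs \<subseteq> XB" using av B BV by (auto simp: XB_def)
  have "take l xs \<in> tup XB l" using ln XBs set_take_subset[of l xs] by (auto simp: tup_def)
  moreover have "take l xs \<notin> badL" using xs kl by (auto simp: S2_def S_def)
  ultimately have "good es" using cards by (auto simp: badL_def es_def)
  moreover have "es \<inter> J = {}" unfolding es_def J_def using dist by (rule set_take_disj_set_drop_if_distinct) simp
  moreover have "(es \<union> J) \<inter> (W \<union> L) = {}" "es \<union> J \<subseteq> B - XA" using av dis B unfolding un by auto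
  moreover have "L \<union> es \<union> J \<in> E" using e un by (simp add: Un_assoc)
  ultimately show ?thesis using cards by (intro exI[of _ es] exI[of _ J]) (simp add: J_def)
qed

lemma good_card: "good L \<Longrightarrow> card L = l" "good L \<Longrightarrow> L \<subseteq> V" "good L \<Longrightarrow> finite L" "good L \<Longrightarrow> L \<subseteq> XB"
  using sets finite_subset[of L XB] by (auto simp: good_def)

text \<open>\<open>L\<close> is the intersection of the two edges, so only the outer ends have to be
  good: a set unfit to be an end is hidden in the middle.\<close>

lemma core_item:
  assumes L: "L \<subseteq> V" "card L = l" and W: "finite W" "real (card W) \<le> h ^ 5 * real n"
    and d: "h ^ 4 / 2 * real n ^ (k - l) \<le> real (wB (k - l) L)"
  shows "\<exists>it. valid it \<and> length (fst it) = 2 \<and> L \<subseteq> ivs it \<and> ivs it \<inter> W \<subseteq> L \<and> ivs it - L \<subseteq> B - XA"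
proof -
  have h0: "0 \<le> h ^ 5 * real n" using h by simp
  obtain es J where 1: "good es" "card J = k - 2 * l" "finite J" "es \<inter> J = {}" "(es \<union> J) \<inter> (W \<union> L) = {}"
    "es \<union> J \<subseteq> B - XA" "L \<union> es \<union> J \<in> E"
    using ext_core[OF L W(1) _ d] W(2) h0 by auto
  have "real k \<le> h ^ 19 * real n" by (rule const_le, rule order_trans[OF _ k_power_le[of 1]]) (use k3 in auto)
  also have "\<dots> \<le> h ^ 5 * real n" by (intro mult_right_mono h_power_mono) auto
  finally have k5: "real k \<le> h ^ 5 * real n" .
  have "card (es \<union> J) \<le> k" using card_Un_le[of es J] good_card[OF 1(1)] 1(2) l by linarith
  then have "real (card (W \<union> (es \<union> J))) \<le> 2 * h ^ 5 * real n"
    using card_Un_le[of W "es \<union> J"] W(2) k5 by linarith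
  then obtain es' J' where 2: "good es'" "card J' = k - 2 * l" "finite J'" "es' \<inter> J' = {}"
    "(es' \<union> J') \<inter> (W \<union> (es \<union> J) \<union> L) = {}" "es' \<union> J' \<subseteq> B - XA" "L \<union> es' \<union> J' \<in> E"
    using ext_core[OF L _ _ d, of "W \<union> (es \<union> J)"] W(1) 1 good_card[OF 1(1)] by auto
  define it where "it = ([(es, J), (L, J')], es')"
  have iv: "ivs it = L \<union> (es \<union> J) \<union> (es' \<union> J')" by (auto simp: ivs_def it_def)
  have finL: "finite L" using L finV finite_subset by auto
  have c1: "card (es \<union> J) = k - l" using 1 good_card[OF 1(1)] l by (subst card_Un_disjoint) auto
  have c2: "card (es' \<union> J') = k - l" using 2 good_card[OF 2(1)] l by (subst card_Un_disjoint) auto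
  have c3: "card (L \<union> (es \<union> J)) = k" using c1 1 good_card[OF 1(1)] L finL l by (subst card_Un_disjoint) auto
  have "card (ivs it) = k + (k - l)"
    unfolding iv using c2 c3 2 1 finL good_card[OF 1(1)] good_card[OF 2(1)] by (subst card_Un_disjoint) auto
  also have "\<dots> = length (fst it) * (k - l) + l" using l by (simp add: it_def)
  finally have "card (ivs it) = length (fst it) * (k - l) + l" .
  moreover have "successively (link E) (fst it @ [(snd it, {})])"
    using 1(7) 2(7) by (simp add: it_def link_def Un_ac)
  moreover have "ivs it \<subseteq> V" unfolding iv using L 1(6) 2(6) BV by auto
  ultimately have "valid it" using 1 2 good_card[OF 1(1)] L by (auto simp: valid_def it_def lend_def)
  moreover have "ivs it \<inter> W \<subseteq> L" "ivs it - L \<subseteq> B - XA" "L \<subseteq> ivs it"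
    unfolding iv using 1(5,6) 2(5,6) by auto
  moreover have "length (fst it) = 2" by (simp add: it_def)
  ultimately show ?thesis by blast
qed

lemma dense_solvable:
  assumes L: "L \<subseteq> B - XA" "card L = l" and d: "\<not> real (wB (k - l) L) \<le> h / 2 * real n ^ (k - l)"
    and K: "L \<subseteq> K" "K \<inter> XA = {}"
  shows "solvable K 2"
  unfolding solvable_def
proof (intro allI impI)
  fix W :: "'a set" assume W: "finite W" "real (card W) \<le> h ^ 5 * real n"
  have "h ^ 4 / 2 * real n ^ (k - l) \<le> h / 2 * real n ^ (k - l)"
    using h_power_mono[of 1 4] by (intro mult_right_mono) auto
  then have "h ^ 4 / 2 * real n ^ (k - l) \<le> real (wB (k - l) L)" using d by linarith
  then obtain it where it: "valid it" "length (fst it) = 2" "L \<subseteq> ivs it" "ivs it \<inter> W \<subseteq> L" "ivs it - L \<subseteq> B - XA"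
    using core_item[OF _ L(2) W, of] L(1) BV by blast
  have "ivs it \<inter> XA = {}" using it(5) L(1) by auto
  then have "contrib it = 2" using it(2) by (simp add: contrib_def)
  then show "\<exists>it. valid it \<and> contrib it = 2 \<and> length (fst it) \<le> 2 \<and> ivs it \<inter> W \<subseteq> K \<and> K \<inter> XA \<subseteq> ivs it"
    using it K by (intro exI[of _ it]) auto
qed

text \<open>Averaging over \<open>(l - 1)\<close>-tuples of \<open>B\<close> gives an
  \<open>l\<close>-set through \<open>v\<close> with many edges into \<open>B\<close>. Its path has
  two edges and one vertex of \<open>XA\<close>, hence value 0.\<close>

lemma vertex_solvable:
  assumes v: "v \<in> XA"
  shows "solvable {v} 0"
  unfolding solvable_def
proof (intro allI impI)
  fix W :: "'a set" assume W: "finite W" "real (card W) \<le> h ^ 5 * real n"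
  have h0: "0 \<le> h ^ 5" "0 < h ^ 4" using h by simp_all
  define f where "f zs = real (wB (k - l) (insert v (set zs)))" for zs
  define U where "U = W \<union> (B \<inter> XA)"
  have "\<exists>zs\<in>tup B (l - 1). set zs \<inter> U = {} \<and> h ^ 4 / 2 * real n ^ (k - l) \<le> f zs"
  proof (rule ccontr)
    assume neg: "\<not> ?thesis"
    let ?T = "{zs \<in> tup B (l - 1). set zs \<inter> U \<noteq> {}}"
    have kk: "l - 1 + (k - l) = k - 1" using l by simp
    have fle: "f zs \<le> real n ^ (k - l)" for zs
    proof -
      have "wB (k - l) (insert v (set zs)) \<le> card B ^ (k - l)" unfolding wB_def by (rule cnt_le[OF finB])
      then have "f zs \<le> real (card B) ^ (k - l)" unfolding f_def of_nat_power[symmetric] by (rule of_nat_mono)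
      also have "\<dots> \<le> real n ^ (k - l)" using card_le_n[OF BV] by (intro power_mono) auto
      finally show ?thesis .
    qed
    have "h ^ 7 \<le> h ^ 5" by (rule h_power_mono) simp
    then have "real (card (B \<inter> XA)) \<le> h ^ 5 * real n" using card_R mult_right_mono[of "h ^ 7" "h ^ 5" "real n"] by linarith
    then have "real (card U) \<le> 2 * h ^ 5 * real n"
      using W(2) card_Un_le[of W "B \<inter> XA"] unfolding U_def by linarith
    then have "real (card ?T) \<le> real (l - 1) * (2 * h ^ 5) * real n ^ (l - 1)"
      using card_le_n[OF BV] finB W(1) by (intro card_tup_hit_le) (auto simp: U_def)
    also have "\<dots> \<le> real k * (2 * h ^ 5) * real n ^ (l - 1)"
      using h0 l by (intro mult_right_mono) auto
    finally have cT: "real (card ?T) \<le> real k * (2 * h ^ 5) * real n ^ (l - 1)" .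
    have "real (wB (k - 1) {v}) = (\<Sum>zs\<in>tup B (l - 1). f zs)"
      unfolding wB_def f_def kk[symmetric] cnt_split[OF finB] by simp
    also have "\<dots> \<le> (\<Sum>zs\<in>tup B (l - 1). (if zs \<in> ?T then real n ^ (k - l) else 0) + h ^ 4 / 2 * real n ^ (k - l))"
    proof (rule sum_mono)
      fix zs assume "zs \<in> tup B (l - 1)"
      then show "f zs \<le> (if zs \<in> ?T then real n ^ (k - l) else 0) + h ^ 4 / 2 * real n ^ (k - l)"
        using neg fle[of zs] h0 by (auto simp: add_increasing2)
    qed
    also have "\<dots> = real (card ?T) * real n ^ (k - l) + real (card B) ^ (l - 1) * (h ^ 4 / 2 * real n ^ (k - l))"
      using finB by (simp add: sum.distrib sum.If_cases card_tup Int_def)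
    also have "\<dots> \<le> (real k * (2 * h ^ 5) * real n ^ (l - 1)) * real n ^ (k - l) + real n ^ (l - 1) * (h ^ 4 / 2 * real n ^ (k - l))"
      using cT card_le_n[OF BV] h0 by (intro add_mono mult_right_mono power_mono) auto
    also have "\<dots> = (2 * real k * h ^ 5 + h ^ 4 / 2) * real n ^ (k - 1)"
      unfolding kk[symmetric] power_add by (simp add: algebra_simps)
    also have "\<dots> < h ^ 4 * real n ^ (k - 1)"
    proof (rule mult_strict_right_mono)
      have "2 * real k * h ^ 5 = 2 * (h * real k) * h ^ 4" by (simp add: eval_nat_numeral)
      also have "\<dots> \<le> 2 / 256 * h ^ 4" using h_small h0 by (intro mult_right_mono) auto
      finally show "2 * real k * h ^ 5 + h ^ 4 / 2 < h ^ 4" using h0 by linarith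
      show "0 < real n ^ (k - 1)" using n0 by simp
    qed
    finally show False using v by (simp add: XA_def)
  qed
  then obtain zs where zs: "zs \<in> tup B (l - 1)" "set zs \<inter> U = {}" "h ^ 4 / 2 * real n ^ (k - l) \<le> f zs" by auto
  define L where "L = insert v (set zs)"
  have LV: "L \<subseteq> V" using v sets zs BV by (auto simp: L_def tup_def)
  have d: "h ^ 4 / 2 * real n ^ (k - l) \<le> real (wB (k - l) L)" using zs by (simp add: f_def L_def)
  have "0 < h ^ 4 / 2 * real n ^ (k - l)" using h0 n0 by simp
  then have "wB (k - l) L \<noteq> 0" using d by linarith
  then obtain xs where xs: "xs \<in> tup B (k - l)" "L \<union> set xs \<in> E"
  proof -
    have "{xs \<in> tup B (k - l). L \<union> set xs \<in> E} \<noteq> {}"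
    proof
      assume "{xs \<in> tup B (k - l). L \<union> set xs \<in> E} = {}"
      then have "wB (k - l) L = 0" unfolding wB_def cnt_def by (simp only: card.empty)
      then show False using \<open>wB (k - l) L \<noteq> 0\<close> by simp
    qed
    then show ?thesis using that by blast
  qed
  \<comment> \<open>The tuple might repeat entries or contain \<open>v\<close>; an edge made of
    \<open>L\<close> and at most \<open>k - l\<close> further vertices rules this out.\<close>
  have "card L \<le> l" using zs l card_length[of zs] card_insert_le_m1[of l "set zs" v] by (auto simp: L_def tup_def)
  moreover have "k \<le> card L + (k - l)"
    using edge(2)[OF xs(2)] card_Un_le[of L "set xs"] card_length[of xs] xs(1) by (simp add: tup_def)
  ultimately have cL: "card L = l" using l by linarith
  obtain it where it: "valid it" "length (fst it) = 2" "L \<subseteq> ivs it" "ivs it \<inter> W \<subseteq> L" "ivs it - L \<subseteq> B - XA"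
    using core_item[OF LV cL W d] by blast
  have "ivs it \<inter> XA = {v}" using it(3,5) zs v by (auto simp: L_def U_def tup_def)
  moreover have "ivs it \<inter> W \<subseteq> {v}" using it(4) zs(2) by (auto simp: L_def U_def)
  ultimately show "\<exists>it. valid it \<and> contrib it = 0 \<and> length (fst it) \<le> 2 \<and> ivs it \<inter> W \<subseteq> {v} \<and> {v} \<inter> XA \<subseteq> ivs it"
    using it by (intro exI[of _ it]) (auto simp: contrib_def)
qed

lemma split_edge:
  assumes e: "e \<in> E" and x: "X \<subseteq> e" "card X = l"
  shows "\<exists>es J. es \<subseteq> e - X \<and> card es = l \<and> card J = k - 2 * l \<and> e = X \<union> es \<union> J \<and> es \<inter> J = {} \<and> X \<inter> J = {} \<and> finite e"
proof -
  have fin: "finite e" "card e = k" using edge[OF e] finV finite_subset by auto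
  have finX: "finite X" using x fin finite_subset by auto
  have c: "card (e - X) = k - l" using fin x finX by (simp add: card_Diff_subset)
  then have "l \<le> card (e - X)" using l by simp
  then obtain es where es: "es \<subseteq> e - X" "card es = l" by (meson obtain_subset_with_card_n)
  have "card (e - X - es) = k - 2 * l" using c es fin finite_subset[OF es(1)] by (simp add: card_Diff_subset)
  then show ?thesis using es x fin by (intro exI[of _ es] exI[of _ "e - X - es"]) auto
qed

text \<open>If all \<open>l\<close>-subsets of \<open>e\<close> are good, \<open>e\<close> itself is
  a path with one edge, which \<open>K = e\<close> exempts from avoiding \<open>W\<close>. Otherwise
  some \<open>l\<close>-subset is the middle of a path with two edges.\<close>

lemma edge_solvable:
  assumes e: "e \<in> E" "e \<subseteq> B - XA"
  shows "solvable e 1 \<or> solvable e 2"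
proof (cases "\<exists>L\<subseteq>e. card L = l \<and> \<not> real (wB (k - l) L) \<le> h / 2 * real n ^ (k - l)")
  case True
  then obtain L where "L \<subseteq> e" "card L = l" "\<not> real (wB (k - l) L) \<le> h / 2 * real n ^ (k - l)" by auto
  then show ?thesis using dense_solvable[of L e] e by blast
next
  case False
  then have g: "good L" if "L \<subseteq> e" "card L = l" for L using good_if_sparse[of L] that e by blast
  have "l \<le> card e" using edge[OF e(1)] l by simp
  then obtain X where X: "X \<subseteq> e" "card X = l" by (meson obtain_subset_with_card_n)
  obtain es J where s: "es \<subseteq> e - X" "card es = l" "card J = k - 2 * l" "e = X \<union> es \<union> J"
    using split_edge[OF e(1) X] by blast
  define it where "it = ([(X, J)], es)"
  have iv: "ivs it = e" using s by (auto simp: ivs_def it_def)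
  have "X \<union> J \<union> es \<in> E" using e(1) s(4) by (simp add: Un_ac)
  then have "successively (link E) (fst it @ [(snd it, {})])" by (simp add: it_def link_def)
  moreover have "card (ivs it) = length (fst it) * (k - l) + l" using edge[OF e(1)] l iv by (simp add: it_def)
  ultimately have "valid it" using iv edge[OF e(1)] X s g[OF X] g[of es] by (auto simp: valid_def it_def lend_def)
  moreover have "ivs it \<inter> XA = {}" using iv e(2) by auto
  then have "contrib it = 1" by (simp add: contrib_def it_def)
  ultimately have "solvable e 1" unfolding solvable_def using iv e(2) by (intro allI impI exI[of _ it]) (auto simp: it_def)
  then show ?thesis by simp
qed

text \<open>\<open>e \<inter> f\<close> becomes the middle of the path. If some
  \<open>l\<close>-subset of \<open>e \<union> f\<close> has many edges into \<open>B\<close>, a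
  path through that subset has the same value 2.\<close>

lemma two_edges_solvable:
  assumes e: "e \<in> E" "e \<subseteq> B - XA" and f: "f \<in> E" "f \<subseteq> B - XA" and ef: "card (e \<inter> f) = l"
  shows "solvable (e \<union> f) 2"
proof (cases "\<exists>L\<subseteq>e \<union> f. card L = l \<and> \<not> real (wB (k - l) L) \<le> h / 2 * real n ^ (k - l)")
  case True
  then obtain L where "L \<subseteq> e \<union> f" "card L = l" "\<not> real (wB (k - l) L) \<le> h / 2 * real n ^ (k - l)" by auto
  then show ?thesis using dense_solvable[of L "e \<union> f"] e f by blast
next
  case False
  then have g: "good L" if "L \<subseteq> e \<union> f" "card L = l" for L using good_if_sparse[of L] that e f by blast
  obtain es J where s: "es \<subseteq> e - e \<inter> f" "card es = l" "card J = k - 2 * l" "e = e \<inter> f \<union> es \<union> J" "finite e"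
    using split_edge[OF e(1) _ ef] by blast
  obtain es' J' where s': "es' \<subseteq> f - e \<inter> f" "card es' = l" "card J' = k - 2 * l" "f = e \<inter> f \<union> es' \<union> J'" "finite f"
    using split_edge[OF f(1) _ ef] by blast
  define it where "it = ([(es, J), (e \<inter> f, J')], es')"
  have iv: "ivs it = e \<union> f" using s(4) s'(4) by (auto simp: ivs_def it_def)
  have "es \<union> J \<union> e \<inter> f = e" "e \<inter> f \<union> J' \<union> es' = f" using s(4) s'(4) by blast+
  then have "successively (link E) (fst it @ [(snd it, {})])" using e f by (simp add: it_def link_def)
  moreover have "card (e \<union> f) + l = k + k" using card_Un_Int[OF s(5) s'(5)] edge(2)[OF e(1)] edge(2)[OF f(1)] ef by simp
  then have "card (ivs it) = length (fst it) * (k - l) + l" using l iv by (simp add: it_def)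
  moreover have "good es" "good es'" using g[of es] g[of es'] s s' by auto
  ultimately have "valid it" using iv edge[OF e(1)] edge[OF f(1)] s(2,3) s'(2,3) ef by (auto simp: valid_def it_def lend_def)
  moreover have "ivs it \<inter> XA = {}" using iv e(2) f(2) by auto
  then have "contrib it = 2" by (simp add: contrib_def it_def)
  ultimately show "solvable (e \<union> f) 2" unfolding solvable_def using iv e(2) f(2) by (intro allI impI exI[of _ it]) (auto simp: it_def)
qed

lemma card_XB_ge: "5 * n \<le> 8 * card XB"
proof -
  have "B \<subseteq> XB \<union> (B \<inter> XA)" using BV sets by auto
  then have "card B \<le> card (XB \<union> (B \<inter> XA))" using sets finB by (intro card_mono) auto
  also have "\<dots> \<le> card XB + card (B \<inter> XA)" by (rule card_Un_le)
  finally have "real (card B) \<le> real (card XB) + h ^ 7 * real n" using card_R by linarith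
  moreover have "h ^ 7 \<le> h" using h_power_mono[of 1 7] by simp
  then have "h ^ 7 * real n \<le> 1 / 256 * real n" using h_small by (intro mult_right_mono) auto
  ultimately show ?thesis using cardB_ge by linarith
qed

lemma half_power_3: "4 * h ^ 3 * real n ^ (k - 1) < (real n / 2) ^ (k - 1)"
proof -
  have "4 * 2 ^ (k - 1) \<le> (16 * real k) ^ 1 * (16 * real k) ^ (k - 1)"
    using k3 by (intro mult_mono power_mono) auto
  also have "\<dots> = (16 * real k) ^ (1 + (k - 1))" by (simp only: power_add)
  also have "\<dots> \<le> (16 * real k) ^ (4 * k)" using k3 by (intro k_power_le) simp
  finally have "4 * 2 ^ (k - 1) * h ^ Suc 2 \<le> h ^ 2" by (rule h_power_gap)
  also have "\<dots> \<le> h ^ 1" by (rule h_power_mono) simp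
  also have "\<dots> < 1" using h_small by simp
  finally have "4 * h ^ 3 * 2 ^ (k - 1) < 1" by (simp add: mult_ac)
  then have "4 * h ^ 3 * 2 ^ (k - 1) * (real n / 2) ^ (k - 1) < 1 * (real n / 2) ^ (k - 1)"
    using n0 by (intro mult_strict_right_mono) auto
  moreover have "2 ^ (k - 1) * (real n / 2) ^ (k - 1) = real n ^ (k - 1)"
    by (simp add: power_divide)
  ultimately show ?thesis by (simp only: mult.assoc mult_1)
qed

lemma card_Ag_ge: "real n \<le> 4 * real (k - l) * real (card Ag)" "real n \<le> 3 * real (k - l) * real (card A)"
proof -
  let ?d = "real (k - l)"
  have d: "?d \<le> real k" "0 \<le> ?d" by auto
  have "N \<le> 2 * card A + 2" using N by auto
  then have "n \<le> (2 * card A + 2) * (k - l)" unfolding N(1) by (rule mult_le_mono1)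
  then have "real n \<le> real ((2 * card A + 2) * (k - l))" by (rule of_nat_mono)
  then have "real n \<le> (2 * real (card A) + 2) * ?d" by (simp only: of_nat_mult of_nat_add of_nat_numeral)
  also have "\<dots> = 2 * (?d * real (card A)) + 2 * ?d" by (simp add: algebra_simps)
  finally have a: "real n \<le> 2 * (?d * real (card A)) + 2 * ?d" .
  have "2 * ?d \<le> real n / 50" using n_big d by linarith
  then show "real n \<le> 3 * ?d * real (card A)" using a unfolding mult.assoc by linarith
  have "A \<subseteq> Ag \<union> (A - Ag)" by auto
  then have "card A \<le> card (Ag \<union> (A - Ag))" using sets finA by (intro card_mono) auto
  also have "\<dots> \<le> card Ag + card (A - Ag)" by (rule card_Un_le)
  finally have "real (card A) \<le> real (card Ag) + h ^ 7 * real n" using card_A_minus_Ag by linarith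
  then have "?d * real (card A) \<le> ?d * (real (card Ag) + h ^ 7 * real n)" using d by (intro mult_left_mono) auto
  also have "\<dots> = ?d * real (card Ag) + ?d * h ^ 7 * real n" by (simp add: algebra_simps)
  also have "?d * h ^ 7 * real n \<le> (1 / 256) * real n"
  proof (rule mult_right_mono)
    have "?d * h ^ 7 \<le> real k * h ^ 1" using d h_power_mono[of 1 7] h by (intro mult_mono) auto
    then show "?d * h ^ 7 \<le> 1 / 256" using h_small by (simp add: mult.commute)
  qed auto
  finally show "real n \<le> 4 * ?d * real (card Ag)" using a \<open>2 * ?d \<le> real n / 50\<close> unfolding mult.assoc by linarith
qed

text \<open>A single edge uses up a vertex of \<open>Ag\<close> that would serve two edges in a
  slot, hence the value 1 - 2. That vertex goes into \<open>J\<close>, so both ends lie in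
  \<open>XB\<close>.\<close>

lemma minus_solvable: "solvable {} (- 1)"
  unfolding solvable_def
proof (intro allI impI)
  fix W :: "'a set" assume W: "finite W" "real (card W) \<le> h ^ 5 * real n"
  have h0: "0 < h ^ 3" "0 \<le> h ^ 5" using h by simp_all
  have h5: "h ^ 5 \<le> h ^ 1" "h ^ 5 \<le> h ^ 3" by (rule h_power_mono; simp)+
  have "\<not> Ag \<subseteq> W"
  proof
    assume "Ag \<subseteq> W"
    then have "real (card Ag) \<le> h ^ 5 * real n" using card_mono[OF W(1)] W(2) by (meson of_nat_mono order_trans)
    also have "\<dots> \<le> h * real n" using h5 by (intro mult_right_mono) auto
    finally have "4 * real (k - l) * real (card Ag) \<le> 4 * real k * (h * real n)" using l by (intro mult_mono) auto
    also have "\<dots> = 4 * (h * real k) * real n" by simp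
    also have "\<dots> \<le> 4 * (1 / 256) * real n" using h_small by (intro mult_right_mono mult_left_mono) auto
    finally show False using card_Ag_ge n0 by simp
  qed
  then obtain y where y: "y \<in> Ag" "y \<notin> W" by auto
  define S where "S = {xs \<in> tup XB (k - 1). distinct xs \<and> set xs \<inter> W = {}}"
  define S1 where "S1 = {xs \<in> tup XB (k - 1). ne (insert y (set xs))}"
  define S2 where "S2 = {xs \<in> tup XB (0 + l + (k - 1 - l)). take l (drop 0 xs) \<in> badL}"
  define S3 where "S3 = {xs \<in> tup XB (l + l + (k - 1 - 2 * l)). take l (drop l xs) \<in> badL}"
  have e: "0 + l + (k - 1 - l) = k - 1" "l + l + (k - 1 - 2 * l) = k - 1" using l by auto
  have s1: "real (card S1) \<le> h ^ 3 * real n ^ (k - 1)"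
    using nonedges_Ag[OF y(1)] by (simp add: S1_def cnt_def)
  have s2: "real (card S2) \<le> h ^ 5 * real n ^ (k - 1)"
    using card_badL_window[OF sets(2), of 0 "k - 1 - l"] unfolding S2_def e .
  have s3: "real (card S3) \<le> h ^ 5 * real n ^ (k - 1)"
    using card_badL_window[OF sets(2), of l "k - 1 - 2 * l"] unfolding S3_def e .
  have "16 * real (card W) \<le> 16 * (1 / 256) * real n"
    using W(2) mult_right_mono[OF order_trans[OF h5(1)], of "1 / 256" "real n"] h_small by simp
  then have "(real n / 2) ^ (k - 1) \<le> real (card S)"
    unfolding S_def using sets card_XB_ge W(1) by (intro fresh_count) auto
  moreover have "real (card (S1 \<union> S2 \<union> S3)) \<le> 3 * (h ^ 3 * real n ^ (k - 1))"
  proof -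
    have "card (S1 \<union> S2 \<union> S3) \<le> card S1 + card S2 + card S3"
      using card_Un_le[of "S1 \<union> S2" S3] card_Un_le[of S1 S2] by linarith
    moreover have "h ^ 5 * real n ^ (k - 1) \<le> h ^ 3 * real n ^ (k - 1)" using h5 by (intro mult_right_mono) auto
    ultimately show ?thesis using s1 s2 s3 by linarith
  qed
  moreover have "0 \<le> h ^ 3 * real n ^ (k - 1)" using h0 by simp
  moreover have "4 * (h ^ 3 * real n ^ (k - 1)) < (real n / 2) ^ (k - 1)" using half_power_3 by simp
  ultimately have "real (card (S1 \<union> S2 \<union> S3)) < real (card S)" by linarith
  then have "card (S1 \<union> S2 \<union> S3) < card S" by simp
  moreover have "finite (S1 \<union> S2 \<union> S3)" using sets by (simp add: S1_def S2_def S3_def)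
  ultimately obtain xs where xs: "xs \<in> S" "xs \<notin> S1 \<union> S2 \<union> S3" by (metis card_mono leD subsetI)
  have xs': "set xs \<subseteq> XB" "length xs = k - 1" "distinct xs" "set xs \<inter> W = {}" using xs by (auto simp: S_def tup_def)
  have yx: "y \<notin> set xs" "y \<in> XA" "y \<in> V" using y xs'(1) XB_Ag Ag_XA sets by auto
  have c: "card (insert y (set xs)) = k" using xs' yx k3 by (simp add: distinct_card)
  have E: "insert y (set xs) \<in> E"
    using xs c yx xs'(1) sets by (auto simp: S1_def S_def ne_def)
  define es where "es = set (take l xs)"
  define es' where "es' = set (take l (drop l xs))"
  define J where "J = insert y (set (drop (2 * l) xs))"
  have spl: "xs = take l xs @ take l (drop l xs) @ drop (2 * l) xs"
    by (metis append_take_drop_id drop_drop mult_2)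
  have un: "set xs = es \<union> es' \<union> set (drop (2 * l) xs)"
    unfolding es_def es'_def by (subst spl) auto
  have cs: "card es = l" "card es' = l" "card J = k - 2 * l"
  proof -
    show "card es = l" "card es' = l" unfolding es_def es'_def using xs' l by (simp_all add: distinct_card)
    have "y \<notin> set (drop (2 * l) xs)" using yx by (meson in_set_dropD)
    then show "card J = k - 2 * l" unfolding J_def using xs' l by (simp add: distinct_card)
  qed
  have "take l xs \<in> tup XB l" "take l (drop l xs) \<in> tup XB l"
    using xs' l by (auto simp: tup_def dest!: in_set_takeD in_set_dropD)
  moreover have "take l xs \<notin> badL" "take l (drop l xs) \<notin> badL"
    using xs unfolding S_def S2_def S3_def e by auto
  ultimately have g: "good es" "good es'" using cs by (auto simp: badL_def es_def es'_def)
  define it where "it = ([(es, J)], es')"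
  have iv: "ivs it = insert y (set xs)" using un by (auto simp: ivs_def it_def J_def)
  have "es \<union> J \<union> es' = insert y (set xs)" using un by (auto simp: J_def)
  then have "successively (link E) (fst it @ [(snd it, {})])" using E by (simp add: it_def link_def)
  then have "valid it" using iv c l g cs edge[OF E] by (auto simp: valid_def it_def lend_def)
  moreover have "ivs it \<inter> XA = {y}" using iv xs' yx sets by auto
  then have "contrib it = - 1" by (simp add: contrib_def it_def)
  moreover have "ivs it \<inter> W = {}" using iv xs' y by auto
  ultimately show "\<exists>it. valid it \<and> contrib it = - 1 \<and> length (fst it) \<le> 2 \<and> ivs it \<inter> W \<subseteq> {} \<and> {} \<inter> XA \<subseteq> ivs it"
    by (intro exI[of _ it]) (auto simp: it_def)
qed

end

lemma growth_bound_le: "growth_bound w j \<le> (w + 1) ^ (j + 1)"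
proof (induction j)
  case (Suc j)
  have "w + w * growth_bound w j \<le> (w + 1) ^ (j + 1) + w * (w + 1) ^ (j + 1)"
    using Suc.IH self_le_power[of "w + 1" "j + 1"] by (intro add_mono mult_le_mono2) auto
  then show ?case by (simp add: algebra_simps)
qed simp

context near_extremal
begin

section \<open>Special items with total contribution \<open>tau\<close>\<close>

lemma card_ivs: "valid it \<Longrightarrow> length (fst it) \<le> 2 \<Longrightarrow> finite (ivs it) \<and> card (ivs it) \<le> 2 * k"
proof
  assume v: "valid it" and len: "length (fst it) \<le> 2"
  show "finite (ivs it)" using v finV finite_subset by (auto simp: valid_def)
  have "card (ivs it) = length (fst it) * (k - l) + l" using v by (simp add: valid_def)
  also have "\<dots> \<le> 2 * (k - l) + l" using len by (intro add_right_mono mult_le_mono1)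
  also have "\<dots> \<le> 2 * k" using l by simp
  finally show "card (ivs it) \<le> 2 * k" .
qed

text \<open>\<open>solvable\<close> tolerates any \<open>h ^ 5 * n\<close> forbidden vertices, so
  the tasks are solved in turn, avoiding the earlier items and the sets of the other tasks, each of
  at most \<open>2 * k\<close> vertices.\<close>

lemma greedy_items:
  assumes K: "\<And>x. x \<in> set ts \<Longrightarrow> finite (fst x) \<and> card (fst x) \<le> 2 * k \<and> solvable (fst x) (snd x)"
    and dis: "sorted_wrt (\<lambda>x y. fst x \<inter> fst y = {}) ts"
    and len: "real (4 * k * length ts) \<le> h ^ 5 * real n"
  shows "q \<le> length ts \<Longrightarrow> \<exists>f. (\<forall>i<q. valid (f i) \<and> contrib (f i) = snd (ts ! i) \<and> length (fst (f i)) \<le> 2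
      \<and> fst (ts ! i) \<inter> XA \<subseteq> ivs (f i) \<and> ivs (f i) \<inter> (\<Union>x\<in>set ts. fst x) \<subseteq> fst (ts ! i))
     \<and> (\<forall>i<q. \<forall>j<i. ivs (f i) \<inter> ivs (f j) = {})"
proof (induction q)
  case 0 then show ?case by simp
next
  case (Suc q)
  then obtain f where f: "\<forall>i<q. valid (f i) \<and> contrib (f i) = snd (ts ! i) \<and> length (fst (f i)) \<le> 2
      \<and> fst (ts ! i) \<inter> XA \<subseteq> ivs (f i) \<and> ivs (f i) \<inter> (\<Union>x\<in>set ts. fst x) \<subseteq> fst (ts ! i)"
    and fd: "\<forall>i<q. \<forall>j<i. ivs (f i) \<inter> ivs (f j) = {}" by auto
  define U where "U = (\<Union>x\<in>set ts. fst x)"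
  define W where "W = (\<Union>i<q. ivs (f i)) \<union> (U - fst (ts ! q))"
  have ci: "finite (ivs (f i)) \<and> card (ivs (f i)) \<le> 2 * k" if "i < q" for i using card_ivs f that by auto
  have finU: "finite U" using K by (auto simp: U_def)
  have "card (\<Union>i<q. ivs (f i)) \<le> (\<Sum>i<q. card (ivs (f i)))" by (rule card_UN_le) simp
  also have "\<dots> \<le> (\<Sum>i<q. 2 * k)" using ci by (intro sum_mono) auto
  also have "\<dots> \<le> length ts * (2 * k)" using Suc.prems by simp
  finally have 1: "card (\<Union>i<q. ivs (f i)) \<le> length ts * (2 * k)" .
  have "card (U - fst (ts ! q)) \<le> card U" using finU by (intro card_mono) auto
  also have "\<dots> \<le> (\<Sum>x\<in>set ts. card (fst x))" unfolding U_def by (rule card_UN_le) simp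
  also have "\<dots> \<le> (\<Sum>x\<in>set ts. 2 * k)" using K by (intro sum_mono) auto
  also have "\<dots> \<le> length ts * (2 * k)" using card_length[of ts] by simp
  finally have "card (U - fst (ts ! q)) \<le> length ts * (2 * k)" .
  moreover have "4 * k * length ts = length ts * (2 * k) + length ts * (2 * k)" by simp
  ultimately have "card W \<le> 4 * k * length ts"
    using card_Un_le[of "\<Union>i<q. ivs (f i)" "U - fst (ts ! q)"] 1 unfolding W_def by linarith
  then have cW: "real (card W) \<le> h ^ 5 * real n" using len by (meson of_nat_mono order_trans)
  have finW: "finite W" using ci finU by (auto simp: W_def)
  have q: "q < length ts" "ts ! q \<in> set ts" using Suc.prems by auto
  obtain it where it: "valid it" "contrib it = snd (ts ! q)" "length (fst it) \<le> 2" "ivs it \<inter> W \<subseteq> fst (ts ! q)"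
    "fst (ts ! q) \<inter> XA \<subseteq> ivs it"
    using K[OF q(2)] finW cW unfolding solvable_def by blast
  have itU: "ivs it \<inter> U \<subseteq> fst (ts ! q)" using it(4) by (auto simp: W_def)
  have itf: "ivs it \<inter> ivs (f j) = {}" if j: "j < q" for j
  proof -
    have "ivs it \<inter> ivs (f j) \<subseteq> fst (ts ! q)" using it(4) j by (auto simp: W_def)
    moreover have "fst (ts ! q) \<inter> ivs (f j) \<subseteq> fst (ts ! j)" using f j q(2) by blast
    moreover have "fst (ts ! j) \<inter> fst (ts ! q) = {}" using dis j q(1) by (auto simp: sorted_wrt_iff_nth_less)
    ultimately show ?thesis by blast
  qed
  define f' where "f' = f(q := it)"
  have "\<forall>i<Suc q. valid (f' i) \<and> contrib (f' i) = snd (ts ! i) \<and> length (fst (f' i)) \<le> 2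
      \<and> fst (ts ! i) \<inter> XA \<subseteq> ivs (f' i) \<and> ivs (f' i) \<inter> (\<Union>x\<in>set ts. fst x) \<subseteq> fst (ts ! i)"
    using f it itU by (simp add: f'_def U_def less_Suc_eq)
  moreover have "\<forall>i<Suc q. \<forall>j<i. ivs (f' i) \<inter> ivs (f' j) = {}"
    using fd itf by (simp add: f'_def less_Suc_eq)
  ultimately show ?case by blast
qed

lemma edges_through:
  assumes S: "S \<subseteq> B" "card S = k - 2"
  shows "\<kappa> \<le> card {f \<in> {e \<in> E. e \<subseteq> B}. S \<subseteq> f}"
proof -
  let ?P = "{P. P \<subseteq> B - S \<and> card P = 2 \<and> S \<union> P \<in> E}"
  have "\<kappa> \<le> card ?P" using pairs[of S] S BV by (meson add_leD2 order_trans subset_trans)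
  also have "card ?P \<le> card {f \<in> {e \<in> E. e \<subseteq> B}. S \<subseteq> f}"
  proof (rule card_inj_on_le)
    show "inj_on (\<lambda>P. S \<union> P) ?P"
    proof (rule inj_onI)
      fix P P' assume "P \<in> ?P" "P' \<in> ?P" and eq: "S \<union> P = S \<union> P'"
      then have "P \<inter> S = {}" "P' \<inter> S = {}" by auto
      then show "P = P'" using eq by blast
    qed
    show "(\<lambda>P. S \<union> P) ` ?P \<subseteq> {f \<in> {e \<in> E. e \<subseteq> B}. S \<subseteq> f}" using S by auto
    show "finite {f \<in> {e \<in> E. e \<subseteq> B}. S \<subseteq> f}" using finE by simp
  qed
  finally show ?thesis .
qed

lemma two_B_edges:
  assumes "2 \<le> \<kappa> \<or> l \<noteq> 1"
  shows "\<exists>e\<in>E. \<exists>f\<in>E. e \<subseteq> B \<and> f \<subseteq> B \<and> (card (e \<inter> f) = 0 \<or> card (e \<inter> f) = l)"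
proof -
  define w2 where "w2 = growth_bound (4 * k) 2 + 4 * k"
  have "(4 * k + 1) ^ 3 \<le> (5 * k) ^ 3" using k3 by (intro power_mono) auto
  then have "w2 + 1 \<le> (5 * k) ^ 3 + 4 * k + 1"
    using growth_bound_le[of "4 * k" 2] unfolding w2_def by (simp del: growth_bound.simps)
  also have "4 * k + 1 \<le> (5 * k) ^ 3" using self_le_power[of "5 * k" 3] k3 by linarith
  then have "(5 * k) ^ 3 + 4 * k + 1 \<le> (16 * k) ^ 3" by (simp add: power_mult_distrib)
  finally have "growth_bound w2 k \<le> ((16 * k) ^ 3) ^ (k + 1)"
    using growth_bound_le[of w2 k] power_mono[of "w2 + 1" "(16 * k) ^ 3" "k + 1"] by linarith
  also have "\<dots> = (16 * k) ^ (3 * k + 3)" unfolding power_mult[symmetric] by (rule arg_cong[where f = "power (16 * k)"]) simp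
  \<comment> \<open>\<open>3 * k + 3 <= 4 * k\<close> as \<open>3 <= k\<close>; this is the largest
    constant that the exponent in the bound on \<open>h\<close> has to cover.\<close>
  also have "\<dots> \<le> (16 * k) ^ (4 * k)" using k3 by (intro power_increasing) auto
  finally have "real (growth_bound w2 k) \<le> real ((16 * k) ^ (4 * k))" by (rule of_nat_mono)
  then have "real (growth_bound w2 k) \<le> (16 * real k) ^ (4 * k)" by simp
  then have "real (growth_bound w2 k) \<le> h ^ 19 * real n" by (rule const_le)
  also have "\<dots> \<le> h ^ 1 * real n" by (intro mult_right_mono h_power_mono) auto
  also have "\<dots> \<le> 1 / 256 * real n" using h_small by (intro mult_right_mono) auto
  finally have "real (growth_bound w2 k) \<le> real n / 256" by simp
  then have big: "growth_bound w2 k + 10 * k \<le> card B" using n_big cardB_ge by linarith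
  have "\<exists>e\<in>{e \<in> E. e \<subseteq> B}. \<exists>f\<in>{e \<in> E. e \<subseteq> B}. card (e \<inter> f) = 0 \<or> card (e \<inter> f) = l"
  proof (rule two_edges[OF l finB _ _ _ big[unfolded w2_def]])
    show "f \<subseteq> B \<and> card f = k" if "f \<in> {e \<in> E. e \<subseteq> B}" for f using that edge by auto
    show "\<exists>f\<in>{e \<in> E. e \<subseteq> B}. S \<subseteq> f" if S: "S \<subseteq> B" "card S = k - 2" for S
    proof (rule ccontr)
      assume "\<not> ?thesis"
      then have "{f \<in> {e \<in> E. e \<subseteq> B}. S \<subseteq> f} = {}" by auto
      then show False using edges_through[OF S] kappa(1) by (simp only: card.empty)
    qed
    show "\<exists>f\<in>{e \<in> E. e \<subseteq> B}. \<exists>g\<in>{e \<in> E. e \<subseteq> B}. S \<subseteq> f \<and> S \<subseteq> g \<and> f \<noteq> g"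
      if "l = 1" and S: "S \<subseteq> B" "card S = k - 2" for S
    proof (rule ccontr)
      assume neg: "\<not> ?thesis"
      have "card {f \<in> {e \<in> E. e \<subseteq> B}. S \<subseteq> f} \<le> 1"
        unfolding One_nat_def using finE neg by (subst card_le_Suc0_iff_eq) auto
      then show False using edges_through[OF S] assms \<open>l = 1\<close> by simp
    qed
  qed
  then show ?thesis by auto
qed

text \<open>The number of edges left to make up when every vertex of \<open>XA\<close> serves two; a
  negative value means a surplus of such vertices.\<close>

definition tau :: int where "tau = int N - 2 * int (card XA)"

lemma card_XA: "card XA + card (A - XA) = card A + card (B \<inter> XA)"
proof -
  have "XA = (A \<inter> XA) \<union> (B \<inter> XA)" using sets AB by auto
  then have "card XA = card (A \<inter> XA) + card (B \<inter> XA)"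
    using card_Un_disjoint[of "A \<inter> XA" "B \<inter> XA"] finA finB AB by auto
  moreover have "card A = card (A \<inter> XA) + card (A - XA)"
    using card_Un_disjoint[of "A \<inter> XA" "A - XA"] finA by (auto simp: Int_Diff_Un)
  ultimately show ?thesis by simp
qed

text \<open>Each vertex of \<open>A - XA\<close> lies in almost no edge with \<open>k - 1\<close> vertices of \<open>B\<close>, so the charging
  argument yields many edges in \<open>B\<close>. They cannot be covered by few vertices of \<open>B\<close>, as these
  have small degree in \<open>B\<close>.\<close>

lemma disjoint_B_edges:
  assumes R: "B \<inter> XA = {}"
  shows "j \<le> 4 * card (A - XA) \<Longrightarrow> \<exists>es. length es = j \<and> (\<forall>e\<in>set es. e \<in> E \<and> e \<subseteq> B) \<and> sorted_wrt (\<lambda>e f. e \<inter> f = {}) es"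
proof (induction j)
  case 0 then show ?case by auto
next
  case (Suc j)
  then obtain es where es: "length es = j" "\<forall>e\<in>set es. e \<in> E \<and> e \<subseteq> B" "sorted_wrt (\<lambda>e f. e \<inter> f = {}) es" by auto
  let ?Q = "A - XA"
  let ?x = "h ^ 4 * real n ^ (k - 1)"
  define U where "U = \<Union> (set es)"
  have UB: "U \<subseteq> B" using es by (auto simp: U_def)
  then have finU: "finite U" using finB finite_subset by auto
  have "card U \<le> (\<Sum>e\<in>set es. card e)" unfolding U_def using card_UN_le[of "set es" id] by simp
  also have "\<dots> = (\<Sum>e\<in>set es. k)" using es edge by (intro sum.cong) auto
  also have "\<dots> \<le> j * k" using card_length[of es] es(1) by simp
  also have "\<dots> \<le> 4 * card ?Q * k" using Suc.prems by (intro mult_le_mono1) simp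
  finally have cU: "card U \<le> 4 * card ?Q * k" .
  have x0: "0 < ?x" using h n0 by simp
  have Q0: "0 < card ?Q" using Suc.prems by simp
  have "\<exists>e\<in>E. e \<subseteq> B \<and> e \<inter> U = {}"
  proof (rule ccontr)
    assume neg: "\<not> ?thesis"
    let ?D = "\<lambda>u. {e \<in> E. {u} \<subseteq> e \<and> e - {u} \<subseteq> B}"
    have "{e \<in> E. {} \<subseteq> e \<and> e - {} \<subseteq> B} \<subseteq> (\<Union>u\<in>U. ?D u)"
    proof
      fix e assume "e \<in> {e \<in> E. {} \<subseteq> e \<and> e - {} \<subseteq> B}"
      then have e: "e \<in> E" "e \<subseteq> B" by auto
      then obtain u where "u \<in> e" "u \<in> U" using neg by blast
      then show "e \<in> (\<Union>u\<in>U. ?D u)" using e by (intro UN_I[of u]) auto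
    qed
    then have "card {e \<in> E. {} \<subseteq> e \<and> e - {} \<subseteq> B} \<le> card (\<Union>u\<in>U. ?D u)"
      using finU finE by (intro card_mono) auto
    also have "\<dots> \<le> (\<Sum>u\<in>U. card (?D u))" by (rule card_UN_le[OF finU])
    finally have "fact k * card {e \<in> E. {} \<subseteq> e \<and> e - {} \<subseteq> B} \<le> fact k * (\<Sum>u\<in>U. card (?D u))" by (rule mult_le_mono2)
    also have "\<dots> = k * (\<Sum>u\<in>U. fact (k - 1) * card (?D u))"
      using k3 by (simp add: fact_reduce[of k] sum_distrib_left mult.assoc)
    also have "(\<Sum>u\<in>U. fact (k - 1) * card (?D u)) = (\<Sum>u\<in>U. wB (k - 1) {u})"
      using wB_eq UB BV k3 by (intro sum.cong) auto
    finally have "wB k {} \<le> k * (\<Sum>u\<in>U. wB (k - 1) {u})" using wB_eq[of "{}" k] by simp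
    then have "real (wB k {}) \<le> real (k * (\<Sum>u\<in>U. wB (k - 1) {u}))" by (rule of_nat_mono)
    also have "\<dots> = real k * (\<Sum>u\<in>U. real (wB (k - 1) {u}))" by simp
    also have "\<dots> \<le> real k * (\<Sum>u\<in>U. ?x)"
    proof (intro mult_left_mono sum_mono)
      fix u assume "u \<in> U"
      then have "u \<in> V" "u \<notin> XA" using UB BV R by auto
      then show "real (wB (k - 1) {u}) \<le> ?x" by (simp add: XA_def)
    qed simp
    also have "\<dots> = real k * real (card U) * ?x" by simp
    also have "\<dots> \<le> real k * real (4 * card ?Q * k) * ?x"
      using of_nat_mono[OF cU, where 'a = real] x0 by (intro mult_right_mono mult_left_mono) auto
    also have "\<dots> = real (card ?Q) * (4 * real k ^ 2 * ?x)" by (simp add: power2_eq_square)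
    finally have up: "real (wB k {}) \<le> real (card ?Q) * (4 * real k ^ 2 * ?x)" .
    have "(\<Sum>y\<in>A. cnt B (k - 2 + 1) (\<lambda>T. ne (insert y ({} \<union> T)))) \<le> wB (k - 2 + 2) {}"
      using k3 by (intro nonedges_le_edges) auto
    moreover have "k - 2 + 1 = k - 1" "k - 2 + 2 = k" using k3 by auto
    ultimately have "(\<Sum>y\<in>A. cnt B (k - 1) (\<lambda>T. ne (insert y T))) \<le> wB k {}" by simp
    then have lo: "(\<Sum>y\<in>A. real (cnt B (k - 1) (\<lambda>T. ne (insert y T)))) \<le> real (wB k {})"
      unfolding of_nat_sum[symmetric] by (rule of_nat_mono)
    \<comment> \<open>Every vertex of \<open>A - XA\<close> has at least
      \<open>(8 * real k ^ 2 - 1) * ?x\<close> non-edges, all charged to edges in \<open>B\<close>.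
      But if every edge in \<open>B\<close> meets \<open>U\<close>, there are at most
      \<open>4 * real k ^ 2 * ?x\<close> edge tuples for each such vertex.\<close>
    have "real (card ?Q) * ((8 * real k ^ 2 - 1) * ?x) = (\<Sum>y\<in>?Q. (8 * real k ^ 2 - 1) * ?x)" by simp
    also have "\<dots> \<le> (\<Sum>y\<in>?Q. real (cnt B (k - 1) (\<lambda>T. ne (insert y T))))"
    proof (rule sum_mono)
      fix y assume y: "y \<in> ?Q"
      then have "real (wB (k - 1) {y}) \<le> ?x" using AV by (auto simp: XA_def)
      moreover have "8 * real k ^ 2 * ?x \<le> (real n / 2) ^ (k - 1)" using half_power' by (simp only: mult.assoc)
      ultimately show "(8 * real k ^ 2 - 1) * ?x \<le> real (cnt B (k - 1) (\<lambda>T. ne (insert y T)))"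
        using edges_plus_nonedges[of y] y by (simp only: left_diff_distrib) auto
    qed
    also have "\<dots> \<le> (\<Sum>y\<in>A. real (cnt B (k - 1) (\<lambda>T. ne (insert y T))))" using finA by (intro sum_mono2) auto
    finally have "real (card ?Q) * ((8 * real k ^ 2 - 1) * ?x) \<le> real (card ?Q) * (4 * real k ^ 2 * ?x)" using lo up by linarith
    then have "(8 * real k ^ 2 - 1) * ?x \<le> 4 * real k ^ 2 * ?x" using Q0 by (simp add: mult_le_cancel_left)
    then have "8 * real k ^ 2 - 1 \<le> 4 * real k ^ 2" using x0 by (rule mult_right_le_imp_le)
    moreover have "3 ^ 2 \<le> real k ^ 2" using k3 by (intro power_mono) auto
    ultimately show False by simp
  qed
  then obtain e where "e \<in> E" "e \<subseteq> B" "e \<inter> U = {}" by auto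
  then show ?case using es by (intro exI[of _ "e # es"]) (auto simp: U_def)
qed

text \<open>Whether an edge yields value 1 or 2 cannot be prescribed, so the sum may overshoot and
  only a lower bound is claimed.\<close>

lemma positive_tasks:
  "\<exists>ts. (\<forall>x\<in>set ts. fst x \<subseteq> XB \<and> card (fst x) \<le> 2 * k \<and> solvable (fst x) (snd x) \<and> 1 \<le> snd x \<and> snd x \<le> 2)
    \<and> sorted_wrt (\<lambda>x y. fst x \<inter> fst y = {}) ts \<and> tau \<le> sum_list (map snd ts)
    \<and> length ts \<le> 4 * card (A - XA) + 2 \<and> (tau \<le> 0 \<longrightarrow> ts = [])"
proof (cases "tau \<le> 0")
  case True
  then show ?thesis by (intro exI[of _ "[]"]) simp
next
  case False
  \<comment> \<open>Otherwise \<open>A - XA\<close> is empty and \<open>XA\<close> is larger than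
    \<open>A\<close>, so it can serve all \<open>N\<close> edges and
    \<open>tau <= 0\<close>.\<close>
  have R: "B \<inter> XA = {}"
  proof (rule ccontr)
    assume ne: "B \<inter> XA \<noteq> {}"
    then have "card (A - XA) = 0" using Q_or_R_empty by (metis card.empty)
    moreover have "0 < card (B \<inter> XA)" using ne finB by (simp add: card_gt_0_iff)
    ultimately have "card A + 1 \<le> card XA" using card_XA by simp
    then show False using False N(2) by (auto simp: tau_def)
  qed
  then have BX: "B \<subseteq> XB" "B - XA = B" using BV by (auto simp: XB_def)
  have cx: "card XA + card (A - XA) = card A" using card_XA R by simp
  define c where "c e = (if solvable e 1 then 1 else 2::int)" for e
  have es: "solvable e (c e)" "1 \<le> c e" "c e \<le> 2" "fst (e, c e) \<subseteq> XB" "card (fst (e, c e)) \<le> 2 * k" if "e \<in> E" "e \<subseteq> B" for e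
    using edge_solvable[of e] that BX edge(2)[of e] by (auto simp: c_def)
  show ?thesis
  proof (cases "A - XA = {}")
    case False
    then have Q0: "1 \<le> card (A - XA)" using finA by (simp add: Suc_leI card_gt_0_iff)
    \<comment> \<open>\<open>tau <= 2 * card (A - XA) + 2\<close>, and the set is nonempty.\<close>
    have tt: "nat tau \<le> 4 * card (A - XA)" using cx N(2) Q0 by (auto simp: tau_def)
    then obtain L where L: "length L = nat tau" "\<forall>e\<in>set L. e \<in> E \<and> e \<subseteq> B" "sorted_wrt (\<lambda>e f. e \<inter> f = {}) L"
      using disjoint_B_edges[OF R] by blast
    define ts where "ts = map (\<lambda>e. (e, c e)) L"
    have "int (length L) \<le> sum_list (map c L)" using L(2) es(2)
    proof (induction L)
      case (Cons a L) then show ?case by force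
    qed simp
    then have "tau \<le> sum_list (map snd ts)" using L(1) \<open>\<not> tau \<le> 0\<close> by (simp add: ts_def o_def)
    moreover have "sorted_wrt (\<lambda>x y. fst x \<inter> fst y = {}) ts" using L(3) by (simp add: ts_def sorted_wrt_map)
    moreover have "length ts \<le> 4 * card (A - XA) + 2" using tt L(1) by (simp add: ts_def)
    ultimately show ?thesis using L(2) es \<open>\<not> tau \<le> 0\<close> by (intro exI[of _ ts]) (auto simp: ts_def)
  next
    case True
    then have "card (A - XA) = 0" by (metis card.empty)
    then have "card XA = card A" using cx by simp
    then have "tau = int N - 2 * int (card A)" by (simp add: tau_def)
    then consider "tau = 1" | "tau = 2" "N = 2 * card A + 2" using N(2) by linarith
    then show ?thesis
    proof cases
      case 1
      have "k - 2 \<le> card B" using cardB_ge n_big by linarith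
      then obtain S where "S \<subseteq> B" "card S = k - 2" by (meson obtain_subset_with_card_n)
      then have "card {f \<in> {e \<in> E. e \<subseteq> B}. S \<subseteq> f} \<noteq> 0" using edges_through[of S] kappa(1) by linarith
      then have "{f \<in> {e \<in> E. e \<subseteq> B}. S \<subseteq> f} \<noteq> {}" by (metis card.empty)
      then obtain e where e: "e \<in> E" "e \<subseteq> B" by auto
      show ?thesis using es[OF e] 1 by (intro exI[of _ "[(e, c e)]"]) auto
    next
      case 2
      \<comment> \<open>Two edges in \<open>B\<close> are usable as two tasks if they are disjoint,
        and as one path if they share \<open>l\<close> vertices.\<close>
      have "2 \<le> \<kappa> \<or> l \<noteq> 1" using kappa(2) 2(2) by auto
      then obtain e f where ef: "e \<in> E" "f \<in> E" "e \<subseteq> B" "f \<subseteq> B" "card (e \<inter> f) = 0 \<or> card (e \<inter> f) = l"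
        using two_B_edges by blast
      show ?thesis
      proof (cases "card (e \<inter> f) = l")
        case True
        have "solvable (e \<union> f) 2" using two_edges_solvable[of e f] ef True BX by auto
        moreover have "card (e \<union> f) \<le> 2 * k" using card_Un_le[of e f] edge(2) ef by auto
        ultimately show ?thesis using ef BX 2 by (intro exI[of _ "[(e \<union> f, 2)]"]) auto
      next
        case False
        then have "e \<inter> f = {}" using ef edge(1)[OF ef(1)] finV by (metis card_eq_0_iff finite_Int finite_subset)
        then show ?thesis using es[OF ef(1,3)] es[OF ef(2,4)] 2 by (intro exI[of _ "[(e, c e), (f, c f)]"]) auto
      qed
    qed
  qed
qed

lemma special_items:
  "\<exists>p f. (\<forall>i<p. valid (f i) \<and> length (fst (f i)) \<le> 2) \<and> (\<forall>i<p. \<forall>j<i. ivs (f i) \<inter> ivs (f j) = {})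
    \<and> XA - Ag \<subseteq> (\<Union>i<p. ivs (f i)) \<and> (\<Sum>i<p. contrib (f i)) = tau \<and> real p \<le> h ^ 6 * real n"
proof -
  obtain ts where ts: "\<forall>x\<in>set ts. fst x \<subseteq> XB \<and> card (fst x) \<le> 2 * k \<and> solvable (fst x) (snd x) \<and> 1 \<le> snd x \<and> snd x \<le> 2"
    "sorted_wrt (\<lambda>x y. fst x \<inter> fst y = {}) ts" "tau \<le> sum_list (map snd ts)"
    "length ts \<le> 4 * card (A - XA) + 2" "tau \<le> 0 \<longrightarrow> ts = []" using positive_tasks by blast
  obtain vs where vs: "set vs = XA - Ag" "distinct vs" using finite_distinct_list[of "XA - Ag"] sets by auto
  define q where "q = nat (sum_list (map snd ts) - tau)"
  \<comment> \<open>The tasks \<open>ts\<close> reach at least \<open>tau\<close>, each vertex of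
    \<open>XA - Ag\<close> gets a task of value 0, and \<open>q\<close> tasks of value -1 bring the
    sum down to \<open>tau\<close>.\<close>
  define us where "us = ts @ map (\<lambda>v. ({v}, 0)) vs @ replicate q ({}, - 1)"
  define p where "p = length us"
  have us: "finite (fst x) \<and> card (fst x) \<le> 2 * k \<and> solvable (fst x) (snd x)" if xus: "x \<in> set us" for x
  proof -
    consider "x \<in> set ts" | v where "v \<in> XA" "x = ({v}, 0)" | "x = ({}, - 1)" using xus vs(1) unfolding us_def by (auto simp: set_replicate_conv_if split: if_splits)
    then show ?thesis
    proof cases
      case 1 then show ?thesis using ts(1) sets finite_subset[of "fst x" XB] by auto
    next
      case 2 then show ?thesis using vertex_solvable k3 by auto
    next
      case 3 then show ?thesis using minus_solvable by auto
    qed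
  qed
  have dis: "sorted_wrt (\<lambda>x y. fst x \<inter> fst y = {}) us"
  proof -
    have "sorted_wrt (\<lambda>x y. fst x \<inter> fst y = {}) (replicate q ({}, - 1 :: int))" by (simp add: sorted_wrt_iff_nth_less)
    moreover have "sorted_wrt (\<lambda>x y. fst x \<inter> fst y = {}) (map (\<lambda>v. ({v}, 0 :: int)) vs)"
      using vs(2) by (auto simp: sorted_wrt_iff_nth_less nth_eq_iff_index_eq)
    ultimately show ?thesis using ts(1,2) vs(1) sets(8) unfolding us_def sorted_wrt_append by fastforce
  qed
  have sum: "sum_list (map snd us) = tau"
    using ts(3) by (simp add: us_def q_def sum_list_replicate o_def)
  have s2: "sum_list (map snd ts) \<le> 2 * int (length ts)" using ts(1)
  proof (induction ts)
    case (Cons a ts) then show ?case by force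
  qed simp
  have qle: "real q \<le> 2 * real (length ts) + 2 * real (card (B \<inter> XA))"
  proof (cases "tau \<le> 0")
    case True
    then have "int q = - tau" using ts(5) by (simp add: q_def)
    also have "\<dots> \<le> 2 * int (card (B \<inter> XA))" using card_XA N(2) by (auto simp: tau_def)
    finally show ?thesis by linarith
  next
    case False
    then have "int q \<le> 2 * int (length ts)" using s2 by (simp add: q_def)
    then show ?thesis by linarith
  qed
  have "XA - Ag \<subseteq> (A - Ag) \<union> (B \<inter> XA)" using AB sets by auto
  then have "card (XA - Ag) \<le> card ((A - Ag) \<union> (B \<inter> XA))" using finA finB by (intro card_mono) auto
  also have "\<dots> \<le> card (A - Ag) + card (B \<inter> XA)" by (rule card_Un_le)
  finally have "card (XA - Ag) \<le> card (A - Ag) + card (B \<inter> XA)" .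
  then have cv: "real (length vs) \<le> 2 * (h ^ 7 * real n)" using card_A_minus_Ag card_R vs distinct_card[of vs] by simp
  have lt: "real (length ts) \<le> 4 * (h ^ 7 * real n) + 2" using ts(4) card_Q by linarith
  have "(6::real) \<le> h ^ 19 * real n" by (rule const_le, rule order_trans[OF _ k_power_le[of 1]]) (use k3 in auto)
  also have "\<dots> \<le> h ^ 7 * real n" by (intro mult_right_mono h_power_mono) auto
  \<comment> \<open>With \<open>x = h ^ 7 * n\<close>: \<open>length ts <= 4 * x + 2\<close>,
    \<open>length vs <= 2 * x\<close> and \<open>q <= 2 * length ts + 2 * x\<close> give
    \<open>p <= 16 * x + 6\<close>, and \<open>6 <= x\<close>.\<close>
  finally have "real p \<le> 17 * (h ^ 7 * real n)"
    using lt cv qle card_R by (simp add: p_def us_def)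
  also have "\<dots> = 17 * h * (h ^ 6 * real n)" by (simp add: eval_nat_numeral)
  also have "\<dots> \<le> 1 * (h ^ 6 * real n)" using h_small h by (intro mult_right_mono) auto
  finally have p6: "real p \<le> h ^ 6 * real n" by simp
  have "real (4 * k * length us) = 4 * real k * real p" by (simp add: p_def)
  also have "\<dots> \<le> 4 * real k * (h ^ 6 * real n)" using p6 by (intro mult_left_mono) auto
  also have "\<dots> = 4 * (h * real k) * (h ^ 5 * real n)" by (simp add: eval_nat_numeral)
  also have "\<dots> \<le> 1 * (h ^ 5 * real n)" using h_small h by (intro mult_right_mono) auto
  finally have len: "real (4 * k * length us) \<le> h ^ 5 * real n" by simp
  obtain f where f: "\<forall>i<p. valid (f i) \<and> contrib (f i) = snd (us ! i) \<and> length (fst (f i)) \<le> 2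
      \<and> fst (us ! i) \<inter> XA \<subseteq> ivs (f i) \<and> ivs (f i) \<inter> (\<Union>x\<in>set us. fst x) \<subseteq> fst (us ! i)"
    "\<forall>i<p. \<forall>j<i. ivs (f i) \<inter> ivs (f j) = {}"
    using greedy_items[OF us dis len, of p] by (auto simp: p_def)
  have "XA - Ag \<subseteq> (\<Union>i<p. ivs (f i))"
  proof
    fix v assume v: "v \<in> XA - Ag"
    then have "({v}, 0) \<in> set us" using vs(1) by (auto simp: us_def)
    then obtain i where i: "i < p" "us ! i = ({v}, 0)" by (auto simp: in_set_conv_nth p_def)
    then have "fst (us ! i) \<inter> XA \<subseteq> ivs (f i)" using f(1) by blast
    then have "v \<in> ivs (f i)" using i v by auto
    then show "v \<in> (\<Union>i<p. ivs (f i))" using i by auto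
  qed
  moreover have "(\<Sum>i<p. contrib (f i)) = (\<Sum>i<p. map snd us ! i)" using f(1) by (intro sum.cong) (auto simp: p_def)
  then have "(\<Sum>i<p. contrib (f i)) = tau" using sum by (simp add: sum_list_sum_nth p_def atLeast0LessThan)
  ultimately show ?thesis using f p6 by blast
qed

end

section \<open>Filling the slots\<close>

lemma card_tup_fixed_coordinate:
  assumes X: "finite X" and i: "i \<le> p"
  shows "card {zs \<in> tup X (Suc p). zs ! i = z \<and> Q zs} \<le> card {us \<in> tup X p. Q (take i us @ z # drop i us)}"
proof -
  let ?S = "{zs \<in> tup X (Suc p). zs ! i = z \<and> Q zs}"
  let ?f = "\<lambda>zs. take i zs @ drop (Suc i) zs"
  have restore: "take i (?f zs) @ z # drop i (?f zs) = zs" if "zs \<in> ?S" for zs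
    using that i id_take_nth_drop[of i zs] by (auto simp: tup_def)
  have "inj_on ?f ?S"
  proof (rule inj_onI)
    fix xs ys assume a: "xs \<in> ?S" "ys \<in> ?S" and "?f xs = ?f ys"
    then show "xs = ys" using restore[OF a(1)] restore[OF a(2)] by simp
  qed
  moreover have "?f ` ?S \<subseteq> {us \<in> tup X p. Q (take i us @ z # drop i us)}"
  proof
    fix us assume "us \<in> ?f ` ?S"
    then obtain zs where zs: "zs \<in> ?S" "us = ?f zs" by blast
    have "us \<in> tup X p" using zs i set_take_subset[of i zs] set_drop_subset[of "Suc i" zs]
      by (auto simp: tup_def)
    then show "us \<in> {us \<in> tup X p. Q (take i us @ z # drop i us)}" using restore[OF zs(1)] zs by simp
  qed
  ultimately show ?thesis using X by (intro card_inj_on_le) auto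
qed

lemma card_tup_window:
  assumes X: "finite X" "real (card X) \<le> n"
  shows "real (card {zs \<in> tup X (a + w + q). P (set (take w (drop a zs)))}) \<le> n ^ (a + q) * real (cnt X w P)"
proof -
  let ?S = "{zs \<in> tup X (a + w + q). P (set (take w (drop a zs)))}"
  let ?f = "\<lambda>xs. (take a xs, take w (drop a xs), drop (a + w) xs)"
  have "inj_on ?f ?S"
  proof (rule inj_onI)
    fix xs ys assume "?f xs = ?f ys"
    then have "take a xs @ take w (drop a xs) @ drop w (drop a xs) = take a ys @ take w (drop a ys) @ drop w (drop a ys)"
      by (simp add: add.commute)
    then show "xs = ys" by (simp only: append_take_drop_id)
  qed
  moreover have "?f ` ?S \<subseteq> tup X a \<times> {ws \<in> tup X w. P (set ws)} \<times> tup X q"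
    by (auto simp: tup_def dest: in_set_takeD in_set_dropD)
  ultimately have "card ?S \<le> card (tup X a \<times> {ws \<in> tup X w. P (set ws)} \<times> tup X q)"
    using X(1) by (intro card_inj_on_le) auto
  also have "\<dots> = card X ^ a * (cnt X w P * card X ^ q)"
    using X(1) by (simp add: card_cartesian_product card_tup cnt_def)
  finally have "real (card ?S) \<le> real (card X) ^ a * (real (cnt X w P) * real (card X) ^ q)"
    unfolding of_nat_mult[symmetric] of_nat_power[symmetric] by (rule of_nat_mono)
  also have "\<dots> \<le> n ^ a * (real (cnt X w P) * n ^ q)"
    using X(2) by (intro mult_mono power_mono) auto
  also have "\<dots> = n ^ (a + q) * real (cnt X w P)" by (simp add: power_add)
  finally show ?thesis .
qed

text \<open>Fixing an entry inside the window leaves the number of outside entries unchanged: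
  \<open>z\<close> joins the set and \<open>w - 1\<close> window entries stay free.\<close>

lemma card_tup_window_inside:
  assumes X: "finite X" "real (card X) \<le> n" and i: "a \<le> i" "i < a + w"
  shows "real (card {zs \<in> tup X (a + w + q). zs ! i = z \<and> P (set (take w (drop a zs)))})
    \<le> n ^ (a + q) * real (cnt X (w - 1) (\<lambda>S. P (insert z S)))"
proof -
  have e: "a + w + q = Suc (a + (w - 1) + q)" using i by simp
  have win: "set (take w (drop a (take i us @ z # drop i us))) = insert z (set (take (w - 1) (drop a us)))"
    if "us \<in> tup X (a + (w - 1) + q)" for us
  proof -
    have len: "length us = a + (w - 1) + q" using that by (simp add: tup_def)
    have 1: "take w (drop a (take i us @ z # drop i us)) = drop a (take i us) @ z # take (w - Suc (i - a)) (drop i us)"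
      using i len by (simp add: take_Cons' Suc_diff_le)
    have "take (w - 1) (drop a us) = take (i - a) (drop a us) @ take (w - 1 - (i - a)) (drop (i - a) (drop a us))"
      using i by (metis Nat.add_diff_assoc add_diff_inverse_nat less_diff_conv2 take_add less_imp_Suc_add diff_Suc_1 le_add1 le_add_diff_inverse not_less_eq add.commute add_diff_cancel_left' less_eq_Suc_le nat_less_le Suc_diff_1)
    also have "\<dots> = drop a (take i us) @ take (w - Suc (i - a)) (drop i us)"
      using i by (simp add: drop_take)
    finally show ?thesis unfolding 1 by auto
  qed
  have "card {zs \<in> tup X (a + w + q). zs ! i = z \<and> P (set (take w (drop a zs)))}
     \<le> card {us \<in> tup X (a + (w - 1) + q). P (set (take w (drop a (take i us @ z # drop i us))))}"
    unfolding e using i by (intro card_tup_fixed_coordinate[OF X(1)]) simp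
  also have "{us \<in> tup X (a + (w - 1) + q). P (set (take w (drop a (take i us @ z # drop i us))))}
     = {us \<in> tup X (a + (w - 1) + q). P (insert z (set (take (w - 1) (drop a us))))}"
    using win by (auto cong: conj_cong)
  finally show ?thesis
    using card_tup_window[OF X, of a "w - 1" q "\<lambda>S. P (insert z S)"] by linarith
qed

text \<open>The fixed entry takes away one of the \<open>a + q\<close> coordinates outside the
  window.\<close>

lemma card_tup_window_outside:
  assumes X: "finite X" "real (card X) \<le> n" and i: "i < a \<or> a + w \<le> i" "i < a + w + q"
  shows "real (card {zs \<in> tup X (a + w + q). zs ! i = z \<and> P (set (take w (drop a zs)))})
    \<le> n ^ (a + q - 1) * real (cnt X w P)"
proof (cases "i < a")
  case True
  have e: "a + w + q = Suc (a - 1 + w + q)" using True by simp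
  have win: "take w (drop a (take i us @ z # drop i us)) = take w (drop (a - 1) us)"
    if "us \<in> tup X (a - 1 + w + q)" for us
    using that True by (simp add: tup_def drop_Cons' min_def)
  have "card {zs \<in> tup X (a + w + q). zs ! i = z \<and> P (set (take w (drop a zs)))}
     \<le> card {us \<in> tup X (a - 1 + w + q). P (set (take w (drop a (take i us @ z # drop i us))))}"
    unfolding e using True by (intro card_tup_fixed_coordinate[OF X(1)]) simp
  also have "{us \<in> tup X (a - 1 + w + q). P (set (take w (drop a (take i us @ z # drop i us))))}
     = {us \<in> tup X (a - 1 + w + q). P (set (take w (drop (a - 1) us)))}"
    using win by (auto cong: conj_cong)
  also have "real (card \<dots>) \<le> n ^ (a - 1 + q) * real (cnt X w P)" by (rule card_tup_window[OF X])
  also have "a - 1 + q = a + q - 1" using True by simp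
  finally show ?thesis by simp
next
  case False
  then have i': "a + w \<le> i" "0 < q" using i by auto
  have e: "a + w + q = Suc (a + w + (q - 1))" using i' by simp
  have win: "take w (drop a (take i us @ z # drop i us)) = take w (drop a us)"
    if "us \<in> tup X (a + w + (q - 1))" for us
    using that i i' by (auto simp: tup_def drop_take min_def)
  have "card {zs \<in> tup X (a + w + q). zs ! i = z \<and> P (set (take w (drop a zs)))}
     \<le> card {us \<in> tup X (a + w + (q - 1)). P (set (take w (drop a (take i us @ z # drop i us))))}"
    unfolding e using i i' by (intro card_tup_fixed_coordinate[OF X(1)]) simp
  also have "{us \<in> tup X (a + w + (q - 1)). P (set (take w (drop a (take i us @ z # drop i us))))}
     = {us \<in> tup X (a + w + (q - 1)). P (set (take w (drop a us)))}"
    using win by (auto cong: conj_cong)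
  also have "real (card \<dots>) \<le> n ^ (a + (q - 1)) * real (cnt X w P)" by (rule card_tup_window[OF X])
  also have "a + (q - 1) = a + q - 1" using i' by simp
  finally show ?thesis by simp
qed

context near_extremal
begin

text \<open>A slot has \<open>rr\<close> vertices, the first of which is in \<open>Ag\<close>. Its two edges use the windows of length
  \<open>k - l - 1\<close> at the beginning and at the end of the other \<open>rr - 1\<close> vertices.\<close>

definition rr :: nat where "rr = 2 * k - 3 * l"

lemma rr: "k - l < rr" "rr + 3 * l = 2 * k" "rr + l = 2 * (k - l)" "rr + 1 \<le> 2 * k" using l by (auto simp: rr_def)

definition TT :: "'a list set" where "TT = {xs. length xs = rr \<and> hd xs \<in> Ag \<and> set (tl xs) \<subseteq> XB}"

text \<open>The windows in use start at 0 and at \<open>k - 2 * l\<close>. They overlap in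
  \<open>l - 1\<close> entries, which together with the vertex of \<open>Ag\<close> form the
  \<open>l\<close>-set shared by the two edges of a slot.\<close>

definition wbad :: "(nat \<Rightarrow> 'a set) \<Rightarrow> nat \<Rightarrow> nat \<Rightarrow> 'a list \<Rightarrow> bool" where
  "wbad G a t xs \<longleftrightarrow> ne (insert (hd xs) (G t \<union> set (take (k - l - 1) (drop a (tl xs)))))"

section \<open>Counting the bad fillings of a slot\<close>

lemma TT_image: "TT = (\<lambda>(y, zs). y # zs) ` (Ag \<times> tup XB (rr - 1))"
proof
  show "TT \<subseteq> (\<lambda>(y, zs). y # zs) ` (Ag \<times> tup XB (rr - 1))"
  proof
    fix xs assume xs: "xs \<in> TT"
    then have "xs \<noteq> []" using rr by (auto simp: TT_def)
    then show "xs \<in> (\<lambda>(y, zs). y # zs) ` (Ag \<times> tup XB (rr - 1))"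
      using xs by (intro image_eqI[of _ _ "(hd xs, tl xs)"]) (auto simp: TT_def tup_def)
  qed
  show "(\<lambda>(y, zs). y # zs) ` (Ag \<times> tup XB (rr - 1)) \<subseteq> TT" using rr by (auto simp: TT_def tup_def)
qed

lemma finite_TT: "finite TT" unfolding TT_image using sets by auto

lemma card_TT_le: "card {xs \<in> TT. Q (hd xs) (tl xs)} \<le> (\<Sum>y\<in>Ag. card {zs \<in> tup XB (rr - 1). Q y zs})"
proof -
  have "{xs \<in> TT. Q (hd xs) (tl xs)} \<subseteq> (\<lambda>(y, zs). y # zs) ` (SIGMA y:Ag. {zs \<in> tup XB (rr - 1). Q y zs})"
    unfolding TT_image by force
  then have "card {xs \<in> TT. Q (hd xs) (tl xs)} \<le> card (SIGMA y:Ag. {zs \<in> tup XB (rr - 1). Q y zs})"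
    using sets by (intro surj_card_le) auto
  then show ?thesis using sets by simp
qed

context
  fixes a q :: nat
  assumes aq: "a + (k - l - 1) + q = rr - 1"
begin

lemma aq_exp: "a + q + (k - l) = rr" "a + q + (k - l - 1) + 1 = rr" using aq rr l by auto

lemma slot_count:
  assumes G: "good (G t)"
  shows "real (card {xs \<in> TT. wbad G a t xs}) \<le> h * real n ^ rr"
proof -
  let ?P = "\<lambda>y S. ne (insert y (G t \<union> S))"
  have "card {xs \<in> TT. wbad G a t xs} \<le> (\<Sum>y\<in>Ag. card {zs \<in> tup XB (rr - 1). ?P y (set (take (k - l - 1) (drop a zs)))})"
    unfolding wbad_def by (rule card_TT_le)
  then have "real (card {xs \<in> TT. wbad G a t xs}) \<le> (\<Sum>y\<in>Ag. real (card {zs \<in> tup XB (rr - 1). ?P y (set (take (k - l - 1) (drop a zs)))}))"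
    unfolding of_nat_sum[symmetric] by (rule of_nat_mono)
  also have "\<dots> \<le> (\<Sum>y\<in>Ag. real n ^ (a + q) * real (cnt XB (k - l - 1) (?P y)))"
    unfolding aq[symmetric] using sets card_le_n by (intro sum_mono card_tup_window) auto
  also have "\<dots> = real n ^ (a + q) * real (NK (k - l - 1) (G t))" by (simp add: NK_def sum_distrib_left)
  also have "\<dots> \<le> real n ^ (a + q) * (h * real n ^ (k - l))" using G by (intro mult_left_mono) (auto simp: good_def)
  also have "\<dots> = h * real n ^ (a + q + (k - l))" by (simp add: power_add)
  finally show ?thesis unfolding aq_exp .
qed

text \<open>At most \<open>2 * h * n\<close> slots are in conflict and get the trivial bound; all
  others together contribute one more share of \<open>h\<close>.\<close>

lemma sum_conflict:
  assumes mn: "m \<le> n" and f0: "\<And>t. t < m \<Longrightarrow> f t \<le> real n ^ (k - l - 1)"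
    and fc: "\<And>t. t < m \<Longrightarrow> \<not> C t \<Longrightarrow> f t \<le> h * real n ^ (k - l - 1)"
    and C: "real (card {t. t < m \<and> C t}) \<le> 2 * h * real n"
  shows "(\<Sum>t<m. real n ^ (a + q) * f t) \<le> 3 * h * real n ^ rr"
proof -
  let ?x = "real n ^ (k - l - 1)"
  have x0: "0 \<le> ?x" "0 \<le> h * ?x" using h by simp_all
  have "(\<Sum>t<m. f t) \<le> (\<Sum>t<m. (if C t then ?x else 0) + h * ?x)"
  proof (rule sum_mono)
    fix t assume "t \<in> {..<m}"
    then show "f t \<le> (if C t then ?x else 0) + h * ?x" using f0[of t] fc[of t] x0 by auto
  qed
  also have "\<dots> = real (card {t. t < m \<and> C t}) * ?x + real m * (h * ?x)"
    by (simp add: sum.distrib sum.If_cases Int_def)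
  also have "\<dots> \<le> (2 * h * real n) * ?x + real n * (h * ?x)"
    using C mn x0 by (intro add_mono mult_right_mono) auto
  also have "\<dots> = 3 * h * (?x * real n)" by simp
  finally have "real n ^ (a + q) * (\<Sum>t<m. f t) \<le> real n ^ (a + q) * (3 * h * (?x * real n))"
    by (intro mult_left_mono) auto
  also have "\<dots> = 3 * h * real n ^ (a + q + (k - l - 1) + 1)" by (simp only: power_add power_one_right mult_ac)
  finally show ?thesis unfolding aq_exp by (simp add: sum_distrib_left)
qed

text \<open>If \<open>z\<close> comes first or lies in the window, its few conflicts give the bound.
  Outside the window the goodness of \<open>G t\<close> suffices: fixing \<open>z\<close> removes a
  factor \<open>n\<close>, and the choice of \<open>t\<close> restores it.\<close>

lemma elem_count:
  assumes mn: "m \<le> n" and G: "\<And>t. t < m \<Longrightarrow> good (G t)"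
    and conf: "\<And>x. x \<in> Ag \<or> x \<in> XB \<Longrightarrow> real (card {t. t < m \<and> conflict x (G t)}) \<le> 2 * h * real n"
    and j: "j < rr" and z: "if j = 0 then z \<in> Ag else z \<in> XB"
  shows "real (card {(t, xs). t < m \<and> xs \<in> TT \<and> xs ! j = z \<and> wbad G a t xs}) \<le> 3 * h * real n ^ rr"
proof -
  let ?w = "k - l - 1"
  let ?P = "\<lambda>t y S. ne (insert y (G t \<union> S))"
  have "{(t, xs). t < m \<and> xs \<in> TT \<and> xs ! j = z \<and> wbad G a t xs} = (SIGMA t:{..<m}. {xs \<in> TT. xs ! j = z \<and> wbad G a t xs})" by auto
  then have eq: "card {(t, xs). t < m \<and> xs \<in> TT \<and> xs ! j = z \<and> wbad G a t xs} = (\<Sum>t<m. card {xs \<in> TT. xs ! j = z \<and> wbad G a t xs})"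
    using finite_TT by simp
  show ?thesis
  proof (cases "j = 0")
    case True
    then have zA: "z \<in> Ag" using z by simp
    have one: "real (card {xs \<in> TT. xs ! j = z \<and> wbad G a t xs}) \<le> real n ^ (a + q) * real (cnt XB ?w (?P t z))" for t
    proof -
      have "{xs \<in> TT. xs ! j = z \<and> wbad G a t xs} \<subseteq> (\<lambda>zs. z # zs) ` {zs \<in> tup XB (rr - 1). ?P t z (set (take ?w (drop a zs)))}"
        unfolding True TT_image wbad_def by auto
      then have "card {xs \<in> TT. xs ! j = z \<and> wbad G a t xs} \<le> card {zs \<in> tup XB (rr - 1). ?P t z (set (take ?w (drop a zs)))}"
        using sets by (intro surj_card_le) auto
      also have "real \<dots> \<le> real n ^ (a + q) * real (cnt XB ?w (?P t z))"
        unfolding aq[symmetric] using sets card_le_n by (intro card_tup_window) auto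
      finally show ?thesis by simp
    qed
    have "real (\<Sum>t<m. card {xs \<in> TT. xs ! j = z \<and> wbad G a t xs}) \<le> (\<Sum>t<m. real n ^ (a + q) * real (cnt XB ?w (?P t z)))"
      unfolding of_nat_sum using one by (intro sum_mono)
    also have "\<dots> \<le> 3 * h * real n ^ rr"
    proof (rule sum_conflict[OF mn, where C = "\<lambda>t. conflict z (G t)"])
      show "real (cnt XB ?w (?P t z)) \<le> real n ^ ?w" for t
      proof -
        have "real (cnt XB ?w (?P t z)) \<le> real (card XB) ^ ?w"
          unfolding of_nat_power[symmetric] using cnt_le[OF sets(6)] by (rule of_nat_mono)
        also have "\<dots> \<le> real n ^ ?w" using card_le_n sets by (intro power_mono) auto
        finally show ?thesis .
      qed
      show "real (cnt XB ?w (?P t z)) \<le> h * real n ^ ?w" if "\<not> conflict z (G t)" for t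
        using that zA by (simp add: conflict_def)
      show "real (card {t. t < m \<and> conflict z (G t)}) \<le> 2 * h * real n" using conf zA by simp
    qed
    finally show ?thesis unfolding eq .
  next
    case False
    define i where "i = j - 1"
    have i: "i < rr - 1" "j = Suc i" using False j by (auto simp: i_def)
    have zB: "z \<in> XB" using z False by simp
    have zAg: "z \<notin> Ag" using zB XB_Ag by auto
    have two: "real (card {xs \<in> TT. xs ! j = z \<and> wbad G a t xs})
       \<le> (\<Sum>y\<in>Ag. real (card {zs \<in> tup XB (rr - 1). zs ! i = z \<and> ?P t y (set (take ?w (drop a zs)))}))" for t
    proof -
      have "{xs \<in> TT. xs ! j = z \<and> wbad G a t xs} = {xs \<in> TT. tl xs ! i = z \<and> ?P t (hd xs) (set (take ?w (drop a (tl xs))))}"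
      proof -
        have "xs ! j = tl xs ! i" if "xs \<in> TT" for xs using that i by (simp add: TT_def nth_tl)
        then show ?thesis unfolding wbad_def by auto
      qed
      then show ?thesis
        using card_TT_le[of "\<lambda>y zs. zs ! i = z \<and> ?P t y (set (take ?w (drop a zs)))"]
        unfolding of_nat_sum[symmetric] by (intro of_nat_mono) simp
    qed
    show ?thesis
    proof (cases "a \<le> i \<and> i < a + ?w")
      case True
      have one: "real (card {xs \<in> TT. xs ! j = z \<and> wbad G a t xs}) \<le> real n ^ (a + q) * real (NK (k - l - 2) (insert z (G t)))" for t
      proof -
        have "real (card {xs \<in> TT. xs ! j = z \<and> wbad G a t xs}) \<le> (\<Sum>y\<in>Ag. real n ^ (a + q) * real (cnt XB (?w - 1) (\<lambda>S. ?P t y (insert z S))))"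
          using True sets card_le_n unfolding aq[symmetric]
          by (intro order_trans[OF two[unfolded aq[symmetric]]] sum_mono card_tup_window_inside) auto
        also have "\<dots> = real n ^ (a + q) * real (NK (k - l - 2) (insert z (G t)))"
          by (simp add: NK_def sum_distrib_left numeral_2_eq_2)
        finally show ?thesis .
      qed
      have "real (\<Sum>t<m. card {xs \<in> TT. xs ! j = z \<and> wbad G a t xs}) \<le> (\<Sum>t<m. real n ^ (a + q) * real (NK (k - l - 2) (insert z (G t))))"
        unfolding of_nat_sum using one by (intro sum_mono)
      also have "\<dots> \<le> 3 * h * real n ^ rr"
      proof (rule sum_conflict[OF mn, where C = "\<lambda>t. conflict z (G t)"])
        show "real (NK (k - l - 2) (insert z (G t))) \<le> real n ^ ?w" for t
        proof -
          have c: "real (cnt XB (k - l - 2) P) \<le> real n ^ (k - l - 2)" for P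
          proof -
            have "real (cnt XB (k - l - 2) P) \<le> real (card XB) ^ (k - l - 2)"
              unfolding of_nat_power[symmetric] using cnt_le[OF sets(6)] by (rule of_nat_mono)
            also have "\<dots> \<le> real n ^ (k - l - 2)" using card_le_n sets by (intro power_mono) auto
            finally show ?thesis .
          qed
          have "real (NK (k - l - 2) (insert z (G t))) \<le> (\<Sum>y\<in>Ag. real n ^ (k - l - 2))"
            unfolding NK_def of_nat_sum using c by (intro sum_mono)
          also have "\<dots> \<le> real n * real n ^ (k - l - 2)" using card_le_n sets by (simp add: mult_right_mono)
          also have "\<dots> = real n ^ Suc (k - l - 2)" by simp
          also have "Suc (k - l - 2) = ?w" using l by simp
          finally show ?thesis .
        qed
        show "real (NK (k - l - 2) (insert z (G t))) \<le> h * real n ^ ?w" if "\<not> conflict z (G t)" for t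
          using that zAg by (simp add: conflict_def)
        show "real (card {t. t < m \<and> conflict z (G t)}) \<le> 2 * h * real n" using conf zB by simp
      qed
      finally show ?thesis unfolding eq .
    next
      case False
      have pos: "0 < a + q" using False i(1) unfolding aq[symmetric] by auto
      have one: "real (card {xs \<in> TT. xs ! j = z \<and> wbad G a t xs}) \<le> real n ^ (a + q - 1) * (h * real n ^ (k - l))" if t: "t < m" for t
      proof -
        have "real (card {xs \<in> TT. xs ! j = z \<and> wbad G a t xs}) \<le> (\<Sum>y\<in>Ag. real n ^ (a + q - 1) * real (cnt XB ?w (?P t y)))"
          using False sets card_le_n i(1) unfolding aq[symmetric]
          by (intro order_trans[OF two[unfolded aq[symmetric]]] sum_mono card_tup_window_outside) auto
        also have "\<dots> = real n ^ (a + q - 1) * real (NK (k - l - 1) (G t))"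
          by (simp add: NK_def sum_distrib_left)
        also have "\<dots> \<le> real n ^ (a + q - 1) * (h * real n ^ (k - l))" using G[OF t] by (intro mult_left_mono) (auto simp: good_def)
        finally show ?thesis .
      qed
      have "real (\<Sum>t<m. card {xs \<in> TT. xs ! j = z \<and> wbad G a t xs}) \<le> (\<Sum>t<m. real n ^ (a + q - 1) * (h * real n ^ (k - l)))"
        unfolding of_nat_sum using one by (intro sum_mono) auto
      also have "\<dots> = real m * (h * real n ^ (a + q - 1 + (k - l)))" by (simp add: power_add)
      also have "\<dots> \<le> real n * (h * real n ^ (a + q - 1 + (k - l)))" using mn h by (intro mult_right_mono) auto
      also have "\<dots> = h * real n ^ Suc (a + q - 1 + (k - l))" by simp
      also have "Suc (a + q - 1 + (k - l)) = rr" using aq_exp(1) pos by linarith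
      also have "h * real n ^ rr \<le> 3 * h * real n ^ rr" using h by simp
      finally show ?thesis unfolding eq .
    qed
  qed
qed

end

lemma fill_slots:
  assumes mn: "m \<le> n" "real n \<le> 8 * real k * real m"
    and R: "\<And>t. t < m \<Longrightarrow> good (R t)" and L: "\<And>t. t < m \<Longrightarrow> good (L t)"
    and cR: "\<And>x. x \<in> Ag \<or> x \<in> XB \<Longrightarrow> real (card {t. t < m \<and> conflict x (R t)}) \<le> 2 * h * real n"
    and cL: "\<And>x. x \<in> Ag \<or> x \<in> XB \<Longrightarrow> real (card {t. t < m \<and> conflict x (L t)}) \<le> 2 * h * real n"
    and Y: "\<And>j. j < rr \<Longrightarrow> card (Y j) = m" "Y 0 \<subseteq> Ag" "\<And>j. 0 < j \<Longrightarrow> j < rr \<Longrightarrow> Y j \<subseteq> XB"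
  shows "\<exists>F. (\<forall>j<rr. bij_betw (F j) {..<m} (Y j)) \<and>
    (\<forall>t<m. \<not> ne (insert (F 0 t) (R t \<union> (\<lambda>j. F j t) ` {1..<k - l}))
         \<and> \<not> ne (insert (F 0 t) (L t \<union> (\<lambda>j. F j t) ` {k - 2 * l + 1..<rr})))"
proof -
  define b where "b = k - 2 * l"
  define bad where "bad t xs \<longleftrightarrow> wbad R 0 t xs \<or> wbad L b t xs" for t xs
  \<comment> \<open>This gives the term \<open>(rr + 1) * \<delta>\<close> in
    \<open>latin_exchange\<close> the value \<open>1 / 2\<close>; the other term is below
    \<open>1 / 2\<close> for large \<open>m\<close>.\<close>
  define \<delta> where "\<delta> = 1 / (2 * real (Suc rr))"
  have aq1: "0 + (k - l - 1) + (rr - 1 - (k - l - 1)) = rr - 1" and aq2: "b + (k - l - 1) + 0 = rr - 1"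
    using l by (auto simp: rr_def b_def)
  have m0: "0 < real m" using mn(2) n0 by (cases m) auto
  \<comment> \<open>Two edges with \<open>3 * h\<close> each from \<open>elem_count\<close>; passing
    from \<open>n\<close> to \<open>m\<close> costs \<open>(8 * k) ^ rr\<close>.\<close>
  have hd: "6 * h * real n ^ rr \<le> \<delta> * real m ^ rr"
  proof -
    have "12 * real (Suc rr) * (8 * real k) ^ rr \<le> (16 * real k) ^ 2 * (16 * real k) ^ rr"
    proof (rule mult_mono)
      have "12 * real (Suc rr) \<le> 24 * real k" using rr by simp
      also have "\<dots> \<le> (16 * real k) ^ 2" using k3 by (simp add: power2_eq_square)
      finally show "12 * real (Suc rr) \<le> (16 * real k) ^ 2" .
      show "(8 * real k) ^ rr \<le> (16 * real k) ^ rr" by (intro power_mono) auto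
    qed auto
    also have "\<dots> = (16 * real k) ^ (2 + rr)" by (simp only: power_add)
    also have "\<dots> \<le> (16 * real k) ^ (4 * k)" using rr k3 by (intro k_power_le) simp
    finally have "h * (12 * real (Suc rr) * (8 * real k) ^ rr) \<le> 1" by (rule h_times_le)
    then have c: "6 * h * (8 * real k) ^ rr \<le> \<delta>" by (simp add: \<delta>_def field_simps)
    have "6 * h * real n ^ rr \<le> 6 * h * (8 * real k * real m) ^ rr"
      using mn(2) h by (intro mult_left_mono power_mono) auto
    also have "\<dots> = (6 * h * (8 * real k) ^ rr) * real m ^ rr" by (simp add: power_mult_distrib)
    also have "\<dots> \<le> \<delta> * real m ^ rr" using c by (intro mult_right_mono) auto
    finally show ?thesis .
  qed
  have subT: "xs \<in> TT" if "length xs = rr" "\<forall>j<rr. xs ! j \<in> Y j" for xs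
  proof -
    have "xs \<noteq> []" using that rr by auto
    moreover have "set (tl xs) \<subseteq> XB"
    proof
      fix x assume "x \<in> set (tl xs)"
      then obtain i where "i < length (tl xs)" "x = tl xs ! i" by (auto simp: in_set_conv_nth)
      then have "Suc i < rr" "x = xs ! Suc i" using that(1) by (auto simp: nth_tl)
      then show "x \<in> XB" using that(2) Y(3)[of "Suc i"] by auto
    qed
    ultimately show ?thesis using that Y(2) rr by (auto simp: TT_def hd_conv_nth)
  qed
  have Yfin: "finite (Y j)" if "j < rr" for j
    using Y(2) Y(3)[of j] that sets finite_subset[of "Y j" Ag] finite_subset[of "Y j" XB] by (cases "j = 0") auto
  have hn0: "0 \<le> h * real n ^ rr" using h by simp
  have "\<exists>F. (\<forall>j<rr. bij_betw (F j) {..<m} (Y j)) \<and> (\<forall>t<m. \<not> bad t (map (\<lambda>j. F j t) [0..<rr]))"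
  proof (rule latin_exchange[where \<delta> = \<delta>])
    show "finite (Y j) \<and> card (Y j) = m" if "j < rr" for j using Yfin Y(1) that by simp
    show "real (card {xs. length xs = rr \<and> (\<forall>j<rr. xs ! j \<in> Y j) \<and> bad t xs}) \<le> \<delta> * real m ^ rr" if t: "t < m" for t
    proof -
      have "{xs. length xs = rr \<and> (\<forall>j<rr. xs ! j \<in> Y j) \<and> bad t xs} \<subseteq> {xs \<in> TT. wbad R 0 t xs} \<union> {xs \<in> TT. wbad L b t xs}"
        using subT by (auto simp: bad_def)
      then have "card {xs. length xs = rr \<and> (\<forall>j<rr. xs ! j \<in> Y j) \<and> bad t xs} \<le> card ({xs \<in> TT. wbad R 0 t xs} \<union> {xs \<in> TT. wbad L b t xs})"
        using finite_TT by (intro card_mono) auto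
      also have "\<dots> \<le> card {xs \<in> TT. wbad R 0 t xs} + card {xs \<in> TT. wbad L b t xs}" by (rule card_Un_le)
      finally have "real (card {xs. length xs = rr \<and> (\<forall>j<rr. xs ! j \<in> Y j) \<and> bad t xs}) \<le> 2 * (h * real n ^ rr)"
        using slot_count[of 0 "rr - 1 - (k - l - 1)" R t, OF aq1 R[OF t]] slot_count[of b 0 L t, OF aq2 L[OF t]] by linarith
      then show ?thesis using hd hn0 by linarith
    qed
    show "real (card {(t, xs). t < m \<and> length xs = rr \<and> (\<forall>j<rr. xs ! j \<in> Y j) \<and> xs ! j = z \<and> bad t xs}) \<le> \<delta> * real m ^ rr"
      if j: "j < rr" and z: "z \<in> Y j" for j z
    proof -
      let ?S1 = "{(t, xs). t < m \<and> xs \<in> TT \<and> xs ! j = z \<and> wbad R 0 t xs}"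
      let ?S2 = "{(t, xs). t < m \<and> xs \<in> TT \<and> xs ! j = z \<and> wbad L b t xs}"
      have zz: "if j = 0 then z \<in> Ag else z \<in> XB" using z Y(2) Y(3)[of j] j by auto
      have fin: "finite ?S1" "finite ?S2"
        by (rule finite_subset[of _ "{..<m} \<times> TT"]; use finite_TT in auto)+
      have "{(t, xs). t < m \<and> length xs = rr \<and> (\<forall>j<rr. xs ! j \<in> Y j) \<and> xs ! j = z \<and> bad t xs} \<subseteq> ?S1 \<union> ?S2"
        using subT by (auto simp: bad_def)
      then have "card {(t, xs). t < m \<and> length xs = rr \<and> (\<forall>j<rr. xs ! j \<in> Y j) \<and> xs ! j = z \<and> bad t xs} \<le> card (?S1 \<union> ?S2)"
        using fin by (intro card_mono) auto
      also have "\<dots> \<le> card ?S1 + card ?S2" by (rule card_Un_le)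
      finally have "real (card {(t, xs). t < m \<and> length xs = rr \<and> (\<forall>j<rr. xs ! j \<in> Y j) \<and> xs ! j = z \<and> bad t xs}) \<le> 6 * (h * real n ^ rr)"
        using elem_count[of 0 "rr - 1 - (k - l - 1)" m R j z, OF aq1 mn(1) R cR j zz]
          elem_count[of b 0 m L j z, OF aq2 mn(1) L cL j zz] by linarith
      then show ?thesis using hd by linarith
    qed
    show "real (Suc rr) * \<delta> + real ((Suc rr)\<^sup>2) / real m < 1"
    proof -
      have "(16 * real k) ^ 3 \<le> (16 * real k) ^ (4 * k)" using k3 by (intro k_power_le) simp
      then have "(16 * real k) ^ 3 \<le> h ^ 19 * real n" by (rule const_le)
      also have "\<dots> \<le> 1 * real n" using h h_small by (intro mult_right_mono power_le_one) auto
      also have "\<dots> \<le> 8 * real k * real m" using mn(2) by simp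
      finally have "8 * real k * (512 * real k ^ 2) \<le> 8 * real k * real m" by (simp add: power_mult_distrib eval_nat_numeral)
      then have "512 * real k ^ 2 \<le> real m" using k3 by simp
      moreover have "real (Suc rr) ^ 2 \<le> (2 * real k) ^ 2" using rr by (intro power_mono) auto
      then have "real ((Suc rr)\<^sup>2) \<le> 4 * real k ^ 2" by (simp add: power_mult_distrib)
      moreover have "0 < real k ^ 2" using k3 by simp
      ultimately have "2 * real ((Suc rr)\<^sup>2) < real m" by linarith
      then have "real ((Suc rr)\<^sup>2) / real m < 1 / 2" using m0 by (simp add: field_simps)
      moreover have "real (Suc rr) * \<delta> = 1 / 2" by (simp add: \<delta>_def)
      ultimately show ?thesis by linarith
    qed
    show "0 < m" using m0 by simp
    show "0 < rr" using rr by simp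
  qed
  then obtain F where F: "\<forall>j<rr. bij_betw (F j) {..<m} (Y j)" "\<forall>t<m. \<not> bad t (map (\<lambda>j. F j t) [0..<rr])" by auto
  have r1: "rr = Suc (rr - 1)" using rr by simp
  have hdm: "hd (map (\<lambda>j. F j t) [0..<rr]) = F 0 t" for t using rr by (simp add: hd_map)
  have tlm: "tl (map (\<lambda>j. F j t) [0..<rr]) = map (\<lambda>j. F j t) [1..<rr]" for t
    using rr by (simp add: map_tl[symmetric] tl_upt)
  have "set (take (k - l - 1) (drop 0 (map (\<lambda>j. F j t) [1..<rr]))) = (\<lambda>j. F j t) ` {1..<k - l}" for t
  proof -
    have e: "1 + (k - l - 1) = k - l" using l by simp
    have "take (k - l - 1) [1..<rr] = [1..<k - l]"
      by (rule take_upt[of 1 "k - l - 1" rr, unfolded e, OF less_imp_le[OF rr(1)]])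
    then show ?thesis by (simp add: take_map)
  qed
  moreover have "set (take (k - l - 1) (drop b (map (\<lambda>j. F j t) [1..<rr]))) = (\<lambda>j. F j t) ` {k - 2 * l + 1..<rr}" for t
  proof -
    have "b + 1 + (k - l - 1) = rr" using l by (simp add: b_def rr_def)
    then have "set (take (k - l - 1) (drop b (map (\<lambda>j. F j t) [1..<rr]))) = (\<lambda>j. F j t) ` {b + 1..<rr}"
      by (simp add: take_map drop_map add.commute)
    then show ?thesis by (simp add: b_def)
  qed
  ultimately have "\<forall>t<m. \<not> ne (insert (F 0 t) (R t \<union> (\<lambda>j. F j t) ` {1..<k - l}))
         \<and> \<not> ne (insert (F 0 t) (L t \<union> (\<lambda>j. F j t) ` {k - 2 * l + 1..<rr}))"
    using F(2) unfolding bad_def wbad_def hdm tlm by simp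
  then show ?thesis using F(1) by blast
qed

end

section \<open>Plain items and the exact vertex count\<close>

lemma successively_link_snd:
  assumes "successively (link E) (xs @ [(z, A)])"
  shows "successively (link E) (xs @ [(z, B)])"
  using assms by (auto simp: successively_append_iff link_def)

context near_extremal
begin

text \<open>In exponential form, the bound of the potential says that a vertex \<open>x\<close> has fewer than
  \<open>h * n\<close> conflicts: \<open>2 ^ b \<le> (1 + \<delta>) ^ m * n \<le> exp (\<delta> * m + h\<^sup>2 * n)\<close> and \<open>1/2 \<le> ln 2\<close>.\<close>

lemma conflicts_le:
  assumes "(2::real) ^ b \<le> (1 + \<delta>) ^ m * real n" "0 \<le> \<delta>" "m \<le> n" "\<delta> * 4 \<le> h" 
  shows "real b \<le> h * real n"
proof -
  define y where "y = h ^ 2 * real n"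
  \<comment> \<open>With this, the quadratic term of \<open>exp y\<close> alone dominates
    \<open>n\<close>.\<close>
  have "2 \<le> h ^ 4 * real n"
  proof -
    have "(2::real) \<le> h ^ 19 * real n" by (rule const_le, rule order_trans[OF _ k_power_le[of 1]]) (use k3 in auto)
    also have "\<dots> \<le> h ^ 4 * real n" by (intro mult_right_mono h_power_mono) auto
    finally show ?thesis .
  qed
  then have "2 * real n \<le> h ^ 4 * real n * real n" by (intro mult_right_mono) auto
  also have "\<dots> = y\<^sup>2" by (simp add: y_def power2_eq_square eval_nat_numeral)
  finally have "real n \<le> y\<^sup>2 / 2" by simp
  also have "\<dots> \<le> exp y"
  proof -
    have "0 \<le> y" using h by (simp add: y_def)
    then have "1 + y + y\<^sup>2 / 2 \<le> exp y" by (rule exp_lower_Taylor_quadratic)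
    then show ?thesis using \<open>0 \<le> y\<close> by linarith
  qed
  finally have 1: "real n \<le> exp y" .
  have 2: "(1 + \<delta>) ^ m \<le> exp (\<delta> * real m)"
  proof -
    have "(1 + \<delta>) ^ m \<le> exp \<delta> ^ m" using assms(2) by (intro power_mono exp_ge_add_one_self) auto
    then show ?thesis by (simp add: exp_of_nat_mult[symmetric] mult.commute)
  qed
  have "exp (1 / 2 :: real) \<le> 2"
    using exp_bound_half[of "1 / 2 :: real"] by simp
  then have "exp (1 / 2 :: real) ^ b \<le> 2 ^ b" by (intro power_mono) auto
  also have "\<dots> \<le> (1 + \<delta>) ^ m * real n" by (rule assms(1))
  also have "\<dots> \<le> exp (\<delta> * real m) * exp y" using 1 2 by (intro mult_mono) auto
  finally have "exp (real b * (1 / 2)) \<le> exp (\<delta> * real m + y)"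
    by (simp only: exp_of_nat_mult[symmetric] exp_add[symmetric])
  then have "real b \<le> 2 * (\<delta> * real m) + 2 * y" by simp
  also have "\<delta> * real m \<le> h / 4 * real n" using assms h by (intro mult_mono) auto
  also have "y \<le> h / 4 * real n"
  proof -
    have "h ^ 2 \<le> h * (1 / 256)" using mult_left_mono[OF h_small(2), of h] h by (simp add: power2_eq_square)
    then have "h ^ 2 \<le> h / 4" using h by simp
    then show ?thesis unfolding y_def by (intro mult_right_mono) auto
  qed
  finally show ?thesis by simp
qed

lemma plain_items:
  assumes W: "finite W" "real (card W) \<le> h ^ 4 * real n" and m: "2 * (k - l) * m \<le> n" and jm: "j \<le> m"
  shows "\<exists>I. (\<forall>i<j. good (I i) \<and> I i \<inter> W = {}) \<and> (\<forall>i<j. \<forall>i'<i. I i \<inter> I i' = {})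
    \<and> (\<forall>x. x \<in> Ag \<or> x \<in> XB \<longrightarrow> real (card {i. i < j \<and> conflict x (I i)}) \<le> h * real n)"
proof -
  define C where "C = {us \<in> tup XB l. card (set us) = l \<and> good (set us)}"
  \<comment> \<open>\<open>XB\<close> loses at most \<open>n / 256\<close> vertices to
    \<open>W\<close>, \<open>n / 2\<close> to earlier choices and \<open>n / 100\<close> to the
    tuple itself, so over \<open>n / 16\<close> remain for each entry. Half of these tuples are
    given up for those that are not good. \<open>\<delta>\<close> is the bound of
    \<open>card_conflict\<close> relative to \<open>K\<close>.\<close>
  define K where "K = (real n / 16) ^ l / 2"
  define \<delta> where "\<delta> = 2 * 16 ^ l * h ^ 2"
  define bad where "bad x us \<longleftrightarrow> (x \<in> Ag \<or> x \<in> XB) \<and> conflict x (set us)" for x us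
  have K0: "0 < K" using n0 by (simp add: K_def)
  have finC: "finite C" using sets by (simp add: C_def)
  have "l * m \<le> (k - l) * m" using l by (intro mult_le_mono1) simp
  then have "2 * (l * m) \<le> n" using m unfolding mult.assoc by linarith
  then have ml: "2 * (m * l) \<le> n" by (simp only: mult.commute)
  have W16: "256 * card W \<le> n"
  proof -
    have "h ^ 4 \<le> h ^ 1" by (rule h_power_mono) simp
    then have "h ^ 4 * real n \<le> 1 / 256 * real n" using h_small by (intro mult_right_mono) auto
    then show ?thesis using W by linarith
  qed
  have avail: "K \<le> real (card {us \<in> C. set us \<inter> U = {}})" if U: "finite U" "card U \<le> card W + m * l" for U
  proof -
    have l16: "100 * l \<le> n" using n_big l by linarith
    have "n \<le> 16 * (card XB - card U - l)" using card_XB_ge U(2) ml W16 l16 by linarith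
    then have "real n / 16 \<le> real (card XB - card U - l)" by linarith
    then have "(real n / 16) ^ l \<le> real (card XB - card U - l) ^ l" by (intro power_mono) auto
    also have "\<dots> \<le> real (card {xs \<in> tup XB l. distinct xs \<and> set xs \<inter> U = {}})"
      using card_tup_fresh_ge[OF sets(6) U(1), of l] unfolding of_nat_power[symmetric] by (rule of_nat_mono)
    also have "\<dots> \<le> real (card ({us \<in> C. set us \<inter> U = {}} \<union> badL))"
    proof (rule of_nat_mono, rule card_mono)
      show "finite ({us \<in> C. set us \<inter> U = {}} \<union> badL)" using finC sets by (simp add: badL_def)
      show "{xs \<in> tup XB l. distinct xs \<and> set xs \<inter> U = {}} \<subseteq> {us \<in> C. set us \<inter> U = {}} \<union> badL"
        by (auto simp: C_def badL_def tup_def distinct_card)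
    qed
    also have "\<dots> \<le> real (card {us \<in> C. set us \<inter> U = {}}) + real (card badL)"
      using card_Un_le[of "{us \<in> C. set us \<inter> U = {}}" badL] by linarith
    also have "real (card badL) \<le> h ^ 5 * real n ^ l" using card_not_good by (simp add: badL_def)
    also have "h ^ 5 * real n ^ l \<le> K"
    proof -
      have "2 * 16 ^ l \<le> (16 * real k) ^ 1 * (16 * real k) ^ l" using k3 by (intro mult_mono power_mono) auto
      also have "\<dots> = (16 * real k) ^ (1 + l)" by (simp only: power_add)
      also have "\<dots> \<le> (16 * real k) ^ (4 * k)" using l by (intro k_power_le) simp
      finally have "2 * 16 ^ l * h ^ Suc 4 \<le> h ^ 4" by (rule h_power_gap)
      also have "\<dots> \<le> 1" using h h_small by (intro power_le_one) auto
      finally have "2 * 16 ^ l * h ^ 5 * (real n / 16) ^ l \<le> 1 * (real n / 16) ^ l" by (intro mult_right_mono) auto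
      then show ?thesis by (simp add: K_def power_divide field_simps)
    qed
    finally show ?thesis by (simp add: K_def)
  qed
  have bd: "real (card {us \<in> C. bad x us}) \<le> \<delta> * K" if x: "x \<in> V" for x
  proof -
    have "card {us \<in> C. bad x us} \<le> card {us \<in> tup XB l. (x \<in> Ag \<or> x \<in> XB) \<and> conflict x (set us)}"
      using sets by (intro card_mono) (auto simp: C_def bad_def)
    then have "real (card {us \<in> C. bad x us}) \<le> h ^ 2 * real n ^ l" using card_conflict[OF x] by linarith
    also have "\<dots> = \<delta> * K" by (simp add: \<delta>_def K_def power_divide)
    finally show ?thesis .
  qed
  have d0: "0 \<le> \<delta>" using h by (simp add: \<delta>_def)
  have d4: "\<delta> * 4 \<le> h"
  proof -
    have "8 * 16 ^ l \<le> (16 * real k) ^ 1 * (16 * real k) ^ l" using k3 by (intro mult_mono power_mono) auto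
    also have "\<dots> = (16 * real k) ^ (1 + l)" by (simp only: power_add)
    also have "\<dots> \<le> (16 * real k) ^ (4 * k)" using l by (intro k_power_le) simp
    finally have "8 * 16 ^ l * h ^ Suc 1 \<le> h ^ 1" by (rule h_power_gap)
    then show ?thesis by (simp add: \<delta>_def power2_eq_square mult_ac)
  qed
  have Cvs: "finite (set us) \<and> card (set us) \<le> l" if "us \<in> C" for us using that by (simp add: C_def)
  obtain f where f: "\<forall>i<j. f i \<in> C \<and> set (f i) \<inter> W = {}" "\<forall>i<j. \<forall>i'<i. set (f i) \<inter> set (f i') = {}"
    "(\<Sum>x\<in>V. 2 ^ card {i. i < j \<and> bad x (f i)}) \<le> (1 + \<delta>) ^ j * real (card V)"
    using balanced_disjoint_sequence[of C set l V W m K bad \<delta> j, OF finC Cvs finV W(1) avail K0 bd d0 jm] by blast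
  have "real (card {i. i < j \<and> conflict x (set (f i))}) \<le> h * real n" if x: "x \<in> Ag \<or> x \<in> XB" for x
  proof -
    have xV: "x \<in> V" using x sets by auto
    have "(2::real) ^ card {i. i < j \<and> bad x (f i)} \<le> (\<Sum>x\<in>V. 2 ^ card {i. i < j \<and> bad x (f i)})"
      using xV finV by (intro member_le_sum) auto
    then have "(2::real) ^ card {i. i < j \<and> bad x (f i)} \<le> (1 + \<delta>) ^ j * real n" using f(3) unfolding cV by (rule order_trans)
    moreover have "j \<le> n"
    proof -
      have "1 * m \<le> 2 * (k - l) * m" using l by (intro mult_le_mono1) simp
      then show ?thesis using m jm by linarith
    qed
    ultimately have "real (card {i. i < j \<and> bad x (f i)}) \<le> h * real n" by (rule conflicts_le[OF _ d0 _ d4])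
    then show ?thesis using x by (simp add: bad_def)
  qed
  then show ?thesis using f by (intro exI[of _ "\<lambda>i. set (f i)"]) (auto simp: C_def)
qed

text \<open>Counting vertices: with \<open>\<Sum>i<p. contrib (f i) = tau\<close> the special items, the plain items and the
  \<open>m\<close> slots use up all vertices exactly, as \<open>\<Sum>i<p. length (fst (f i)) + 2 * m = N\<close>.\<close>

lemma items_collection:
  "\<exists>m g Y0. 0 < m \<and> m \<le> n \<and> real n \<le> 8 * real k * real m
    \<and> (\<forall>t<m. valid (g t)) \<and> (\<forall>t<m. \<forall>s<t. ivs (g t) \<inter> ivs (g s) = {})
    \<and> Y0 \<subseteq> Ag \<and> card Y0 = m \<and> (\<forall>t<m. ivs (g t) \<inter> Y0 = {}) \<and> XA \<subseteq> Y0 \<union> (\<Union>t<m. ivs (g t))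
    \<and> (\<Sum>t<m. length (fst (g t))) + 2 * m = N
    \<and> (\<forall>x. x \<in> Ag \<or> x \<in> XB \<longrightarrow> real (card {t. t < m \<and> conflict x (snd (g t))}) \<le> 2 * h * real n)
    \<and> (\<forall>x. x \<in> Ag \<or> x \<in> XB \<longrightarrow> real (card {t. t < m \<and> conflict x (lend (g t))}) \<le> 2 * h * real n)"
proof -
  obtain p f where f: "\<forall>i<p. valid (f i) \<and> length (fst (f i)) \<le> 2" "\<forall>i<p. \<forall>j<i. ivs (f i) \<inter> ivs (f j) = {}"
    "XA - Ag \<subseteq> (\<Union>i<p. ivs (f i))" "(\<Sum>i<p. contrib (f i)) = tau" "real p \<le> h ^ 6 * real n"
    using special_items by blast
  define S where "S = (\<Union>i<p. ivs (f i))"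
  \<comment> \<open>These vertices belong to \<open>Ag\<close> and head the slots, one each. Items
    and slots alternate on the cycle, so \<open>m\<close> is also the number of items.\<close>
  define Y0 where "Y0 = XA - S"
  define m where "m = card Y0"
  have fi: "finite (ivs (f i)) \<and> card (ivs (f i)) \<le> 2 * k" if "i < p" for i using card_ivs f(1) that by auto
  have finS: "finite S" using fi by (auto simp: S_def)
  have "card S \<le> (\<Sum>i<p. card (ivs (f i)))" unfolding S_def by (rule card_UN_le) simp
  also have "\<dots> \<le> (\<Sum>i<p. 2 * k)" using fi by (intro sum_mono) auto
  finally have "card S \<le> p * (2 * k)" by simp
  then have "real (card S) \<le> real (p * (2 * k))" by (rule of_nat_mono)
  also have "\<dots> = 2 * real k * real p" by simp
  also have "\<dots> \<le> 2 * real k * (h ^ 6 * real n)" using f(5) by (intro mult_left_mono) auto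
  finally have cS: "real (card S) \<le> 2 * real k * (h ^ 6 * real n)" .
  have "2 * real k * (h ^ 6 * real n) = 2 * (h * real k) * (h ^ 5 * real n)" by (simp add: eval_nat_numeral)
  also have "\<dots> \<le> 1 * (h ^ 4 * real n)"
    using h_small h h_power_mono[of 4 5] by (intro mult_mono) auto
  finally have cS4: "real (card S) \<le> h ^ 4 * real n" using cS by simp
  have nm: "real n \<le> 8 * real k * real m"
  proof -
    have "Ag \<subseteq> Y0 \<union> S" using Ag_XA by (auto simp: Y0_def)
    then have "card Ag \<le> card (Y0 \<union> S)" using sets finS by (intro card_mono) (auto simp: Y0_def)
    also have "\<dots> \<le> m + card S" unfolding m_def by (rule card_Un_le)
    finally have "real (card Ag) \<le> real m + 2 * real k * (h ^ 6 * real n)" using cS by linarith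
    then have "4 * real (k - l) * real (card Ag) \<le> 4 * real k * (real m + 2 * real k * (h ^ 6 * real n))"
      by (intro mult_mono) auto
    also have "\<dots> = 4 * real k * real m + 8 * (h * (real k)\<^sup>2) * h ^ 5 * real n" by (simp add: algebra_simps power2_eq_square eval_nat_numeral)
    also have "8 * (h * (real k)\<^sup>2) * h ^ 5 * real n \<le> 1 / 2 * 1 * real n"
      using h_small h by (intro mult_right_mono mult_mono power_le_one) auto
    finally show ?thesis using card_Ag_ge(1) by simp
  qed
  have m0: "0 < m" using nm n0 by (cases m) auto
  have pm: "p \<le> m"
  proof -
    have "h ^ 6 * real n \<le> h ^ 6 * (8 * real k * real m)" using nm h by (intro mult_left_mono) auto
    then have "real p \<le> h ^ 6 * (8 * real k * real m)" using f(5) by linarith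
    also have "\<dots> = 8 * (h * real k) * h ^ 5 * real m" by (simp add: eval_nat_numeral)
    also have "\<dots> \<le> 1 * 1 * real m" using h_small h by (intro mult_right_mono mult_mono power_le_one) auto
    finally show ?thesis by simp
  qed
  have Sdis: "ivs (f i) \<inter> ivs (f j) = {}" if "i < p" "j < p" "i \<noteq> j" for i j
    using f(2) that by (metis Int_commute linorder_neqE_nat)
  have "(\<Sum>i<p. card (ivs (f i) \<inter> XA)) = card (S \<inter> XA)"
  proof -
    have "S \<inter> XA = (\<Union>i<p. ivs (f i) \<inter> XA)" by (auto simp: S_def)
    moreover have "card (\<Union>i<p. ivs (f i) \<inter> XA) = (\<Sum>i<p. card (ivs (f i) \<inter> XA))"
      using fi Sdis by (intro card_UN_disjoint) auto
    ultimately show ?thesis by simp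
  qed
  moreover have "card XA = card (S \<inter> XA) + m"
  proof -
    have "XA = (S \<inter> XA) \<union> Y0" by (auto simp: Y0_def)
    then show ?thesis using card_Un_disjoint[of "S \<inter> XA" Y0] sets by (auto simp: Y0_def m_def)
  qed
  \<comment> \<open>Each vertex of \<open>Y0\<close> accounts for two edges, so contributions with
    sum \<open>tau\<close> make the edges of items and slots number exactly
    \<open>N\<close>.\<close>
  moreover have "tau = (\<Sum>i<p. int (length (fst (f i)))) - 2 * (\<Sum>i<p. int (card (ivs (f i) \<inter> XA)))"
    unfolding f(4)[symmetric] contrib_def by (simp add: sum_subtractf sum_distrib_left)
  ultimately have iN: "int N = (\<Sum>i<p. int (length (fst (f i)))) + 2 * int m"
    by (simp add: tau_def of_nat_sum[symmetric] del: of_nat_sum)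
  have Nm: "N = (\<Sum>i<p. length (fst (f i))) + 2 * m"
  proof -
    have "int N = int ((\<Sum>i<p. length (fst (f i))) + 2 * m)" using iN by simp
    then show ?thesis by (simp only: of_nat_eq_iff)
  qed
  have m2: "2 * (k - l) * m \<le> n"
  proof -
    have "2 * m * (k - l) \<le> N * (k - l)" using Nm by (intro mult_le_mono1) simp
    then show ?thesis using N(1) by (simp add: mult_ac)
  qed
  obtain I where I: "\<forall>i<m - p. good (I i) \<and> I i \<inter> S = {}" "\<forall>i<m - p. \<forall>i'<i. I i \<inter> I i' = {}"
    "\<forall>x. x \<in> Ag \<or> x \<in> XB \<longrightarrow> real (card {i. i < m - p \<and> conflict x (I i)}) \<le> h * real n"
    using plain_items[OF finS cS4 m2, of "m - p"] by auto
  define g where "g t = (if t < p then f t else ([], I (t - p)))" for t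
  have gp: "g t = f t" if "t < p" for t using that by (simp add: g_def)
  have gq: "ivs (g t) = I (t - p)" "lend (g t) = I (t - p)" "snd (g t) = I (t - p)" "fst (g t) = []" if "p \<le> t" for t
    using that by (simp_all add: g_def ivs_def lend_def)
  have Igood: "good (I (t - p))" "I (t - p) \<inter> S = {}" if "p \<le> t" "t < m" for t using I(1) that by auto
  have val: "valid (g t)" if t: "t < m" for t
  proof (cases "t < p")
    case False
    then have "p \<le> t" by simp
    then show ?thesis using Igood[of t] t gq[of t] good_card[of "I (t - p)"] by (simp add: valid_def)
  qed (use f(1) gp in auto)
  have gdis: "ivs (g t) \<inter> ivs (g s) = {}" if "t < m" "s < t" for t s
  proof (cases "t < p")
    case True then show ?thesis using f(2) that gp by auto
  next
    case False
    then have pt: "p \<le> t" by simp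
    show ?thesis
    proof (cases "s < p")
      case True
      then have "ivs (g s) \<subseteq> S" using gp by (auto simp: S_def)
      then show ?thesis using Igood(2)[OF pt that(1)] gq(1)[OF pt] by auto
    next
      case False
      then have "t - p < m - p" "s - p < t - p" using that by auto
      then show ?thesis using I(2) gq(1)[OF pt] gq(1)[of s] False by auto
    qed
  qed
  have gY: "ivs (g t) \<inter> Y0 = {}" if "t < m" for t
  proof (cases "t < p")
    case True then show ?thesis using gp by (auto simp: Y0_def S_def)
  next
    case False
    then show ?thesis using Igood[of t] that gq(1)[of t] good_card(4)[of "I (t - p)"] sets by (auto simp: Y0_def)
  qed
  have S_sub: "S \<subseteq> (\<Union>t<m. ivs (g t))"
  proof
    fix x assume "x \<in> S"
    then obtain i where "i < p" "x \<in> ivs (f i)" by (auto simp: S_def)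
    then show "x \<in> (\<Union>t<m. ivs (g t))" using gp[of i] pm by (intro UN_I[of i]) auto
  qed
  have "{..<m} = {..<p} \<union> {p..<m}" using pm by auto
  then have "(\<Sum>t<m. length (fst (g t))) = (\<Sum>t<p. length (fst (g t))) + (\<Sum>t=p..<m. length (fst (g t)))"
    by (simp add: sum.union_disjoint ivl_disj_int)
  also have "(\<Sum>t<p. length (fst (g t))) = (\<Sum>i<p. length (fst (f i)))" using gp by simp
  also have "(\<Sum>t=p..<m. length (fst (g t))) = 0" using gq by simp
  finally have Nm': "(\<Sum>t<m. length (fst (g t))) + 2 * m = N" using Nm by simp
  have conf: "real (card {t. t < m \<and> conflict x (E' (g t))}) \<le> 2 * h * real n"
    if x: "x \<in> Ag \<or> x \<in> XB" and E': "\<And>t. p \<le> t \<Longrightarrow> E' (g t) = I (t - p)" for x E'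
  proof -
    \<comment> \<open>Conflicts with special items are not controlled, but there are at most
      \<open>h ^ 6 * n\<close> such items.\<close>
    have "{t. t < m \<and> conflict x (E' (g t))} \<subseteq> {..<p} \<union> (\<lambda>i. p + i) ` {i. i < m - p \<and> conflict x (I i)}"
    proof
      fix t assume t: "t \<in> {t. t < m \<and> conflict x (E' (g t))}"
      show "t \<in> {..<p} \<union> (\<lambda>i. p + i) ` {i. i < m - p \<and> conflict x (I i)}"
      proof (cases "t < p")
        case False
        then have "t = p + (t - p)" "t - p \<in> {i. i < m - p \<and> conflict x (I i)}" using t E'[of t] by auto
        then show ?thesis by blast
      qed simp
    qed
    then have "card {t. t < m \<and> conflict x (E' (g t))} \<le> card ({..<p} \<union> (\<lambda>i. p + i) ` {i. i < m - p \<and> conflict x (I i)})"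
      by (intro card_mono) auto
    also have "\<dots> \<le> p + card ((\<lambda>i. p + i) ` {i. i < m - p \<and> conflict x (I i)})"
      using card_Un_le[of "{..<p}"] by simp
    also have "\<dots> \<le> p + card {i. i < m - p \<and> conflict x (I i)}"
      using card_image_le[of "{i. i < m - p \<and> conflict x (I i)}"] by simp
    finally have "real (card {t. t < m \<and> conflict x (E' (g t))}) \<le> real p + real (card {i. i < m - p \<and> conflict x (I i)})"
      by linarith
    also have "\<dots> \<le> h ^ 6 * real n + h * real n" using f(5) I(3) x by (intro add_mono) auto
    also have "h ^ 6 * real n \<le> h ^ 1 * real n" by (intro mult_right_mono h_power_mono) auto
    finally show ?thesis by simp
  qed
  have "Y0 \<subseteq> Ag" using f(3) by (auto simp: Y0_def S_def)
  moreover have "m \<le> n"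
  proof -
    have "1 * m \<le> 2 * (k - l) * m" using l by (intro mult_le_mono1) simp
    then show ?thesis using m2 by linarith
  qed
  moreover have "XA \<subseteq> Y0 \<union> (\<Union>t<m. ivs (g t))" using S_sub by (auto simp: Y0_def)
  ultimately show ?thesis
    using m0 nm val gdis gY Nm' conf[where E' = snd] conf[where E' = lend] gq
    by (intro exI[of _ m] exI[of _ g] exI[of _ Y0]) (simp add: m_def)
qed

end

section \<open>Assembly of the cycle\<close>

lemma lend_subset: "lend it \<subseteq> ivs it"
  by (cases "fst it") (auto simp: lend_def ivs_def)

lemma snd_subset_ivs: "snd it \<subseteq> ivs it"
  by (auto simp: ivs_def)

context near_extremal
begin

theorem hamiltonian: "has_hamiltonian_ell_cycle k l V E"
proof -
  obtain m g Y0 where m: "0 < m" "m \<le> n" "real n \<le> 8 * real k * real m"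
    and val: "\<And>t. t < m \<Longrightarrow> valid (g t)" and dis: "\<And>t s. t < m \<Longrightarrow> s < t \<Longrightarrow> ivs (g t) \<inter> ivs (g s) = {}"
    and Y0: "Y0 \<subseteq> Ag" "card Y0 = m" "\<And>t. t < m \<Longrightarrow> ivs (g t) \<inter> Y0 = {}" "XA \<subseteq> Y0 \<union> (\<Union>t<m. ivs (g t))"
    and Nm: "(\<Sum>t<m. length (fst (g t))) + 2 * m = N"
    and cs: "\<And>x. x \<in> Ag \<or> x \<in> XB \<Longrightarrow> real (card {t. t < m \<and> conflict x (snd (g t))}) \<le> 2 * h * real n"
    and cl: "\<And>x. x \<in> Ag \<or> x \<in> XB \<Longrightarrow> real (card {t. t < m \<and> conflict x (lend (g t))}) \<le> 2 * h * real n"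
    using items_collection by blast
  define GU where "GU = (\<Union>t<m. ivs (g t))"
  define Z where "Z = XB - GU"
  define nx where "nx t = Suc t mod m" for t
  have nx: "nx t < m" for t using m(1) by (simp add: nx_def)
  have nx_inj: "inj_on nx {..<m}"
  proof (rule inj_onI)
    fix s t assume st: "s \<in> {..<m}" "t \<in> {..<m}" "nx s = nx t"
    then have "(1 + s) mod m = (1 + t) mod m" by (simp add: nx_def)
    then have "s mod m = t mod m" by (rule add_mod_eq_cancel_left)
    then show "s = t" using st by simp
  qed
  have gV: "ivs (g t) \<subseteq> V" if "t < m" for t using val[OF that] by (simp add: valid_def)
  have gfin: "finite (ivs (g t))" if "t < m" for t using gV[OF that] finV finite_subset by auto
  have gdis: "ivs (g t) \<inter> ivs (g s) = {}" if "t < m" "s < m" "t \<noteq> s" for t s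
    using dis that by (metis Int_commute linorder_neqE_nat)
  have GUV: "GU \<subseteq> V" using gV by (auto simp: GU_def)
  have finGU: "finite GU" using GUV finV finite_subset by auto
  have cGU: "card GU = (\<Sum>t<m. length (fst (g t))) * (k - l) + m * l"
  proof -
    have "card GU = (\<Sum>t<m. card (ivs (g t)))"
      unfolding GU_def using gfin gdis by (intro card_UN_disjoint) auto
    also have "\<dots> = (\<Sum>t<m. length (fst (g t)) * (k - l) + l)" using val by (intro sum.cong) (auto simp: valid_def)
    finally show ?thesis by (simp add: sum.distrib sum_distrib_right)
  qed
  have finZ: "finite Z" using sets by (simp add: Z_def)
  have Y0XA: "Y0 \<subseteq> XA" using Y0(1) Ag_XA by auto
  have finY0: "finite Y0" by (rule finite_subset[OF Y0XA sets(5)])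
  have VU: "V = Y0 \<union> GU \<union> Z" using Y0(4) Y0XA GUV sets by (auto simp: Z_def GU_def)
  have d1: "Y0 \<inter> GU = {}" using Y0(3) by (auto simp: GU_def)
  have d2: "(Y0 \<union> GU) \<inter> Z = {}" using Y0XA sets(8) by (auto simp: Z_def)
  have "n = m + card GU + card Z"
  proof -
    have "card V = card (Y0 \<union> GU) + card Z" unfolding VU using d2 finY0 finGU finZ by (intro card_Un_disjoint) auto
    also have "card (Y0 \<union> GU) = m + card GU" using d1 finY0 finGU Y0(2) by (subst card_Un_disjoint) auto
    finally show ?thesis using cV by simp
  qed
  moreover have "n = (\<Sum>t<m. length (fst (g t))) * (k - l) + m * (rr + l)"
    unfolding N(1) Nm[symmetric] rr(3) by (simp add: algebra_simps)
  ultimately have "card Z + m = m * rr" using cGU by (simp add: algebra_simps)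
  moreover have "m * rr = m * (rr - 1) + m" using rr(1) by (cases rr) auto
  \<comment> \<open>The vertices left over fill the remaining \<open>rr - 1\<close> places of all
    slots exactly.\<close>
  ultimately have cZ: "card Z = m * (rr - 1)" by simp
  obtain e where e: "bij_betw e {..<m * (rr - 1)} Z"
    using ex_bij_betw_nat_finite[OF finZ] cZ by (auto simp: atLeast0LessThan)
  define Y where "Y j = (if j = 0 then Y0 else e ` {(j - 1) * m..<j * m})" for j
  have blk: "{(j - 1) * m..<j * m} \<subseteq> {..<m * (rr - 1)}" if "0 < j" "j < rr" for j
  proof -
    have "j * m \<le> (rr - 1) * m" using that by (intro mult_le_mono1) simp
    also have "(rr - 1) * m = m * (rr - 1)" by (rule mult.commute)
    finally have "j * m \<le> m * (rr - 1)" .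
    then show ?thesis by (intro subsetI) (simp only: atLeastLessThan_iff lessThan_iff, linarith)
  qed
  have einj: "inj_on e {..<m * (rr - 1)}" and eim: "e ` {..<m * (rr - 1)} = Z" using e by (auto simp: bij_betw_def)
  have Ycard: "card (Y j) = m" if "j < rr" for j
  proof (cases "j = 0")
    case False
    then have "card (Y j) = card {(j - 1) * m..<j * m}"
      using card_image[OF inj_on_subset[OF einj blk[of j]]] that by (simp add: Y_def)
    also have "\<dots> = m" using False by (cases j) auto
    finally show ?thesis .
  qed (simp add: Y_def Y0)
  have YZ: "Y j \<subseteq> Z" if "0 < j" "j < rr" for j using blk[OF that] eim that by (auto simp: Y_def)
  have YZun: "\<exists>j. 0 < j \<and> j < rr \<and> z \<in> Y j" if z: "z \<in> Z" for z
  proof -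
    obtain x where x: "x < m * (rr - 1)" "z = e x" using z eim by auto
    define j where "j = Suc (x div m)"
    have "x div m < rr - 1" using x(1) by (simp add: less_mult_imp_div_less mult.commute)
    moreover have "x \<in> {(j - 1) * m..<j * m}"
      using m(1) dividend_less_div_times[of m x] by (simp add: j_def mult.commute)
    ultimately show ?thesis using x(2) by (intro exI[of _ j]) (auto simp: Y_def j_def)
  qed
  have Ydis: "Y i \<inter> Y j = {}" if "i < j" "j < rr" for i j
  proof (cases "i = 0")
    case True
    then show ?thesis using YZ[of j] that d2 by (auto simp: Y_def)
  next
    case False
    have "i * m \<le> (j - 1) * m" using that by (intro mult_le_mono1) simp
    then have dj: "{(i - 1) * m..<i * m} \<inter> {(j - 1) * m..<j * m} = {}" by auto
    have "e ` ({(i - 1) * m..<i * m} \<inter> {(j - 1) * m..<j * m}) = e ` {(i - 1) * m..<i * m} \<inter> e ` {(j - 1) * m..<j * m}"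
      using blk[of i] blk[of j] False that by (intro inj_on_image_Int[OF einj]) auto
    then show ?thesis unfolding dj using False that by (simp add: Y_def)
  qed
  have cl': "real (card {t. t < m \<and> conflict x (lend (g (nx t)))}) \<le> 2 * h * real n" if x: "x \<in> Ag \<or> x \<in> XB" for x
  proof -
    have "card {t. t < m \<and> conflict x (lend (g (nx t)))} \<le> card {t. t < m \<and> conflict x (lend (g t))}"
      using nx_inj nx by (intro card_inj_on_le[of nx]) (auto simp: inj_on_def)
    then show ?thesis using cl[OF x] by linarith
  qed
  have "\<exists>F. (\<forall>j<rr. bij_betw (F j) {..<m} (Y j)) \<and>
    (\<forall>t<m. \<not> ne (insert (F 0 t) (snd (g t) \<union> (\<lambda>j. F j t) ` {1..<k - l}))
         \<and> \<not> ne (insert (F 0 t) (lend (g (nx t)) \<union> (\<lambda>j. F j t) ` {k - 2 * l + 1..<rr})))"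
  proof (rule fill_slots[OF m(2,3) _ _ cs cl' Ycard])
    show "good (snd (g t))" if "t < m" for t using val[OF that] by (simp add: valid_def)
    show "good (lend (g (nx t)))" if "t < m" for t using val[OF nx] by (simp add: valid_def)
    show "Y 0 \<subseteq> Ag" using Y0 by (simp add: Y_def)
    show "Y j \<subseteq> XB" if "0 < j" "j < rr" for j using YZ[OF that] by (auto simp: Z_def)
  qed
  then obtain F where F: "\<And>j. j < rr \<Longrightarrow> bij_betw (F j) {..<m} (Y j)"
    "\<And>t. t < m \<Longrightarrow> \<not> ne (insert (F 0 t) (snd (g t) \<union> (\<lambda>j. F j t) ` {1..<k - l}))"
    "\<And>t. t < m \<Longrightarrow> \<not> ne (insert (F 0 t) (lend (g (nx t)) \<union> (\<lambda>j. F j t) ` {k - 2 * l + 1..<rr}))" by auto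
  have FY: "F j t \<in> Y j" if "j < rr" "t < m" for j t using bij_betwE[OF F(1)[OF that(1)]] that(2) by simp
  have rr0: "0 < rr" using rr by simp
  have F0: "F 0 t \<in> Y0" if "t < m" for t using FY[OF rr0 that] by (simp add: Y_def)
  have FZ: "F j t \<in> Z" if "0 < j" "j < rr" "t < m" for j t using FY[of j t] YZ[of j] that by auto
  have Finj: "inj_on (\<lambda>j. F j t) {..<rr}" if t: "t < m" for t
  proof (rule inj_onI)
    fix i j assume ij: "i \<in> {..<rr}" "j \<in> {..<rr}" "F i t = F j t"
    show "i = j"
    proof (rule ccontr)
      assume "i \<noteq> j"
      then have "Y i \<inter> Y j = {}" using Ydis[of i j] Ydis[of j i] ij by (auto simp: neq_iff)
      then show False using FY[of i t] FY[of j t] ij t by auto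
    qed
  qed
  have cF: "card ((\<lambda>j. F j t) ` I) = card I" if "I \<subseteq> {..<rr}" "t < m" for I t
    using card_image[OF inj_on_subset[OF Finj[OF that(2)] that(1)]] .
  \<comment> \<open>After the end \<open>snd (g t)\<close> of an item come \<open>J t\<close>, the
    \<open>l\<close>-set \<open>I1 t\<close> shared by the two edges of the slot,
    \<open>J' t\<close>, and the first \<open>l\<close>-set of the next item.\<close>
  define J where "J t = (\<lambda>j. F j t) ` {1..<k - 2 * l + 1}" for t
  define I1 where "I1 t = insert (F 0 t) ((\<lambda>j. F j t) ` {k - 2 * l + 1..<k - l})" for t
  define J' where "J' t = (\<lambda>j. F j t) ` {k - l..<rr}" for t
  have edge_ok: "insert (F 0 t) (G \<union> (\<lambda>j. F j t) ` I) \<in> E"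
    if nb: "\<not> ne (insert (F 0 t) (G \<union> (\<lambda>j. F j t) ` I))" and t: "t < m" and G: "G \<subseteq> GU" "card G = l"
      and I: "I \<subseteq> {1..<rr}" "card I = k - l - 1" for t G I
  proof -
    let ?FI = "(\<lambda>j. F j t) ` I"
    have FI: "?FI \<subseteq> Z" using FZ t I(1) by auto
    have "I \<subseteq> {..<rr}" using I(1) by auto
    then have c: "card ?FI = k - l - 1" using cF[of I t] I(2) t by simp
    have "finite I" using I(1) finite_subset by auto
    have "F 0 t \<notin> G \<union> ?FI" using F0[OF t] d1 d2 G(1) FI by auto
    moreover have "card (G \<union> ?FI) = l + (k - l - 1)"
      using G FI d2 finGU finite_subset[OF G(1)] c \<open>finite I\<close> by (subst card_Un_disjoint) auto
    ultimately have "card (insert (F 0 t) (G \<union> ?FI)) = k"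
      using l finite_subset[OF G(1) finGU] \<open>finite I\<close> by simp
    moreover have "insert (F 0 t) (G \<union> ?FI) \<subseteq> V" using F0[OF t] G(1) FI VU by auto
    ultimately show ?thesis using nb by (simp add: ne_def)
  qed
  have sG: "snd (g t) \<subseteq> GU" "lend (g t) \<subseteq> GU" "card (snd (g t)) = l" "card (lend (g t)) = l" if "t < m" for t
    using lend_subset[of "g t"] snd_subset_ivs[of "g t"] that val[OF that] good_card(1) by (auto simp: GU_def valid_def)
  have e1: "snd (g t) \<union> J t \<union> I1 t \<in> E" if t: "t < m" for t
  proof -
    have "insert (F 0 t) (snd (g t) \<union> (\<lambda>j. F j t) ` {1..<k - l}) \<in> E"
      using rr(1) sG[OF t] t by (intro edge_ok[OF F(2)]) auto
    moreover have "{1..<k - l} = {1..<k - 2 * l + 1} \<union> {k - 2 * l + 1..<k - l}" using l by auto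
    ultimately show ?thesis by (simp add: J_def I1_def image_Un Un_ac)
  qed
  have e2: "I1 t \<union> J' t \<union> lend (g (nx t)) \<in> E" if t: "t < m" for t
  proof -
    have "rr - (k - 2 * l + 1) = k - l - 1" using l by (simp add: rr_def)
    then have "insert (F 0 t) (lend (g (nx t)) \<union> (\<lambda>j. F j t) ` {k - 2 * l + 1..<rr}) \<in> E"
      using sG[OF nx] t by (intro edge_ok[OF F(3)]) auto
    moreover have "{k - 2 * l + 1..<rr} = {k - 2 * l + 1..<k - l} \<union> {k - l..<rr}" using l rr(1) by auto
    ultimately show ?thesis by (simp add: J'_def I1_def image_Un Un_ac)
  qed
  define u where "u t = fst (g t) @ [(snd (g t), J t), (I1 t, J' t)]" for t
  define bl where "bl = concat (map u [0..<m])"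
  have len: "length bl = N"
  proof -
    have "length bl = (\<Sum>t<m. length (u t))"
      by (simp add: bl_def length_concat o_def interv_sum_list_conv_sum_set_nat atLeast0LessThan)
    also have "\<dots> = (\<Sum>t<m. length (fst (g t)) + 2)" by (simp add: u_def)
    also have "\<dots> = (\<Sum>t<m. length (fst (g t))) + 2 * m" by (simp only: sum.distrib sum_constant card_lessThan of_nat_id mult.commute)
    finally show ?thesis using Nm by simp
  qed
  have us: "successively (link E) (u t)" if t: "t < m" for t
  proof -
    have "successively (link E) (fst (g t) @ [(snd (g t), J t)])"
    proof (rule successively_link_snd)
      show "successively (link E) (fst (g t) @ [(snd (g t), {})])" using val[OF t] by (simp add: valid_def)
    qed
    then have "successively (link E) ((fst (g t) @ [(snd (g t), J t)]) @ [(I1 t, J' t)])"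
      using e1[OF t] by (subst successively_append_iff) (simp add: link_def)
    then show ?thesis by (simp add: u_def)
  qed
  have hdu: "fst (hd (u t)) = lend (g t)" for t
    by (cases "fst (g t)") (simp_all add: u_def lend_def)
  have ul: "link E (last (u t)) (hd (u (Suc t mod m)))" if t: "t < m" for t
    using e2[OF t] hdu[of "nx t"] by (simp add: link_def u_def nx_def)
  have mem: "q \<in> set bl \<longleftrightarrow> (\<exists>t<m. q \<in> set (fst (g t)) \<or> q = (snd (g t), J t) \<or> q = (I1 t, J' t))" for q
    by (auto simp: bl_def u_def)
  show ?thesis
  proof (rule hamiltonian_ell_cycle_of_blocks[OF H l len])
    show "card V = N * (k - l)" using cV N(1) by simp
    show "2 * k \<le> card V" using cV n_big by simp
    show "link E (bl ! i) (bl ! (Suc i mod N))" if "i < N" for i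
      using successively_concat_cyclic[of m u "link E" bl i, OF m(1) _ us ul bl_def] that len by (simp add: u_def)
    have c: "card (J t) = k - 2 * l" "card (I1 t) = l" "card (J' t) = k - 2 * l" if t: "t < m" for t
    proof -
      show "card (J t) = k - 2 * l" unfolding J_def using rr(1) t l by (subst cF) auto
      show "card (J' t) = k - 2 * l" unfolding J'_def using t l by (subst cF) (auto simp: rr_def)
      have "F 0 t \<notin> (\<lambda>j. F j t) ` {k - 2 * l + 1..<k - l}"
      proof
        assume "F 0 t \<in> (\<lambda>j. F j t) ` {k - 2 * l + 1..<k - l}"
        then obtain j where j: "k - 2 * l + 1 \<le> j" "j < k - l" "F 0 t = F j t" by auto
        then show False using F0[OF t] FZ[of j t] d2 rr(1) t by auto
      qed
      moreover have "card ((\<lambda>j. F j t) ` {k - 2 * l + 1..<k - l}) = l - 1"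
        using rr(1) t l by (subst cF) auto
      ultimately show "card (I1 t) = l" unfolding I1_def using l by simp
    qed
    show "card (fst q) = l" if q: "q \<in> set bl" for q
    proof -
      obtain t where t: "t < m" "q \<in> set (fst (g t)) \<or> q = (snd (g t), J t) \<or> q = (I1 t, J' t)"
        using iffD1[OF mem q] by (elim exE conjE) (rule that)
      have "\<forall>q\<in>set (fst (g t)). card (fst q) = l" using val[OF t(1)] by (simp add: valid_def)
      then show ?thesis using t(2) c(2)[OF t(1)] sG(3)[OF t(1)] by auto
    qed
    show "card (snd q) = k - 2 * l" if q: "q \<in> set bl" for q
    proof -
      obtain t where t: "t < m" "q \<in> set (fst (g t)) \<or> q = (snd (g t), J t) \<or> q = (I1 t, J' t)"
        using iffD1[OF mem q] by (elim exE conjE) (rule that)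
      have "\<forall>q\<in>set (fst (g t)). card (snd q) = k - 2 * l" using val[OF t(1)] by (simp add: valid_def)
      then show ?thesis using t(2) c(1,3)[OF t(1)] by auto
    qed
    show "(\<Union>q\<in>set bl. fst q \<union> snd q) = V"
    proof
      show "(\<Union>q\<in>set bl. fst q \<union> snd q) \<subseteq> V"
      proof
        fix x assume "x \<in> (\<Union>q\<in>set bl. fst q \<union> snd q)"
        then obtain q where q: "q \<in> set bl" "x \<in> fst q \<union> snd q" by blast
        then obtain t where t: "t < m" "q \<in> set (fst (g t)) \<or> q = (snd (g t), J t) \<or> q = (I1 t, J' t)"
          using mem by blast
        have F_V: "F j t \<in> V" if "j < rr" for j
          using F0[OF t(1)] FZ[of j t] that t(1) VU by (cases "j = 0") auto
        have "J t \<subseteq> V" "I1 t \<subseteq> V" "J' t \<subseteq> V" using F_V rr(1) l by (auto simp: J_def I1_def J'_def)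
        moreover have "fst q \<union> snd q \<subseteq> V" if "q \<in> set (fst (g t))" using that gV[OF t(1)] by (auto simp: ivs_def)
        moreover have "snd (g t) \<subseteq> V" using sG(1)[OF t(1)] GUV by auto
        ultimately show "x \<in> V" using q(2) t(2) by auto
      qed
      show "V \<subseteq> (\<Union>q\<in>set bl. fst q \<union> snd q)"
      proof
        fix x assume "x \<in> V"
        then consider "x \<in> GU" | j where "j < rr" "x \<in> Y j" using VU YZun rr0 by (auto simp: Y_def)
        then show "x \<in> (\<Union>q\<in>set bl. fst q \<union> snd q)"
        proof cases
          case 1
          then obtain t where t: "t < m" "x \<in> ivs (g t)" by (auto simp: GU_def)
          then have "(\<exists>q\<in>set (fst (g t)). x \<in> fst q \<union> snd q) \<or> x \<in> snd (g t)" by (auto simp: ivs_def)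
          then show ?thesis
          proof
            assume "\<exists>q\<in>set (fst (g t)). x \<in> fst q \<union> snd q"
            then obtain q where "q \<in> set (fst (g t))" "x \<in> fst q \<union> snd q" by blast
            then show ?thesis using t(1) mem[of q] by blast
          next
            assume "x \<in> snd (g t)"
            then show ?thesis using t(1) mem[of "(snd (g t), J t)"] by (intro UN_I[of "(snd (g t), J t)"]) auto
          qed
        next
          case 2
          then have "x \<in> F j ` {..<m}" using F(1)[of j] by (simp add: bij_betw_def)
          then obtain t where t: "t < m" "x = F j t" by auto
          consider "j = 0 \<or> (k - 2 * l + 1 \<le> j \<and> j < k - l)" | "1 \<le> j" "j < k - 2 * l + 1" | "k - l \<le> j" by linarith
          then have "x \<in> J t \<or> x \<in> I1 t \<union> J' t"
            by cases (use t 2 in \<open>auto simp: J_def I1_def J'_def\<close>)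
          then show ?thesis
          proof
            assume "x \<in> J t"
            then show ?thesis using t(1) mem[of "(snd (g t), J t)"] by (intro UN_I[of "(snd (g t), J t)"]) auto
          next
            assume "x \<in> I1 t \<union> J' t"
            then show ?thesis using t(1) mem[of "(I1 t, J' t)"] by (intro UN_I[of "(I1 t, J' t)"]) auto
          qed
        qed
      qed
    qed
  qed
qed

end

section \<open>The extremal threshold\<close>

text \<open>A pair missing at \<open>S\<close> lies in \<open>B\<close>, and so does
  \<open>S\<close>. For \<open>l = 1\<close> and even \<open>N\<close> the set \<open>F\<close> has
  just two vertices, so \<open>S\<close> can be completed to contain \<open>F\<close> by a pair in
  \<open>B\<close>; that pair is not missing, which raises the bound by 1.\<close>

lemma degree_X_edges_ge:
  assumes k: "3 \<le> k" and l: "1 \<le> l" "2 * l < k" and n: "n = N * (k - l)" and N: "N = 2 * a + 1 \<or> N = 2 * a + 2"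
    and b: "a + b = n" "k \<le> b" and S: "S \<subseteq> {..<n}" "card S = k - 2"
  shows "((n - (k - 2)) choose 2) + (if l = 1 \<and> even N then 1 else 0)
    \<le> degree (X_edges k l n) S + ((b - (k - 2)) choose 2)"
proof -
  define d where "d = k - l"
  have d0: "0 < d" using l by (simp add: d_def)
  have nd: "n div d = N" using n d0 by (simp add: d_def)
  have n2: "n div (2 * d) = N div 2" using nd div_mult2_eq[of n d 2] by (simp add: mult.commute)
  have H: "uniform_hypergraph k {..<n} (X_edges k l n)"
    by (auto simp: uniform_hypergraph_def X_edges_def Let_def)
  have XA: "e \<in> X_edges k l n" if "e \<subseteq> {..<n}" "card e = k" "e \<inter> {..<a} \<noteq> {}" for e
  proof (cases "odd N")
    case True
    then have "N div 2 = a" using N by auto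
    then show ?thesis using that True by (simp add: X_edges_def nd n2 flip: d_def)
  next
    case False
    then have "N div 2 - 1 = a" using N by auto
    then show ?thesis using that False by (simp add: X_edges_def Let_def nd n2 flip: d_def)
  qed
  have XB: "e \<in> X_edges k l n" if "e \<subseteq> {..<n} - {..<a}" "card e = k" "{a..a + l} \<subseteq> e" "even N" for e
  proof -
    have "N div 2 - 1 = a" using N that(4) by auto
    then show ?thesis using that by (simp add: X_edges_def Let_def nd n2 flip: d_def)
  qed
  have finS: "finite S" using S(1) finite_subset by auto
  define NN where "NN = {P. P \<subseteq> {..<n} - S \<and> card P = 2 \<and> S \<union> P \<notin> X_edges k l n}"
  define BB where "BB = {..<n} - {..<a}"
  have BB: "x \<in> BB \<longleftrightarrow> a \<le> x \<and> x < n" for x by (auto simp: BB_def)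
  have finBB: "finite BB" by (simp add: BB_def)
  let ?PB = "{P. P \<subseteq> BB - S \<and> card P = 2}"
  have cU: "card (S \<union> P) = k" if "P \<subseteq> {..<n} - S" "card P = 2" for P
    using that finS S(2) k finite_subset[OF that(1)] by (subst card_Un_disjoint) auto
  have N_sub: "S \<inter> {..<a} = {} \<and> P \<in> ?PB" if "P \<in> NN" for P
  proof -
    have P: "P \<subseteq> {..<n} - S" "card P = 2" "S \<union> P \<notin> X_edges k l n" using that by (auto simp: NN_def)
    have "S \<union> P \<subseteq> {..<n}" using S(1) P(1) by auto
    then have "(S \<union> P) \<inter> {..<a} = {}" using XA[of "S \<union> P"] cU[OF P(1,2)] P(3) by blast
    then show ?thesis using P unfolding BB_def by blast
  qed
  have cB: "card BB = b" using b by (simp add: BB_def card_Diff_subset)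
  have "0 < (b - (k - 2)) choose 2" using b k by (intro zero_less_binomial) auto
  then have pos: "1 \<le> (b - (k - 2)) choose 2" by (simp only: One_nat_def Suc_le_eq)
  have "card NN + (if l = 1 \<and> even N then 1 else 0) \<le> (b - (k - 2)) choose 2"
  proof (cases "S \<inter> {..<a} = {}")
    \<comment> \<open>\<open>S\<close> meets \<open>A\<close>, so no pair is missing and one pair
      inside \<open>B\<close> pays for the extra 1.\<close>
    case False
    then have "NN = {}" using N_sub by blast
    then have "card NN = 0" by simp
    moreover have "(if l = 1 \<and> even N then 1 else 0) \<le> (1 :: nat)" by simp
    ultimately show ?thesis using pos by linarith
  next
    case True
    then have SB: "S \<subseteq> BB" using S(1) unfolding BB_def by blast
    have cBS: "card (BB - S) = b - (k - 2)" using SB finS S(2) cB by (simp add: card_Diff_subset)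
    have cPB: "card ?PB = (b - (k - 2)) choose 2" using n_subsets[of "BB - S" 2] cBS finBB by simp
    have finPB: "finite ?PB" using finBB by simp
    show ?thesis
    proof (cases "l = 1 \<and> even N")
      case False
      have "card NN \<le> card ?PB" using N_sub finPB by (intro card_mono) auto
      then show ?thesis using cPB False by auto
    next
      case l1: True
      have "card ({a, a + 1} - S) \<le> card {a, a + 1}" by (intro card_mono) auto
      then have "card ({a, a + 1} - S) \<le> 2" by simp
      moreover have "2 \<le> card (BB - S)" using cBS b k by simp
      moreover have "{a, a + 1} - S \<subseteq> BB - S" using b k by (auto simp: BB)
      ultimately obtain P0 where P0: "{a, a + 1} - S \<subseteq> P0" "P0 \<subseteq> BB - S" "card P0 = 2"
        using exists_subset_between[of "{a, a + 1} - S" 2 "BB - S"] finBB by auto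
      have "{a..a + l} = {a, a + 1}" using l1 by auto
      then have "{a..a + l} \<subseteq> S \<union> P0" using P0(1) by auto
      moreover have "card (S \<union> P0) = k" using P0 by (intro cU) (auto simp: BB)
      ultimately have "S \<union> P0 \<in> X_edges k l n" using XB[of "S \<union> P0"] P0(2) SB l1 unfolding BB_def by blast
      then have "NN \<subseteq> ?PB - {P0}" using N_sub by (auto simp: NN_def)
      then have "card NN \<le> card (?PB - {P0})" using finPB by (intro card_mono) auto
      also have "\<dots> = card ?PB - 1" using P0 by (intro card_Diff_singleton) simp
      finally have "card NN \<le> card ?PB - 1" .
      then show ?thesis using cPB pos by (simp only: if_P[OF l1])
    qed
  qed
  moreover have "degree (X_edges k l n) S + card NN = (n - (k - 2)) choose 2"
    using degree_plus_missing_pairs[OF H _ S] k by (simp add: NN_def)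
  ultimately show ?thesis by linarith
qed

section \<open>Constants and the choice of the partition\<close>

lemma min_degree_le:
  assumes "finite V" "S \<subseteq> V" "card S = s"
  shows "min_degree s V E \<le> degree E S"
  unfolding min_degree_def using assms by (intro Min_le) auto

lemma min_degree_attained:
  assumes "finite V" "s \<le> card V"
  obtains S where "S \<subseteq> V" "card S = s" "min_degree s V E = degree E S"
proof -
  obtain S0 where "S0 \<subseteq> V" "card S0 = s" using assms(2) by (meson obtain_subset_with_card_n)
  then have "min_degree s V E \<in> degree E ` {S. S \<subseteq> V \<and> card S = s}"
    unfolding min_degree_def using assms(1) by (intro Min_in) auto
  then show ?thesis using that by auto
qed

theorem theorem1p4:
  fixes k l :: nat
  assumes "k \<ge> 3" and "1 \<le> l" and "real l < real k / 2"
  shows "\<exists>\<xi>::real. \<xi> > 0 \<and>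
    (\<exists>n0::nat. \<forall>n\<ge>n0. \<forall>(V :: 'a set) E.
      uniform_hypergraph k V E \<longrightarrow> card V = n \<longrightarrow> (k - l) dvd n \<longrightarrow>
      extremal k l \<xi> V E \<longrightarrow>
      min_degree (k - 2) V E > min_degree (k - 2) {..<n} (X_edges k l n) \<longrightarrow>
      has_hamiltonian_ell_cycle k l V E)"
proof -
  \<comment> \<open>The largest value that \<open>near_extremal\<close> admits; \<open>\<xi>\<close>
    will be \<open>h ^ 11\<close>, the density in \<open>sparse\<close>.\<close>
  define h where "h = 1 / (16 * real k) ^ (4 * k)"
  have h0: "0 < h" using assms(1) by (simp add: h_def)
  have l2: "2 * l < k" using assms(3) by linarith
  \<comment> \<open>The first term secures \<open>big\<close>; \<open>4 * k\<close> ensures that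
    \<open>B\<close> has at least \<open>k\<close> vertices.\<close>
  define n0 where "n0 = nat \<lceil>1 / h ^ 20\<rceil> + 4 * k"
  have main: "has_hamiltonian_ell_cycle k l V E"
    if n: "n0 \<le> n" and H: "uniform_hypergraph k V E" and cV: "card V = n" and dv: "(k - l) dvd n"
      and ex: "extremal k l (h ^ 11) V E"
      and md: "min_degree (k - 2) V E > min_degree (k - 2) {..<n} (X_edges k l n)"
    for n and V :: "'a set" and E
  proof -
    have finV: "finite V" using H by (simp add: uniform_hypergraph_def)
    have nk: "4 * k \<le> n" using n by (simp add: n0_def)
    obtain N where N: "n = N * (k - l)" using dv by (metis dvd_div_mult_self)
    obtain A1 B1 where AB1: "A1 \<union> B1 = V" "A1 \<inter> B1 = {}"
      and cA: "int (card A1) = \<lceil>real n / (2 * (real k - real l)) - 1\<rceil>"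
      and eB: "real (edges_within E B1) \<le> h ^ 11 * real (n choose k)"
      using ex cV unfolding extremal_def by auto
    define D where "D = real k - real l"
    have "0 < D" "real n = real N * D" using l2 by (auto simp: D_def N of_nat_diff)
    then have e: "real n / (2 * D) = real N / 2" by simp
    \<comment> \<open>The ceiling encodes the parity of \<open>N\<close>:
      \<open>2 * card A1 + 1\<close> if odd, \<open>2 * card A1 + 2\<close> if even.\<close>
    have "int (card A1) = \<lceil>real N / 2 - 1\<rceil>" using cA unfolding D_def[symmetric] e .
    then have "real (card A1) - 1 < real N / 2 - 1" "real N / 2 - 1 \<le> real (card A1)"
      using ceiling_correct[of "real N / 2 - 1"] by (metis of_int_of_nat_eq)+
    then have N2: "N = 2 * card A1 + 1 \<or> N = 2 * card A1 + 2" by linarith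
    \<comment> \<open>A partition with fewest edges in \<open>B\<close> among those with
      \<open>card A = card A1\<close> is at least as sparse as the given one.\<close>
    define P where "P x \<longleftrightarrow> fst x \<union> snd x = V \<and> fst x \<inter> snd x = {} \<and> card (fst x) = card A1" for x :: "'a set \<times> 'a set"
    have "P (A1, B1)" using AB1 by (simp add: P_def)
    then obtain x where x: "P x" "\<forall>y. P y \<longrightarrow> edges_within E (snd x) \<le> edges_within E (snd y)"
      using ex_has_least_nat[of P "(A1, B1)" "\<lambda>x. edges_within E (snd x)"] by blast
    define A where "A = fst x"
    define B where "B = snd x"
    have PAB: "A \<union> B = V" "A \<inter> B = {}" "card A = card A1" using x(1) by (auto simp: P_def A_def B_def)
    have min: "edges_within E B \<le> edges_within E B'" if "A' \<union> B' = V" "A' \<inter> B' = {}" "card A' = card A" for A' B'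
      using x(2) that PAB(3) by (auto simp: P_def B_def dest: spec[of _ "(A', B')"])
    have cb: "card A + card B = n"
      using PAB finV cV card_Un_disjoint[of A B] by auto
    have "2 \<le> k - l" using l2 assms(1) by linarith
    then have "N * 2 \<le> n" unfolding N by (rule mult_le_mono2)
    then have kb: "k \<le> card B" using cb N2 PAB(3) nk by linarith
    \<comment> \<open>One unit comes from the strict degree inequality, the second from the extra 1
      in \<open>degree_X_edges_ge\<close>.\<close>
    define \<kappa> :: nat where "\<kappa> = (if l = 1 \<and> even N then 2 else 1)"
    interpret degree_condition k n \<kappa> V A B E
    proof
      fix S assume S: "S \<subseteq> V" "card S = k - 2"
      have "k - 2 \<le> card {..<n}" using nk by simp
      then obtain T where T: "T \<subseteq> {..<n}" "card T = k - 2"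
        "min_degree (k - 2) {..<n} (X_edges k l n) = degree (X_edges k l n) T"
        using min_degree_attained[of "{..<n}" "k - 2" "X_edges k l n"] by blast
      have "((n - (k - 2)) choose 2) + (if l = 1 \<and> even N then 1 else 0)
         \<le> degree (X_edges k l n) T + ((card B - (k - 2)) choose 2)"
        using N2 PAB(3) by (intro degree_X_edges_ge[OF assms(1,2) l2 N _ cb kb T(1,2)]) simp
      moreover have "degree (X_edges k l n) T < degree E S"
        using md min_degree_le[OF finV S, of E] T(3) by linarith
      ultimately show "((n - (k - 2)) choose 2) + \<kappa> \<le> degree E S + ((card B - (k - 2)) choose 2)"
        by (auto simp: \<kappa>_def)
    qed (use H cV PAB assms in auto)
    interpret near_extremal k n \<kappa> V A B E l N h
    proof
      show "1 \<le> l" "2 * l < k" using assms l2 by auto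
      show "n = N * (k - l)" by (rule N)
      show "N = 2 * card A + 1 \<or> N = 2 * card A + 2" using N2 PAB(3) by simp
      show "0 < h" by (rule h0)
      show "h * (16 * real k) ^ (4 * k) \<le> 1" using assms(1) by (simp add: h_def)
      show "1 \<le> h ^ 20 * real n"
      proof -
        have "1 / h ^ 20 \<le> real n" using n unfolding n0_def by linarith
        then show ?thesis using h0 by (simp add: field_simps)
      qed
      have "edges_within E B \<le> edges_within E B1" using min[of A1 B1] AB1 PAB(3) by simp
      then have "real (wB k {}) \<le> fact k * (h ^ 11 * real (n choose k))"
        using wB_eq[of "{}" k] eB by (simp add: edges_within_def)
      also have "\<dots> = h ^ 11 * real ((n choose k) * fact k)" by simp
      also have "\<dots> \<le> h ^ 11 * real (n ^ k)"
        using binomial_fact_pow[of n k] h0 by (intro mult_left_mono of_nat_mono) auto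
      finally show "real (wB k {}) \<le> h ^ 11 * real n ^ k" by simp
      show "edges_within E B \<le> edges_within E B'" if "A' \<union> B' = V" "A' \<inter> B' = {}" "card A' = card A" for A' B'
        using min that by blast
      show "1 \<le> \<kappa>" "l = 1 \<Longrightarrow> even N \<Longrightarrow> 2 \<le> \<kappa>" by (auto simp: \<kappa>_def)
    qed
    show ?thesis by (rule hamiltonian)
  qed
  show ?thesis using main h0 by (intro exI[of _ "h ^ 11"] exI[of _ n0] conjI) auto
qed

end
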